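(* Let $(R,\mathfrak m)$ be a noetherian local domain of prime characteristic $p>0$ and Krull dimension $d$ whose Frobenius endomorphism is a finite map. Let $I,J$ be ideals of $R$ such that $I+J$ is $\mathfrak m$-primary. For $n\in\mathbb N$ and $s\in\mathbb R$ set $$h_{n,I,J}(s)=l\!\left(\frac{R}{(I^{\lceil sp^n\rceil}+J^{[p^n]})R}\right).$$ (1) There is a function $h_{I,J}:\mathbb R\to\mathbb R$ such that for every interval $[s_1,s_2]\subseteq\mathbb R$ there is a constant $C$, depending only on $s_1,s_2$ (for the given $R,I,J$), with $$\left|h_{I,J}(s)-\frac{h_{n,I,J}(s)}{p^{nd}}\right|\le\frac{C}{p^n}\quad\text{for all } s\in[s_1,s_2]\text{ and all } n\in\mathbb N.$$ Consequently the sequence of functions $h_{n,I,J}(s)/p^{nd}$ converges to $h_{I,J}(s)$, and the convergence is uniform on every compact subset of $\mathbb R$. (2) Given real numbers $s_2>s_1>0$, there is a constant $C'$, depending only on $s_1,s_2$ (for the given $R,I,J$), such that for all $x,y\in[s_1,s_2]$, $$|h_{I,J}(x)-h_{I,J}(y)|\le C'|x-y|.$$ That is, away from zero, $h_{I,J}$ is locally Lipschitz continuous.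
   Context: $l(-)$ denotes the length of an $R$-module. For an ideal $J$, $J^{[p^n]}$ is the ideal generated by $\{f^{p^n}\mid f\in J\}$. By convention, a nonpositive power of an ideal is the unit ideal. $\mathbb N$ is the set of nonnegative integers. *)

theory Defs
  imports
    "HOL-Algebra.Algebra"
    "HOL-Library.Extended_Nat"
    "HOL-Analysis.Uniform_Limit"
begin

text \<open>The length of a module is the supremum of the lengths \<open>n\<close> of strictly increasing chains
  \<open>N 0 \<subset> \<dots> \<subset> N n\<close> of submodules; it is \<open>\<infinity>\<close> if these lengths are unbounded.\<close>

definition module_length :: "('a, 'c) ring_scheme \<Rightarrow> ('a, 'b, 'd) module_scheme \<Rightarrow> enat" where
  "module_length R M =
     Sup {enat n | n. \<exists>N :: nat \<Rightarrow> 'b set.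
       (\<forall>i\<le>n. submodule (N i) R M) \<and> (\<forall>i<n. N i \<subset> N (Suc i))}"

definition finitely_generated_module :: "('a, 'c) ring_scheme \<Rightarrow> ('a, 'b, 'd) module_scheme \<Rightarrow> bool" where
  "finitely_generated_module R M \<longleftrightarrow>
     (\<exists>A \<subseteq> carrier M. finite A \<and> \<Inter>{N. submodule N R M \<and> A \<subseteq> N} = carrier M)"

text \<open>The ring \<open>S\<close>, viewed as a module over the source of a ring homomorphism \<open>\<phi>\<close> into \<open>S\<close>.\<close>

definition module_via :: "('a \<Rightarrow> 'b) \<Rightarrow> ('b, 'c) ring_scheme \<Rightarrow> ('a, 'b) module" where
  "module_via \<phi> S =
     \<lparr>carrier = carrier S, monoid.mult = monoid.mult S, one = one S, ring.zero = ring.zero S, add = add S,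
      smult = (\<lambda>a x. \<phi> a \<otimes>\<^bsub>S\<^esub> x)\<rparr>"

lemma module_via_is_module:
  assumes "cring R" "cring S" "\<phi> \<in> ring_hom R S"
  shows "Module.module R (module_via \<phi> S)"
proof -
  interpret R: cring R by fact
  interpret S: cring S by fact
  note hom = ring_hom_closed[OF assms(3)] ring_hom_add[OF assms(3)]
    ring_hom_mult[OF assms(3)] ring_hom_one[OF assms(3)]
  show ?thesis
    by (rule moduleI, rule assms(1), rule abelian_groupI)
      (auto simp: module_via_def hom S.l_distr S.r_distr S.m_assoc S.add.m_ac
        intro: S.l_neg)
qed

definition quotient_module :: "('a, 'c) ring_scheme \<Rightarrow> 'a set \<Rightarrow> ('a, 'a set) module" where
  "quotient_module R I = module_via (\<lambda>a. I +>\<^bsub>R\<^esub> a) (R Quot I)"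

lemma quotient_module_is_module:
  assumes "cring R" "ideal I R"
  shows "Module.module R (quotient_module R I)"
  unfolding quotient_module_def
  by (intro module_via_is_module assms ideal.quotient_is_cring ideal.rcos_ring_hom)

definition finite_ring_hom :: "('a, 'c) ring_scheme \<Rightarrow> ('b, 'd) ring_scheme \<Rightarrow> ('a \<Rightarrow> 'b) \<Rightarrow> bool" where
  "finite_ring_hom R S \<phi> \<longleftrightarrow>
     \<phi> \<in> ring_hom R S \<and> finitely_generated_module R (module_via \<phi> S)"

text \<open>In \<^theory>\<open>HOL-Algebra.Multiplicative_Group\<close>, an element of infinite order has \<open>ord\<close> zero, so
  this is zero exactly if no positive multiple of \<open>\<one>\<close> vanishes.\<close>

definition ring_characteristic :: "('a, 'c) ring_scheme \<Rightarrow> nat" where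
  "ring_characteristic R = group.ord (add_monoid R) \<one>\<^bsub>R\<^esub>"

definition krull_dimension :: "('a, 'c) ring_scheme \<Rightarrow> enat" where
  "krull_dimension R =
     Sup {enat n | n. \<exists>P :: nat \<Rightarrow> 'a set.
       (\<forall>i\<le>n. primeideal (P i) R) \<and> (\<forall>i<n. P i \<subset> P (Suc i))}"

definition local_ring :: "('a, 'c) ring_scheme \<Rightarrow> 'a set \<Rightarrow> bool" where
  "local_ring R \<mm> \<longleftrightarrow> cring R \<and> maximalideal \<mm> R \<and> (\<forall>\<nn>. maximalideal \<nn> R \<longrightarrow> \<nn> = \<mm>)"

definition F_finite :: "('a, 'c) ring_scheme \<Rightarrow> nat \<Rightarrow> bool" where
  "F_finite R p \<longleftrightarrow> finite_ring_hom R R (\<lambda>x. x [^]\<^bsub>R\<^esub> p)"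

definition radical_ideal :: "('a, 'c) ring_scheme \<Rightarrow> 'a set \<Rightarrow> 'a set" where
  "radical_ideal R Q = {x \<in> carrier R. \<exists>n::nat. x [^]\<^bsub>R\<^esub> n \<in> Q}"

definition primary_ideal :: "('a, 'c) ring_scheme \<Rightarrow> 'a set \<Rightarrow> bool" where
  "primary_ideal R Q \<longleftrightarrow> ideal Q R \<and> Q \<noteq> carrier R \<and>
     (\<forall>x \<in> carrier R. \<forall>y \<in> carrier R.
        x \<otimes>\<^bsub>R\<^esub> y \<in> Q \<longrightarrow> x \<in> Q \<or> (\<exists>n::nat. y [^]\<^bsub>R\<^esub> n \<in> Q))"

definition primary_to :: "('a, 'c) ring_scheme \<Rightarrow> 'a set \<Rightarrow> 'a set \<Rightarrow> bool" where
  "primary_to R \<mm> Q \<longleftrightarrow> primary_ideal R Q \<and> radical_ideal R Q = \<mm>"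

text \<open>The power is taken in the semiring of ideals, whose unit is the unit ideal. As \<^const>\<open>nat\<close>
  sends negative integers to zero, every nonpositive power is the unit ideal.\<close>

definition ideal_power :: "('a, 'c) ring_scheme \<Rightarrow> 'a set \<Rightarrow> int \<Rightarrow> 'a set" where
  "ideal_power R I k = I [^]\<^bsub>ideals_set R\<^esub> nat k"

definition frobenius_power :: "('a, 'c) ring_scheme \<Rightarrow> 'a set \<Rightarrow> nat \<Rightarrow> 'a set" where
  "frobenius_power R J q = Idl\<^bsub>R\<^esub> {f [^]\<^bsub>R\<^esub> q | f. f \<in> J}"

definition h_length :: "('a, 'c) ring_scheme \<Rightarrow> nat \<Rightarrow> 'a set \<Rightarrow> 'a set \<Rightarrow> nat \<Rightarrow> real \<Rightarrow> enat" where
  "h_length R p I J n s =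
     module_length R (quotient_module R
       (ideal_power R I \<lceil>s * real p ^ n\<rceil> <+>\<^bsub>R\<^esub> frobenius_power R J (p ^ n)))"

text \<open>Meaningful only where \<^const>\<open>h_length\<close> is finite: \<^term>\<open>the_enat \<infinity>\<close> is unspecified.\<close>

definition h_fun :: "('a, 'c) ring_scheme \<Rightarrow> nat \<Rightarrow> 'a set \<Rightarrow> 'a set \<Rightarrow> nat \<Rightarrow> real \<Rightarrow> real" where
  "h_fun R p I J n s = real (the_enat (h_length R p I J n s))"

end

theory Submission
  imports Defs
begin

text \<open>The proof takes place inside the ring \<open>R\<close>. Write \<open>F\<close> for the Frobenius map \<open>x \<mapsto> x^p\<close>. For ideals
  \<open>A \<subseteq> B\<close> the quotient \<open>B/A\<close>, viewed as an \<open>R\<close>-module through \<open>F\<close>, has as submodules the additive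
  subgroups between \<open>A\<close> and \<open>B\<close> that are closed under multiplication by \<open>p\<close>-th powers. Its localization
  at a prime \<open>Q\<close> has as length the largest number of steps of a chain of such subgroups, where a step counts
  only if it is not killed by elements outside \<open>Q\<close>. This number, \<open>local_length\<close>, replaces
  modules, localizations and residue fields throughout; it is additive, and it is invariant under the
  maps \<open>z \<mapsto> z^t e\<close> (\<open>local_length_add\<close>, \<open>local_length_twist\<close>).

  The Frobenius degree of a prime \<open>P\<close> is \<open>[\<kappa>(P) : \<kappa>(P)^p]\<close>, the length of \<open>R/P\<close> over \<open>R\<close> through \<open>F\<close>,
  localized at \<open>P\<close>. At \<open>P\<close>, lengths through \<open>F\<close> are ordinary lengths times this degree. If no prime lies
  strictly between \<open>P \<subset> Q\<close>, localize at \<open>Q\<close> and take \<open>x\<close> in \<open>Q\<close> outside \<open>P\<close>: the length of \<open>R/(P + x^p R)\<close> through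
  \<open>F\<close> is \<open>p\<close> times the degree of \<open>Q\<close> times the length of \<open>R/(P + xR)\<close>, and since \<open>R/P\<close> is, up to torsion, free
  through \<open>F\<close> of rank the degree of \<open>P\<close>, it is also the degree of \<open>P\<close> times the length of \<open>R/(P + xR)\<close>. Hence
  degrees drop by exactly the factor \<open>p\<close> in each step of a saturated chain of primes, and the rank of
  \<open>R\<close> over itself through \<open>F\<close> is \<open>p^d\<close> times the degree of the maximal ideal (Kunz).

  This rank controls colengths. There is a free submodule of full rank in \<open>R\<close> through \<open>F\<close>, and a
  nonzero multiple of \<open>R\<close> lies in it, so that the colength of \<open>A^[p]\<close> differs from \<open>p^d\<close> times that of
  \<open>A\<close> by at most a constant times the colengths of these ideals enlarged by one nonzero element. Such errors are of order
  \<open>p^(n(d-1))\<close> along Frobenius powers: by devissage only quotients by primes matter, and for a prime the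
  same comparison gives a linear recursion whose factor is the degree of the prime relative to that of
  the maximal ideal (\<open>local_length_growth\<close>).

  Let \<open>A_n = I^a + J^[p^n]\<close> with \<open>a = \<lceil>s p^n\<rceil>\<close>. Then \<open>A_n^[p] \<subseteq> A_(n+1)\<close>, and one nonzero \<open>c\<close> multiplies
  \<open>A_(n+1)\<close> into \<open>A_n^[p]\<close> for all \<open>n\<close> and \<open>s\<close>; this again costs only the colength of an ideal enlarged by
  \<open>c\<close>. So the colength of \<open>A_(n+1)\<close> is \<open>p^d\<close> times that of \<open>A_n\<close> up to order \<open>p^(n(d-1))\<close>, and after
  division by \<open>p^(nd)\<close> the sequence converges with error of order \<open>p^(-n)\<close>. Likewise a nonzero element of \<open>I\<close>
  multiplies \<open>I^k\<close> into \<open>I^(k+1)\<close>, so that raising the exponent by one changes the colength by order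
  \<open>p^(n(d-1))\<close> only, and in the limit this is the Lipschitz bound. The case \<open>I = 0\<close>, where
  all positive powers agree, is the reason for staying away from zero.\<close>

section \<open>Submodules for the action through powers\<close>

no_notation Sum_Type.Plus (infixr "<+>" 65)

context cring
begin

text \<open>For \<open>q = 1\<close> these are the ideals; for \<open>q = p\<close> they are the submodules of \<open>R\<close> as a module over itself
  through the Frobenius map.\<close>

definition power_submodule :: "nat \<Rightarrow> 'a set \<Rightarrow> bool" where
  "power_submodule q N \<longleftrightarrow> additive_subgroup N R \<and> (\<forall>a\<in>carrier R. \<forall>x\<in>N. a [^] q \<otimes> x \<in> N)"

text \<open>For \<open>V \<subseteq> U\<close>, the quotient \<open>U/V\<close>, with \<open>R\<close> acting through \<open>q\<close>-th powers, vanishes after localization at \<open>Q\<close>.\<close>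

definition torsion_modulo :: "nat \<Rightarrow> 'a set \<Rightarrow> 'a set \<Rightarrow> 'a set \<Rightarrow> bool" where
  "torsion_modulo q Q U V \<longleftrightarrow> (\<forall>x\<in>U. \<exists>s\<in>carrier R - Q. s [^] q \<otimes> x \<in> V)"

text \<open>The outermost inclusions need not be steps; chains can thus be stretched at both ends.\<close>

primrec local_chain :: "nat \<Rightarrow> 'a set \<Rightarrow> nat \<Rightarrow> 'a set \<Rightarrow> 'a set \<Rightarrow> bool" where
  "local_chain q Q 0 A B \<longleftrightarrow> A \<subseteq> B"
| "local_chain q Q (Suc n) A B \<longleftrightarrow>
     (\<exists>N. power_submodule q N \<and> local_chain q Q n A N \<and> N \<subseteq> B \<and> \<not> torsion_modulo q Q B N)"

text \<open>The length of \<open>B/A\<close> localized at \<open>Q\<close>, with \<open>R\<close> acting through \<open>q\<close>-th powers.\<close>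

definition local_length :: "nat \<Rightarrow> 'a set \<Rightarrow> 'a set \<Rightarrow> 'a set \<Rightarrow> enat" where
  "local_length q Q A B = Sup {enat n | n. local_chain q Q n A B}"

lemma set_addI: "x \<in> U \<Longrightarrow> y \<in> V \<Longrightarrow> x \<oplus> y \<in> U <+> V"
  by (auto simp: set_add_def')

lemma set_addE:
  assumes "z \<in> U <+> V"
  obtains x y where "x \<in> U" "y \<in> V" "z = x \<oplus> y"
  using assms by (auto simp: set_add_def')

lemma power_submoduleI:
  assumes "N \<subseteq> carrier R" "\<zero> \<in> N"
    and "\<And>x y. x \<in> N \<Longrightarrow> y \<in> N \<Longrightarrow> x \<oplus> y \<in> N"
    and "\<And>x. x \<in> N \<Longrightarrow> \<ominus> x \<in> N"
    and "\<And>a x. a \<in> carrier R \<Longrightarrow> x \<in> N \<Longrightarrow> a [^] q \<otimes> x \<in> N"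
  shows "power_submodule q N"
  unfolding power_submodule_def
  using assms by (auto intro!: additive_subgroupI add.subgroupI simp flip: a_inv_def)

lemma power_submoduleD:
  assumes "power_submodule q N"
  shows "N \<subseteq> carrier R" "\<zero> \<in> N"
    and "x \<in> N \<Longrightarrow> y \<in> N \<Longrightarrow> x \<oplus> y \<in> N"
    and "x \<in> N \<Longrightarrow> \<ominus> x \<in> N"
    and "x \<in> N \<Longrightarrow> y \<in> N \<Longrightarrow> x \<ominus> y \<in> N"
    and "a \<in> carrier R \<Longrightarrow> x \<in> N \<Longrightarrow> a [^] q \<otimes> x \<in> N"
    and "x \<in> N \<Longrightarrow> x \<in> carrier R"
proof -
  interpret additive_subgroup N R using assms by (simp add: power_submodule_def)
  have inv: "\<ominus> x \<in> N" if "x \<in> N" for x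
    using a_subgroup subgroup.m_inv_closed that by (fastforce simp: a_inv_def)
  show "N \<subseteq> carrier R" "\<zero> \<in> N" "x \<in> N \<Longrightarrow> y \<in> N \<Longrightarrow> x \<oplus> y \<in> N" "x \<in> N \<Longrightarrow> x \<in> carrier R"
    using a_subset by auto
  show "x \<in> N \<Longrightarrow> \<ominus> x \<in> N" "x \<in> N \<Longrightarrow> y \<in> N \<Longrightarrow> x \<ominus> y \<in> N"
    using inv by (auto simp: a_minus_def)
  show "a \<in> carrier R \<Longrightarrow> x \<in> N \<Longrightarrow> a [^] q \<otimes> x \<in> N"
    using assms by (simp add: power_submodule_def)
qed

lemma ideal_imp_power_submodule: "ideal N R \<Longrightarrow> power_submodule q N"
  by (simp add: power_submodule_def ideal.axioms ideal.I_l_closed)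

lemma power_submodule_1_iff: "power_submodule 1 N \<longleftrightarrow> ideal N R"
proof
  assume N: "power_submodule 1 N"
  note D = power_submoduleD[OF N]
  show "ideal N R"
  proof (rule idealI)
    show "ring R" by (rule ring_axioms)
    show "subgroup N (add_monoid R)"
      using N additive_subgroup.a_subgroup power_submodule_def by blast
    fix a x assume "a \<in> N" "x \<in> carrier R"
    then show "x \<otimes> a \<in> N" "a \<otimes> x \<in> N"
      using D(6)[of x a] D(7) by (auto simp: m_comm)
  qed
qed (rule ideal_imp_power_submodule)

lemma power_submodule_carrier: "power_submodule q (carrier R)"
  by (rule power_submoduleI) auto

lemma power_submodule_Int:
  "power_submodule q U \<Longrightarrow> power_submodule q V \<Longrightarrow> power_submodule q (U \<inter> V)"
  by (rule power_submoduleI) (auto dest: power_submoduleD)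

lemma power_submodule_add:
  assumes U: "power_submodule q U" and V: "power_submodule q V"
  shows "power_submodule q (U <+> V)"
proof (rule power_submoduleI)
  note D = power_submoduleD(7)[OF U] power_submoduleD(7)[OF V]
  show "U <+> V \<subseteq> carrier R"
    using D by (auto elim!: set_addE)
  have "\<zero> \<oplus> \<zero> \<in> U <+> V" by (intro set_addI power_submoduleD(2)[OF U] power_submoduleD(2)[OF V])
  then show "\<zero> \<in> U <+> V" by simp
  fix z assume z: "z \<in> U <+> V"
  then obtain x y where xy: "x \<in> U" "y \<in> V" "z = x \<oplus> y" by (rule set_addE)
  have "\<ominus> z = \<ominus> x \<oplus> \<ominus> y" using xy D by (simp add: minus_add)
  then show "\<ominus> z \<in> U <+> V" using xy power_submoduleD(4)[OF U] power_submoduleD(4)[OF V] by (auto intro: set_addI)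
  show "a [^] q \<otimes> z \<in> U <+> V" if a: "a \<in> carrier R" for a
  proof -
    have "a [^] q \<otimes> z = a [^] q \<otimes> x \<oplus> a [^] q \<otimes> y" using xy D a by (simp add: r_distr)
    then show ?thesis using a xy power_submoduleD(6)[OF U] power_submoduleD(6)[OF V] by (auto intro: set_addI)
  qed
  fix w assume "w \<in> U <+> V"
  then obtain x' y' where xy': "x' \<in> U" "y' \<in> V" "w = x' \<oplus> y'" by (rule set_addE)
  have "z \<oplus> w = (x \<oplus> x') \<oplus> (y \<oplus> y')" using xy xy' D by (simp add: a_ac)
  then show "z \<oplus> w \<in> U <+> V" using xy xy' power_submoduleD(3)[OF U] power_submoduleD(3)[OF V] by (auto intro: set_addI)
qed

lemma subset_set_add1:
  assumes "power_submodule q V" "U \<subseteq> carrier R" shows "U \<subseteq> U <+> V"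
proof
  fix x assume "x \<in> U"
  then have "x \<oplus> \<zero> \<in> U <+> V" using assms power_submoduleD(2) by (blast intro: set_addI)
  then show "x \<in> U <+> V" using \<open>x \<in> U\<close> assms by auto
qed

lemma subset_set_add2:
  assumes "power_submodule q U" "V \<subseteq> carrier R" shows "V \<subseteq> U <+> V"
proof
  fix x assume "x \<in> V"
  then have "\<zero> \<oplus> x \<in> U <+> V" using assms power_submoduleD(2) by (blast intro: set_addI)
  then show "x \<in> U <+> V" using \<open>x \<in> V\<close> assms by auto
qed

lemma set_add_least:
  assumes "power_submodule q Z" "U \<subseteq> Z" "V \<subseteq> Z" shows "U <+> V \<subseteq> Z"
  using assms power_submoduleD(3)[OF assms(1)] by (auto elim!: set_addE)

lemma set_add_mono: "U \<subseteq> U' \<Longrightarrow> V \<subseteq> V' \<Longrightarrow> U <+> V \<subseteq> U' <+> V'"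
  by (auto simp: set_add_def')

lemma set_add_absorb:
  assumes "power_submodule q Z" "power_submodule q U" "U \<subseteq> Z" shows "Z <+> U = Z" "U <+> Z = Z"
  using set_add_least[OF assms(1), of Z U] set_add_least[OF assms(1), of U Z]
    subset_set_add1[OF assms(2), of Z] subset_set_add2[OF assms(2), of Z] assms power_submoduleD(1)[OF assms(1)]
  by auto

lemma set_add_assoc:
  assumes "U \<subseteq> carrier R" "V \<subseteq> carrier R" "Z \<subseteq> carrier R"
  shows "(U <+> V) <+> Z = U <+> (V <+> Z)"
  using assms add.set_mult_assoc[of U V Z] unfolding set_add_defs by simp

section \<open>Localized length\<close>

lemma torsion_antimono: "torsion_modulo q Q U V \<Longrightarrow> U' \<subseteq> U \<Longrightarrow> V \<subseteq> V' \<Longrightarrow> torsion_modulo q Q U' V'"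
  unfolding torsion_modulo_def by blast

lemma local_chain_mono:
  "local_chain q Q n A B \<Longrightarrow> A' \<subseteq> A \<Longrightarrow> B \<subseteq> B' \<Longrightarrow> local_chain q Q n A' B'"
proof (induction n arbitrary: B B')
  case (Suc n)
  then obtain N where N: "power_submodule q N" "local_chain q Q n A N" "N \<subseteq> B" "\<not> torsion_modulo q Q B N"
    by auto
  moreover have "local_chain q Q n A' N" using Suc N by auto
  ultimately show ?case using Suc.prems torsion_antimono by (auto intro!: exI[of _ N])
qed auto

lemma local_chain_Suc_D: "local_chain q Q (Suc n) A B \<Longrightarrow> local_chain q Q n A B"
  using local_chain_mono[of q Q n A _ A B] by auto

lemma local_chain_le: "local_chain q Q n A B \<Longrightarrow> m \<le> n \<Longrightarrow> local_chain q Q m A B"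
  by (induction n) (auto simp: le_Suc_eq simp del: local_chain.simps dest: local_chain_Suc_D)

lemma local_chain_subset: "local_chain q Q n A B \<Longrightarrow> A \<subseteq> B"
  using local_chain_le[of q Q n A B 0] by simp

lemma local_chain_append:
  "local_chain q Q j B C \<Longrightarrow> local_chain q Q i A B \<Longrightarrow> local_chain q Q (i + j) A C"
proof (induction j arbitrary: C)
  case 0 then show ?case using local_chain_mono by auto
next
  case (Suc j)
  then show ?case by auto
qed

lemma enat_le_local_length_iff: 
  "enat n \<le> local_length q Q A B \<longleftrightarrow> local_chain q Q n A B \<or> n = 0"
proof
  assume *: "enat n \<le> local_length q Q A B"
  show "local_chain q Q n A B \<or> n = 0"
  proof (rule ccontr)
    assume "\<not> ?thesis"
    then have n: "\<not> local_chain q Q n A B" "n > 0" by auto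
    have "local_length q Q A B \<le> enat (n - 1)"
      unfolding local_length_def
    proof (rule Sup_least)
      fix x assume "x \<in> {enat n |n. local_chain q Q n A B}"
      then obtain m where m: "x = enat m" "local_chain q Q m A B" by auto
      then show "x \<le> enat (n - 1)" using n local_chain_le[of q Q m A B n] by (cases "m < n") auto
    qed
    with * have "enat n \<le> enat (n - 1)" by (rule order_trans)
    then show False using n by simp
  qed
next
  assume "local_chain q Q n A B \<or> n = 0"
  then show "enat n \<le> local_length q Q A B"
    unfolding local_length_def by (auto intro: Sup_upper simp flip: zero_enat_def)
qed

lemma local_length_leI:
  assumes "\<And>n. local_chain q Q n A B \<Longrightarrow> enat n \<le> x"
  shows "local_length q Q A B \<le> x"
  unfolding local_length_def using assms by (auto intro: Sup_least)

lemma local_length_ge: "local_chain q Q n A B \<Longrightarrow> enat n \<le> local_length q Q A B"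
  by (simp add: enat_le_local_length_iff)

lemma local_length_mono: "A' \<subseteq> A \<Longrightarrow> B \<subseteq> B' \<Longrightarrow> local_length q Q A B \<le> local_length q Q A' B'"
  by (rule local_length_leI) (blast intro: local_length_ge local_chain_mono)

text \<open>Lengths are compared through this lemma: a bijection between submodules is not needed, only that a step
  of a chain remains a step.\<close>

lemma local_chain_map:
  assumes chain: "local_chain q Q n A B" and B: "power_submodule q B"
    and f: "\<And>N. power_submodule q N \<Longrightarrow> A \<subseteq> N \<Longrightarrow> N \<subseteq> B \<Longrightarrow> power_submodule q' (f N)"
    and mono: "\<And>N N'. power_submodule q N \<Longrightarrow> power_submodule q N' \<Longrightarrow> A \<subseteq> N \<Longrightarrow> N \<subseteq> N' \<Longrightarrow> N' \<subseteq> B \<Longrightarrow> f N \<subseteq> f N'"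
    and strict: "\<And>N N'. power_submodule q N \<Longrightarrow> power_submodule q N' \<Longrightarrow> A \<subseteq> N \<Longrightarrow> N \<subseteq> N' \<Longrightarrow> N' \<subseteq> B \<Longrightarrow>
        torsion_modulo q' Q' (f N') (f N) \<Longrightarrow> torsion_modulo q Q N' N"
    and A': "\<And>N. power_submodule q N \<Longrightarrow> A \<subseteq> N \<Longrightarrow> N \<subseteq> B \<Longrightarrow> A' \<subseteq> f N" and B': "f B \<subseteq> B'"
  shows "local_chain q' Q' n A' B'"
proof -
  have "local_chain q' Q' n A' (f C)" if "local_chain q Q n A C" "power_submodule q C" "C \<subseteq> B" for n C
    using that
  proof (induction n arbitrary: C)
    case 0
    then show ?case using A' by auto
  next
    case (Suc n)
    then obtain N where N: "power_submodule q N" "local_chain q Q n A N" "N \<subseteq> C" "\<not> torsion_modulo q Q C N"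
      by auto
    note AN = local_chain_subset[OF N(2)]
    have "local_chain q' Q' n A' (f N)" using Suc N by auto
    moreover have "\<not> torsion_modulo q' Q' (f C) (f N)" using strict[of N C] N Suc.prems AN by auto
    ultimately show ?case using f[of N] mono[of N C] N Suc.prems AN by auto
  qed
  from this[OF chain B order_refl] show ?thesis using local_chain_mono B' by blast
qed

end

context primeideal
begin

lemma outside_mult:
  "s \<in> carrier R - I \<Longrightarrow> t \<in> carrier R - I \<Longrightarrow> s \<otimes> t \<in> carrier R - I"
  using I_prime by auto

lemma outside_one: "\<one> \<in> carrier R - I"
  using I_notcarr one_imp_carrier by auto

lemma outside_power: "s \<in> carrier R - I \<Longrightarrow> s [^] (n :: nat) \<in> carrier R - I"
  by (induction n) (use outside_one outside_mult in auto)

lemma torsion_refl: "U \<subseteq> V \<Longrightarrow> U \<subseteq> carrier R \<Longrightarrow> torsion_modulo q I U V"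
  unfolding torsion_modulo_def using outside_one by (auto intro!: bexI[of _ \<one>] simp: subset_eq)

text \<open>If \<open>s^q x = y + b\<close> with \<open>x\<close> in \<open>N'\<close>, \<open>y\<close> in \<open>N\<close> and \<open>b\<close> in \<open>B\<close>, then \<open>b\<close> lies in \<open>N' \<inter> B\<close>, so some multiple of \<open>b\<close> lies
  in \<open>N\<close>, and the same multiple brings \<open>s^q x\<close> into \<open>N\<close>.\<close>

lemma torsion_step_split:
  assumes N: "power_submodule q N" and N': "power_submodule q N'" and B: "power_submodule q B" and sub: "N \<subseteq> N'"
    and t1: "torsion_modulo q I (N' \<inter> B) (N \<inter> B)" and t2: "torsion_modulo q I (N' <+> B) (N <+> B)"
  shows "torsion_modulo q I N' N"
  unfolding torsion_modulo_def
proof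
  note D = power_submoduleD(7)[OF N] power_submoduleD(7)[OF N'] power_submoduleD(7)[OF B]
  fix x assume x: "x \<in> N'"
  then have "x \<in> N' <+> B" using subset_set_add1[OF B power_submoduleD(1)[OF N']] by auto
  then obtain s where s: "s \<in> carrier R - I" "s [^] q \<otimes> x \<in> N <+> B" using t2 by (auto simp: torsion_modulo_def)
  obtain y b where yb: "y \<in> N" "b \<in> B" "s [^] q \<otimes> x = y \<oplus> b" using s(2) by (rule set_addE)
  have b: "b = s [^] q \<otimes> x \<ominus> y"
    using yb D by (simp add: minus_eq a_ac r_neg1 r_neg)
  have "b \<in> N'" unfolding b
    using x s yb sub by (intro power_submoduleD(5,6)[OF N']) auto
  then obtain t where t: "t \<in> carrier R - I" "t [^] q \<otimes> b \<in> N" using t1 yb by (auto simp: torsion_modulo_def)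
  have "(t \<otimes> s) [^] q \<otimes> x = t [^] q \<otimes> (s [^] q \<otimes> x)" using s t x D by (auto simp: nat_pow_distrib m_assoc)
  also have "\<dots> = t [^] q \<otimes> y \<oplus> t [^] q \<otimes> b" using yb t D by (simp add: r_distr)
  also have "\<dots> \<in> N" using t yb power_submoduleD(3,6)[OF N] by auto
  finally show "\<exists>s\<in>carrier R - I. s [^] q \<otimes> x \<in> N" using s t outside_mult[of t s] by (intro bexI[of _ "t \<otimes> s"]) auto
qed

text \<open>Each step of the chain survives on intersecting with \<open>B\<close> or on adding \<open>B\<close>, so the two induced
  chains have together at least as many steps.\<close>

lemma local_chain_split:
  assumes "local_chain q I n A C" "power_submodule q A" "power_submodule q B" "power_submodule q C"
  shows "\<exists>i j. n \<le> i + j \<and> local_chain q I i (A \<inter> B) (C \<inter> B) \<and> local_chain q I j (A <+> B) (C <+> B)"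
  using assms
proof (induction n arbitrary: C)
  case 0
  then have "A \<inter> B \<subseteq> C \<inter> B" "A <+> B \<subseteq> C <+> B" using set_add_mono[of A C B B] by auto
  then show ?case by (intro exI[of _ 0]) auto
next
  case (Suc n)
  then obtain N where N: "power_submodule q N" "local_chain q I n A N" "N \<subseteq> C" "\<not> torsion_modulo q I C N"
    by auto
  obtain i j where ij: "n \<le> i + j" "local_chain q I i (A \<inter> B) (N \<inter> B)" "local_chain q I j (A <+> B) (N <+> B)"
    using Suc N by blast
  have NB: "power_submodule q (N \<inter> B)" "power_submodule q (N <+> B)"
    using N Suc.prems by (auto intro: power_submodule_Int power_submodule_add)
  consider "\<not> torsion_modulo q I (C \<inter> B) (N \<inter> B)" | "\<not> torsion_modulo q I (C <+> B) (N <+> B)"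
    using torsion_step_split[of q N C B] N Suc.prems by auto
  then show ?case
  proof cases
    case 1
    then have "local_chain q I (Suc i) (A \<inter> B) (C \<inter> B)"
      unfolding local_chain.simps using ij NB N(3) by (intro exI[of _ "N \<inter> B"]) auto
    moreover have "local_chain q I j (A <+> B) (C <+> B)"
      using ij(3) by (rule local_chain_mono[OF _ order_refl set_add_mono[OF N(3) order_refl]])
    ultimately show ?thesis using ij by (intro exI[of _ "Suc i"] exI[of _ j]) auto
  next
    case 2
    then have "local_chain q I (Suc j) (A <+> B) (C <+> B)"
      unfolding local_chain.simps using ij NB set_add_mono[OF N(3) order_refl[of B]]
      by (intro exI[of _ "N <+> B"]) auto
    moreover have "local_chain q I i (A \<inter> B) (C \<inter> B)"
      using ij(2) by (rule local_chain_mono) (use N(3) in auto)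
    ultimately show ?thesis using ij by (intro exI[of _ i] exI[of _ "Suc j"]) auto
  qed
qed

text \<open>Length is additive in short exact sequences: chains concatenate, and conversely a chain from \<open>A\<close>
  to \<open>C\<close> splits at \<open>B\<close>.\<close>

lemma local_length_add:
  assumes A: "power_submodule q A" and B: "power_submodule q B" and C: "power_submodule q C"
    and sub: "A \<subseteq> B" "B \<subseteq> C"
  shows "local_length q I A C = local_length q I A B + local_length q I B C"
proof (rule antisym)
  have eqs: "A \<inter> B = A" "C \<inter> B = B" "A <+> B = B" "C <+> B = C"
    using sub set_add_absorb A B C by auto
  show "local_length q I A C \<le> local_length q I A B + local_length q I B C"
  proof (rule local_length_leI)
    fix n assume "local_chain q I n A C"
    then obtain i j where ij: "n \<le> i + j" "local_chain q I i A B" "local_chain q I j B C"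
      using local_chain_split[OF _ A B C] eqs by metis
    then have "enat i + enat j \<le> local_length q I A B + local_length q I B C"
      by (intro add_mono local_length_ge)
    moreover have "enat n \<le> enat i + enat j" using ij(1) by simp
    ultimately show "enat n \<le> local_length q I A B + local_length q I B C"
      by (rule order_trans[rotated])
  qed
  show "local_length q I A B + local_length q I B C \<le> local_length q I A C"
  proof (rule ccontr)
    assume "\<not> ?thesis"
    then have less: "local_length q I A C < local_length q I A B + local_length q I B C" by auto
    then obtain m where m: "local_length q I A C = enat m" by (cases "local_length q I A C") auto
    have "\<exists>i j. enat i \<le> local_length q I A B \<and> enat j \<le> local_length q I B C \<and> m < i + j"
    proof (cases "local_length q I A B"; cases "local_length q I B C")
      fix a b assume "local_length q I A B = enat a" "local_length q I B C = enat b"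
      then show ?thesis using less m by (intro exI[of _ a] exI[of _ b]) auto
    next
      fix a assume "local_length q I A B = enat a" "local_length q I B C = \<infinity>"
      then show ?thesis by (intro exI[of _ 0] exI[of _ "Suc m"]) auto
    next
      assume "local_length q I A B = \<infinity>"
      then show ?thesis by (intro exI[of _ "Suc m"] exI[of _ 0]) (auto simp flip: zero_enat_def)
    next
      assume "local_length q I A B = \<infinity>"
      then show ?thesis by (intro exI[of _ "Suc m"] exI[of _ 0]) (auto simp flip: zero_enat_def)
    qed
    then obtain i j where ij: "enat i \<le> local_length q I A B" "enat j \<le> local_length q I B C" "m < i + j" by auto
    then have "local_chain q I i A B" "local_chain q I j B C"
      using sub by (auto simp: enat_le_local_length_iff)
    then have "local_chain q I (i + j) A C" using local_chain_append by blast
    then have "enat (i + j) \<le> enat m" using local_length_ge m by metis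
    then show False using ij by simp
  qed
qed

lemma local_length_eq_0_iff: "power_submodule q A \<Longrightarrow> A \<subseteq> B \<Longrightarrow> B \<subseteq> carrier R \<Longrightarrow>
   local_length q I A B = 0 \<longleftrightarrow> torsion_modulo q I B A"
proof -
  assume *: "power_submodule q A" "A \<subseteq> B" "B \<subseteq> carrier R"
  have "local_length q I A B = 0 \<longleftrightarrow> \<not> enat 1 \<le> local_length q I A B"
    by (cases "local_length q I A B") (auto simp: zero_enat_def)
  also have "\<dots> \<longleftrightarrow> \<not> local_chain q I 1 A B" by (simp add: enat_le_local_length_iff)
  also have "\<dots> \<longleftrightarrow> torsion_modulo q I B A"
    using * torsion_antimono by auto
  finally show ?thesis .
qed

end

section \<open>Twisted multiplication maps\<close>

lemma enat_add_eq_oneD: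
  fixes a b :: enat
  assumes "1 = a + 1 + b" shows "a = 0" "b = 0"
  using assms by (cases a; cases b; simp add: one_enat_def zero_enat_def)+

lemma enat_add_eq_SucD:
  fixes a b :: enat
  assumes "enat n \<le> a" "enat (Suc n) = a + b" "b \<noteq> 0" shows "a = enat n" "b = 1"
  using assms by (cases a; cases b; simp add: one_enat_def zero_enat_def)+

context cring
begin

definition additive_power :: "nat \<Rightarrow> bool" where
  "additive_power t \<longleftrightarrow> (\<forall>x\<in>carrier R. \<forall>y\<in>carrier R. (x \<oplus> y) [^] t = x [^] t \<oplus> y [^] t)"

lemma additive_power_1: "additive_power 1"
  by (simp add: additive_power_def)

lemma additive_power_zero:
  assumes "additive_power t" shows "\<zero> [^] t = \<zero>"
proof -
  have "(\<zero> \<oplus> \<zero>) [^] t = \<zero> [^] t \<oplus> \<zero> [^] t" using assms by (simp add: additive_power_def del: l_zero r_zero)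
  then have "\<zero> [^] t = \<zero> [^] t \<oplus> \<zero> [^] t" by simp
  then show ?thesis using add.l_cancel_one'[of "\<zero> [^] t" "\<zero> [^] t"] by simp
qed

lemma additive_power_minus:
  assumes "additive_power t" "x \<in> carrier R" shows "(\<ominus> x) [^] t = \<ominus> (x [^] t)"
proof -
  have "(\<ominus> x \<oplus> x) [^] t = (\<ominus> x) [^] t \<oplus> x [^] t" using assms by (simp add: additive_power_def)
  then have "(\<ominus> x) [^] t \<oplus> x [^] t = \<zero>" using assms additive_power_zero by (simp add: l_neg)
  then show ?thesis using assms by (simp add: minus_equality)
qed

text \<open>For \<open>t = 1\<close> this is multiplication by \<open>e\<close>; for \<open>t = p\<close> it is the linear map from \<open>R\<close> to \<open>R\<close> through the
  Frobenius map that sends \<open>\<one>\<close> to \<open>e\<close>.\<close>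

definition twist :: "nat \<Rightarrow> 'a \<Rightarrow> 'a \<Rightarrow> 'a" where
  "twist t e z = z [^] t \<otimes> e"

lemma twist_closed [simp]: "e \<in> carrier R \<Longrightarrow> z \<in> carrier R \<Longrightarrow> twist t e z \<in> carrier R"
  by (simp add: twist_def)

lemma twist_add:
  assumes "additive_power t" "e \<in> carrier R" "x \<in> carrier R" "y \<in> carrier R" 
  shows "twist t e (x \<oplus> y) = twist t e x \<oplus> twist t e y"
  using assms by (simp add: twist_def additive_power_def l_distr)

lemma twist_zero: "additive_power t \<Longrightarrow> e \<in> carrier R \<Longrightarrow> twist t e \<zero> = \<zero>"
  by (simp add: twist_def additive_power_zero)

lemma twist_minus:
  assumes "additive_power t" "e \<in> carrier R" "x \<in> carrier R"
  shows "twist t e (\<ominus> x) = \<ominus> twist t e x"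
  using assms by (simp add: twist_def additive_power_minus l_minus)

lemma twist_diff:
  assumes "additive_power t" "e \<in> carrier R" "x \<in> carrier R" "y \<in> carrier R" 
  shows "twist t e (x \<ominus> y) = twist t e x \<ominus> twist t e y"
  using assms by (simp add: minus_eq twist_minus twist_add)

lemma twist_mult:
  assumes "e \<in> carrier R" "a \<in> carrier R" "x \<in> carrier R" 
  shows "twist t e (a [^] q \<otimes> x) = a [^] (q * t) \<otimes> twist t e x"
  using assms by (simp add: twist_def nat_pow_distrib nat_pow_pow m_assoc)

lemma power_submodule_twist_vimage:
  assumes t: "additive_power t" "e \<in> carrier R" and U: "power_submodule (q * t) U" and Z: "power_submodule q Z"
  shows "power_submodule q {z \<in> Z. twist t e z \<in> U}"
  using power_submoduleD[OF U] power_submoduleD[OF Z] t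
  by (intro power_submoduleI) (auto simp: twist_zero twist_minus twist_add twist_mult subset_eq)

lemma power_submodule_twist_image:
  assumes t: "additive_power t" "e \<in> carrier R" and Z: "power_submodule q Z"
  shows "power_submodule (q * t) (twist t e ` Z)"
proof (rule power_submoduleI)
  note D = power_submoduleD[OF Z]
  show "twist t e ` Z \<subseteq> carrier R" using D(7) t by auto
  show "\<zero> \<in> twist t e ` Z" using D(2) twist_zero[OF t] by (metis imageI)
  fix x assume "x \<in> twist t e ` Z"
  then obtain z where z: "z \<in> Z" "x = twist t e z" by auto
  show "\<ominus> x \<in> twist t e ` Z" using z D(4,7) t by (auto simp flip: twist_minus)
  show "a [^] (q * t) \<otimes> x \<in> twist t e ` Z" if "a \<in> carrier R" for a
    using z D(6,7) t that by (auto simp flip: twist_mult)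
  fix y assume "y \<in> twist t e ` Z"
  then obtain w where w: "w \<in> Z" "y = twist t e w" by auto
  show "x \<oplus> y \<in> twist t e ` Z" using z w D(3,7) t by (auto simp flip: twist_add)
qed

end

context primeideal
begin

text \<open>The isomorphism theorem for the twisted map \<open>\<phi>\<close>: it embeds \<open>Z\<close>, modulo the preimage of \<open>U\<close>, onto
  \<open>(U + \<phi>(Z))/U\<close>, and turns the action through \<open>q\<close>-th powers into the one through \<open>q t\<close>-th powers. For
  \<open>t = 1\<close> and \<open>e = \<one>\<close> it is the second isomorphism theorem.\<close>

lemma local_length_twist:
  assumes t: "additive_power t" "e \<in> carrier R" and U: "power_submodule (q * t) U" and Z: "power_submodule q Z"
  shows "local_length q I {z \<in> Z. twist t e z \<in> U} Z
    = local_length (q * t) I U (U <+> twist t e ` Z)" (is "local_length q I ?W Z = local_length _ I U ?V")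
proof (rule antisym)
  note DU = power_submoduleD[OF U] and DZ = power_submoduleD[OF Z]
  have V: "power_submodule (q * t) ?V" by (intro power_submodule_add power_submodule_twist_image U Z t)
  show "local_length q I ?W Z \<le> local_length (q * t) I U ?V"
  proof (rule local_length_leI)
    fix n assume n: "local_chain q I n ?W Z"
    have "local_chain (q * t) I n U ?V"
    proof (rule local_chain_map[OF n Z, where f = "\<lambda>N. U <+> twist t e ` N"])
      fix N assume N: "power_submodule q N"
      then show "power_submodule (q * t) (U <+> twist t e ` N)"
        by (intro power_submodule_add power_submodule_twist_image U t)
      show "U \<subseteq> U <+> twist t e ` N"
        by (intro subset_set_add1[OF power_submodule_twist_image[OF t N]] DU(1))
      fix N' assume N': "power_submodule q N'" "?W \<subseteq> N" "N \<subseteq> N'" "N' \<subseteq> Z"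
      note DN = power_submoduleD[OF N] and DN' = power_submoduleD[OF N'(1)]
      show "U <+> twist t e ` N \<subseteq> U <+> twist t e ` N'" using N' by (intro set_add_mono) auto
      assume tor: "torsion_modulo (q * t) I (U <+> twist t e ` N') (U <+> twist t e ` N)"
      show "torsion_modulo q I N' N"
        unfolding torsion_modulo_def
      proof
        fix z assume z: "z \<in> N'"
        then have "\<zero> \<oplus> twist t e z \<in> U <+> twist t e ` N'" using DU by (intro set_addI) auto
        then obtain s where s: "s \<in> carrier R - I" "s [^] (q * t) \<otimes> twist t e z \<in> U <+> twist t e ` N"
          using tor z DN' t unfolding torsion_modulo_def by auto
        from s(2) obtain u v where "u \<in> U" "v \<in> twist t e ` N" and eq: "s [^] (q * t) \<otimes> twist t e z = u \<oplus> v"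
          by (rule set_addE)
        then obtain n where n: "u \<in> U" "n \<in> N" "v = twist t e n" by auto
        have carr: "u \<in> carrier R" "n \<in> carrier R" "z \<in> carrier R" "s \<in> carrier R" using DU(7) DN(7) DN'(7) n z s by auto
        have "twist t e (s [^] q \<otimes> z \<ominus> n) = (u \<oplus> twist t e n) \<ominus> twist t e n"
          using carr t eq n by (simp add: twist_diff twist_mult)
        also have "\<dots> = u" using carr t by (simp add: minus_eq a_assoc r_neg)
        finally have "twist t e (s [^] q \<otimes> z \<ominus> n) \<in> U" using n by simp
        moreover have "s [^] q \<otimes> z \<ominus> n \<in> Z" using z n carr N' by (intro DZ(5,6)) auto
        ultimately have "s [^] q \<otimes> z \<ominus> n \<in> N" using N' by auto
        then have "s [^] q \<otimes> z \<ominus> n \<oplus> n \<in> N" using n DN(3) by auto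
        moreover have "s [^] q \<otimes> z \<ominus> n \<oplus> n = s [^] q \<otimes> z" using carr by (simp add: minus_eq a_assoc l_neg)
        ultimately show "\<exists>s\<in>carrier R - I. s [^] q \<otimes> z \<in> N" using s by auto
      qed
    qed simp
    then show "enat n \<le> local_length (q * t) I U ?V" by (rule local_length_ge)
  qed
  show "local_length (q * t) I U ?V \<le> local_length q I ?W Z"
  proof (rule local_length_leI)
    fix n assume n: "local_chain (q * t) I n U ?V"
    have "local_chain q I n ?W Z"
    proof (rule local_chain_map[OF n V, where f = "\<lambda>N. {z \<in> Z. twist t e z \<in> N}"])
      fix N assume N: "power_submodule (q * t) N" and sub: "U \<subseteq> N"
      show "power_submodule q {z \<in> Z. twist t e z \<in> N}"
        by (intro power_submodule_twist_vimage t N Z)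
      show "?W \<subseteq> {z \<in> Z. twist t e z \<in> N}" using sub by auto
      fix N' assume N': "power_submodule (q * t) N'" "N \<subseteq> N'" "N' \<subseteq> ?V"
      note DN = power_submoduleD[OF N] and DN' = power_submoduleD[OF N'(1)]
      show "{z \<in> Z. twist t e z \<in> N} \<subseteq> {z \<in> Z. twist t e z \<in> N'}" using N' by auto
      assume tor: "torsion_modulo q I {z \<in> Z. twist t e z \<in> N'} {z \<in> Z. twist t e z \<in> N}"
      show "torsion_modulo (q * t) I N' N"
        unfolding torsion_modulo_def
      proof
        fix y assume y: "y \<in> N'"
        then have "y \<in> ?V" using N' by auto
        then obtain u v where "u \<in> U" "v \<in> twist t e ` Z" and eq: "y = u \<oplus> v"
          by (rule set_addE)
        then obtain z where z: "u \<in> U" "z \<in> Z" "v = twist t e z" by auto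
        have carr: "u \<in> carrier R" "z \<in> carrier R" "y \<in> carrier R" "v \<in> carrier R" using DU(7) DZ(7) DN'(7) y z t by auto
        have "v = y \<ominus> u" using eq carr by (simp add: minus_eq a_comm[of u v] a_assoc r_neg)
        then have "v \<in> N'" using y z sub N' DN'(5) by auto
        then obtain s where s: "s \<in> carrier R - I" "twist t e (s [^] q \<otimes> z) \<in> N"
          using tor z unfolding torsion_modulo_def by auto
        then have "s [^] (q * t) \<otimes> v \<in> N" using z carr t by (auto simp: twist_mult)
        then have "s [^] (q * t) \<otimes> u \<oplus> s [^] (q * t) \<otimes> v \<in> N" using DN(6)[of s u] s z sub by (intro DN(3)) auto
        then show "\<exists>s\<in>carrier R - I. s [^] (q * t) \<otimes> y \<in> N" using s carr eq by (auto simp: r_distr)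
      qed
    qed auto
    then show "enat n \<le> local_length q I ?W Z" by (rule local_length_ge)
  qed
qed

end

section \<open>Ideal quotients and the scaling of lengths\<close>

context cring
begin

definition colon :: "'a set \<Rightarrow> 'a \<Rightarrow> 'a set" where
  "colon J a = {z \<in> carrier R. z \<otimes> a \<in> J}"

lemma twist_1: "a \<in> carrier R \<Longrightarrow> z \<in> carrier R \<Longrightarrow> twist (Suc 0) a z = z \<otimes> a"
  by (simp add: twist_def)

lemma twist_image_carrier: "a \<in> carrier R \<Longrightarrow> twist (Suc 0) a ` carrier R = PIdl a"
  unfolding cgenideal_def by (auto simp: twist_1)

lemma colon_power_submodule:
  assumes "power_submodule q J" "a \<in> carrier R" shows "power_submodule q (colon J a)"
proof -
  have "colon J a = {z \<in> carrier R. twist (Suc 0) a z \<in> J}" using assms by (auto simp: colon_def twist_1)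
  then show ?thesis 
    using power_submodule_twist_vimage[of 1 a q J "carrier R"] assms additive_power_1 power_submodule_carrier by simp
qed

lemma colon_ideal: "ideal J R \<Longrightarrow> a \<in> carrier R \<Longrightarrow> ideal (colon J a) R"
  using colon_power_submodule[of 1] power_submodule_1_iff by blast

lemma subset_colon: "ideal J R \<Longrightarrow> a \<in> carrier R \<Longrightarrow> J \<subseteq> colon J a"
  by (auto simp: colon_def ideal.I_r_closed ideal.Icarr)

lemma mem_PIdl: "a \<in> carrier R \<Longrightarrow> a \<in> PIdl a" by (rule cgenideal_self)

lemma PIdl_closed: "a \<in> carrier R \<Longrightarrow> PIdl a \<subseteq> carrier R"
  by (auto simp: cgenideal_def)

lemma local_length_colon:
  assumes "primeideal Q R" "power_submodule q J" "a \<in> carrier R"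
  shows "local_length q Q J (J <+> PIdl a) = local_length q Q (colon J a) (carrier R)"
proof -
  have "colon J a = {z \<in> carrier R. twist (Suc 0) a z \<in> J}" using assms by (auto simp: colon_def twist_1)
  then show ?thesis 
    using primeideal.local_length_twist[OF assms(1) additive_power_1 assms(3), of q J "carrier R"] assms power_submodule_carrier
     by (simp add: twist_image_carrier)
qed

lemma local_length_refl:
  assumes "primeideal Q R" "power_submodule q A" shows "local_length q Q A A = 0"
  using primeideal.local_length_eq_0_iff[OF assms order_refl] primeideal.torsion_refl[OF assms(1) order_refl]
   power_submoduleD(1)[OF assms(2)] by simp

lemma local_length_prime_ge_1:
  assumes Q: "primeideal Q R" shows "1 \<le> local_length q Q Q (carrier R)"
proof -
  interpret primeideal Q R by fact
  have "\<not> torsion_modulo q Q (carrier R) Q"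
  proof
    assume "torsion_modulo q Q (carrier R) Q"
    then obtain s where "s \<in> carrier R - Q" "s [^] q \<otimes> \<one> \<in> Q"
      unfolding torsion_modulo_def by blast
    then show False using outside_power[of s q] by auto
  qed
  then have "local_chain q Q 1 Q (carrier R)"
    by (auto intro!: exI[of _ Q] ideal_imp_power_submodule is_ideal)
  then show ?thesis using local_length_ge one_enat_def by metis
qed

text \<open>An element of a submodule outside \<open>Q\<close> generates all of \<open>R\<close> after localization, so the residue field
  is simple.\<close>

lemma local_length_prime:
  assumes Q: "primeideal Q R" shows "local_length 1 Q Q (carrier R) = 1"
proof (rule antisym)
  interpret primeideal Q R by fact
  show "1 \<le> local_length 1 Q Q (carrier R)" by (rule local_length_prime_ge_1[OF Q])
  have "\<not> local_chain 1 Q 2 Q (carrier R)"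
  proof
    assume "local_chain 1 Q 2 Q (carrier R)"
    then obtain N M where N: "power_submodule 1 N" "\<not> torsion_modulo 1 Q (carrier R) N" "Q \<subseteq> M" "M \<subseteq> N" "\<not> torsion_modulo 1 Q N M"
      by (auto simp: numeral_2_eq_2)
    have "\<exists>x\<in>N. x \<notin> Q"
    proof (rule ccontr)
      assume "\<not> ?thesis"
      then have "N \<subseteq> M" using N by auto
      then show False using N torsion_refl[of N M 1] power_submoduleD(1)[OF N(1)] by auto
    qed
    then obtain x where x: "x \<in> N" "x \<notin> Q" by auto
    have "x \<otimes> y \<in> N" if "y \<in> carrier R" for y
      using power_submoduleD(6)[OF N(1) that x(1)] that power_submoduleD(7)[OF N(1) x(1)] by (simp add: m_comm)
    then have "torsion_modulo 1 Q (carrier R) N"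
      using x power_submoduleD(7)[OF N(1) x(1)] unfolding torsion_modulo_def by auto
    then show False using N by simp
  qed
  then have "\<not> enat 2 \<le> local_length 1 Q Q (carrier R)" by (simp add: enat_le_local_length_iff)
  then show "local_length 1 Q Q (carrier R) \<le> 1"
    by (cases "local_length 1 Q Q (carrier R)") (auto simp: one_enat_def)
qed

lemma torsion_power:
  assumes "torsion_modulo 1 Q U V" "ideal V R" "q > 0" "U \<subseteq> carrier R"
  shows "torsion_modulo q Q U V"
  unfolding torsion_modulo_def
proof
  fix x assume x: "x \<in> U"
  then obtain s where s: "s \<in> carrier R - Q" "s \<otimes> x \<in> V" using assms(1) by (auto simp: torsion_modulo_def)
  obtain k where k: "q = Suc k" using assms by (cases q) auto
  have "s [^] q \<otimes> x = s [^] k \<otimes> (s \<otimes> x)" using s x assms by (auto simp: k m_assoc)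
  also have "\<dots> \<in> V" using s by (auto intro: ideal.I_l_closed[OF assms(2) s(2)])
  finally show "\<exists>s\<in>carrier R - Q. s [^] q \<otimes> x \<in> V" using s by auto
qed

lemma add_PIdl_ideal: "ideal J R \<Longrightarrow> a \<in> carrier R \<Longrightarrow> ideal (J <+> PIdl a) R"
  by (intro add_ideals cgenideal_ideal)

lemma add_PIdl_props:
  assumes "ideal J R" "a \<in> carrier R" 
  shows "J \<subseteq> J <+> PIdl a" "a \<in> J <+> PIdl a" "ideal K R \<Longrightarrow> J \<subseteq> K \<Longrightarrow> a \<in> K \<Longrightarrow> J <+> PIdl a \<subseteq> K"
proof -
  note P = ideal_imp_power_submodule[OF assms(1), of 1] ideal_imp_power_submodule[OF cgenideal_ideal[OF assms(2)], of 1]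
  show "J \<subseteq> J <+> PIdl a" by (rule subset_set_add1[OF P(2) power_submoduleD(1)[OF P(1)]])
  show "a \<in> J <+> PIdl a" 
    using subset_set_add2[OF P(1) power_submoduleD(1)[OF P(2)]] mem_PIdl[OF assms(2)] by blast
  show "J <+> PIdl a \<subseteq> K" if "ideal K R" "J \<subseteq> K" "a \<in> K"
    using that ideal_imp_power_submodule cgenideal_minimal by (intro set_add_least[of 1]) auto
qed

text \<open>A subquotient that is simple at \<open>Q\<close> is there a copy of the residue field: it is generated by one \<open>b\<close>,
  and the annihilator of \<open>b\<close> modulo \<open>A\<close> agrees with \<open>Q\<close> up to torsion. Hence its length through \<open>q\<close>-th powers is
  that of the residue field.\<close>

lemma local_length_simple:
  assumes Q: "primeideal Q R" and A: "ideal A R" and B: "ideal B R" and sub: "A \<subseteq> B"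
    and simple: "local_length 1 Q A B = 1" and q: "q > 0"
  shows "local_length q Q A B = local_length q Q Q (carrier R)"
proof -
  interpret Q: primeideal Q R by fact
  note psub = ideal_imp_power_submodule
  have carr: "A \<subseteq> carrier R" "B \<subseteq> carrier R" "Q \<subseteq> carrier R" using A B Q.is_ideal ideal.Icarr by auto
  have "\<not> torsion_modulo 1 Q B A"
    using simple Q.local_length_eq_0_iff[OF psub[OF A, of 1] sub carr(2)] by simp
  then obtain b where b: "b \<in> B" "\<And>s. s \<in> carrier R - Q \<Longrightarrow> s \<otimes> b \<notin> A" by (auto simp: torsion_modulo_def)
  then have bc: "b \<in> carrier R" using carr by auto
  let ?M = "A <+> PIdl b"
  have M: "ideal ?M R" by (rule add_PIdl_ideal[OF A bc])
  have MB: "A \<subseteq> ?M" "?M \<subseteq> B" and bM: "b \<in> ?M" using add_PIdl_props[OF A bc] B b sub by auto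
  have split: "local_length q Q A B = local_length q Q A ?M + local_length q Q ?M B" for q
    by (intro Q.local_length_add psub A B M MB)
  have W: "ideal (colon A b) R" by (rule colon_ideal[OF A bc])
  have WQ: "colon A b \<subseteq> Q" using b by (auto simp: colon_def)
  have split': "local_length q Q (colon A b) (carrier R) = local_length q Q (colon A b) Q + local_length q Q Q (carrier R)" for q
    by (intro Q.local_length_add psub W Q.is_ideal WQ carr oneideal)
  have col: "local_length q Q A ?M = local_length q Q (colon A b) (carrier R)" for q
    by (rule local_length_colon[OF Q psub[OF A] bc])
  have "local_length 1 Q A B = local_length 1 Q (colon A b) Q + 1 + local_length 1 Q ?M B"
    unfolding split col split' local_length_prime[OF Q] by simp
  then have 0: "local_length 1 Q (colon A b) Q = 0" "local_length 1 Q ?M B = 0"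
    unfolding simple by (rule enat_add_eq_oneD)+
  have "local_length q Q (colon A b) Q = 0" "local_length q Q ?M B = 0"
    using 0 torsion_power[OF _ W q carr(3)] torsion_power[OF _ M q carr(2)]
    by (simp_all add: Q.local_length_eq_0_iff psub W WQ carr M MB)
  then show ?thesis unfolding split col split' by simp
qed

lemma local_length_scale_aux:
  assumes Q: "primeideal Q R" and A: "ideal A R" and q: "q > 0" 
  shows "ideal B R \<Longrightarrow> A \<subseteq> B \<Longrightarrow> local_length 1 Q A B = enat n \<Longrightarrow> 
     local_length q Q A B = enat n * local_length q Q Q (carrier R)"
proof (induction n arbitrary: B)
  interpret Q: primeideal Q R by fact
  note psub = ideal_imp_power_submodule
  case 0
  then have "local_length q Q A B = 0"
    using torsion_power[OF _ A q, of Q B] 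
    by (simp add: Q.local_length_eq_0_iff psub A ideal.Icarr subsetI zero_enat_def[symmetric])
  then show ?case by (simp add: zero_enat_def[symmetric])
next
  interpret Q: primeideal Q R by fact
  note psub = ideal_imp_power_submodule
  case (Suc n)
  then have "enat (Suc n) \<le> local_length 1 Q A B" by simp
  then have "local_chain 1 Q (Suc n) A B" by (simp only: enat_le_local_length_iff) auto
  then obtain N where N: "power_submodule 1 N" "local_chain 1 Q n A N" "N \<subseteq> B" "\<not> torsion_modulo 1 Q B N"
    by auto
  then have Ni: "ideal N R" using power_submodule_1_iff by simp
  have AN: "A \<subseteq> N" using local_chain_subset[OF N(2)] .
  have split: "local_length q Q A B = local_length q Q A N + local_length q Q N B" for q
    by (intro Q.local_length_add psub A Ni Suc.prems N AN)
  have 1: "enat n \<le> local_length 1 Q A N" by (rule local_length_ge[OF N(2)])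
  have "local_length 1 Q N B \<noteq> 0"
    using N Suc.prems by (subst Q.local_length_eq_0_iff) (auto simp: ideal.Icarr)
  moreover have "enat (Suc n) = local_length 1 Q A N + local_length 1 Q N B" using split[of 1] Suc.prems(3) by simp
  ultimately have *: "local_length 1 Q A N = enat n" "local_length 1 Q N B = 1"
    using enat_add_eq_SucD[OF 1] by blast+
  then show ?case
    using Suc.IH[OF Ni AN] local_length_simple[OF Q Ni Suc.prems(1) N(3) _ q] unfolding split[of q]
    by (simp add: eSuc_enat[symmetric] mult_eSuc add.commute)
qed

text \<open>By additivity, applied to a composition series with factors as in \<open>local_length_simple\<close>.\<close>

lemma local_length_scale:
  assumes "primeideal Q R" "ideal A R" "ideal B R" "A \<subseteq> B" "local_length 1 Q A B \<noteq> \<infinity>" "q > 0"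
  shows "local_length q Q A B = local_length 1 Q A B * local_length q Q Q (carrier R)"
  using local_length_scale_aux[OF assms(1,2,6,3,4)] assms(5) by auto

end

section \<open>Noetherian induction on ideals\<close>

context noetherian_domain
begin

text \<open>Devissage. If \<open>a b\<close> lies in a nonprime \<open>K\<close> while \<open>a\<close> and \<open>b\<close> do not, then \<open>K : a\<close> contains \<open>b\<close> and \<open>K + a R\<close>
  contains \<open>a\<close>, so both are strictly larger than \<open>K\<close>; and \<open>R/K\<close> is an extension of \<open>R/(K + a R)\<close> by \<open>R/(K : a)\<close>.\<close>

lemma ideal_induct [consumes 1, case_names carrier prime step]:
  assumes J: "ideal J R"
    and carrier: "\<Phi> (carrier R)"
    and prime: "\<And>P. primeideal P R \<Longrightarrow> (\<And>K. ideal K R \<Longrightarrow> P \<subset> K \<Longrightarrow> \<Phi> K) \<Longrightarrow> \<Phi> P"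
    and step: "\<And>K a. ideal K R \<Longrightarrow> a \<in> carrier R \<Longrightarrow> a \<notin> K \<Longrightarrow> \<Phi> (colon K a) \<Longrightarrow> \<Phi> (K <+> PIdl a) \<Longrightarrow> \<Phi> K"
  shows "\<Phi> J"
proof -
  have wf: "wf {(K, J). ideal K R \<and> ideal J R \<and> J \<subset> K}"
    unfolding wf_iff_no_infinite_down_chain
  proof (rule notI)
    assume "\<exists>f. \<forall>i. (f (Suc i), f i) \<in> {(K, J). ideal K R \<and> ideal J R \<and> J \<subset> K}"
    then obtain f where "\<forall>i. ideal (f (Suc i)) R \<and> ideal (f i) R \<and> f i \<subset> f (Suc i)" by auto
    then have f: "ideal (f i) R" "f i \<subset> f (Suc i)" for i by blast+
    have "mono f" using f(2) by (intro mono_iff_le_Suc[THEN iffD2]) auto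
    then have "subset.chain {I. ideal I R} (range f)" using f(1)
      using monoD[OF \<open>mono f\<close>] nat_le_linear unfolding subset_chain_def by blast
    then have "\<Union> (range f) \<in> range f" by (intro ideal_chain_is_trivial) auto
    then obtain n where "\<Union> (range f) = f n" by auto
    then show False using f(2)[of n] by blast
  qed
  show ?thesis using J
  proof (induction J rule: wf_induct_rule[OF wf])
    case (1 J)
    then have IH: "\<And>K. ideal K R \<Longrightarrow> J \<subset> K \<Longrightarrow> \<Phi> K" by auto
    consider "J = carrier R" | "primeideal J R" | "J \<noteq> carrier R" "\<not> primeideal J R" by blast
    then show ?case
    proof cases
      case 3
      then obtain a b where ab: "a \<in> carrier R" "b \<in> carrier R" "a \<otimes> b \<in> J" "a \<notin> J" "b \<notin> J"
        using primeidealI[OF 1(2) is_cring] by blast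
      have "b \<in> colon J a" using ab by (auto simp: colon_def m_comm)
      then have "\<Phi> (colon J a)"
        using ab subset_colon[OF 1(2)] by (intro IH colon_ideal 1(2)) auto
      moreover have "\<Phi> (J <+> PIdl a)"
        using ab add_PIdl_props[OF 1(2) ab(1)] by (intro IH add_PIdl_ideal 1(2)) auto
      ultimately show ?thesis using step[OF 1(2) ab(1,4)] by auto
    qed (use carrier prime IH in auto)
  qed
qed

lemma local_length_split_colon:
  assumes Q: "primeideal Q R" and J: "ideal J R" and a: "a \<in> carrier R"
  shows "local_length q Q J (carrier R) = local_length q Q (colon J a) (carrier R) + local_length q Q (J <+> PIdl a) (carrier R)"
proof -
  have "local_length q Q J (carrier R) = local_length q Q J (J <+> PIdl a) + local_length q Q (J <+> PIdl a) (carrier R)"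
    using add_PIdl_props[OF J a] add_PIdl_ideal[OF J a] J
    by (intro primeideal.local_length_add[OF Q] ideal_imp_power_submodule oneideal) (auto simp: ideal.Icarr)
  then show ?thesis using local_length_colon[OF Q ideal_imp_power_submodule[OF J] a] by simp
qed

text \<open>By devissage only quotients by primes above \<open>J\<close> matter; such a prime is \<open>Q\<close> itself, or it contains an
  element outside \<open>Q\<close> and its quotient vanishes at \<open>Q\<close>.\<close>

lemma finite_local_length:
  assumes J: "ideal J R" and Q: "primeideal Q R"
    and min: "\<And>P. primeideal P R \<Longrightarrow> J \<subseteq> P \<Longrightarrow> P \<subseteq> Q \<Longrightarrow> P = Q"
  shows "local_length 1 Q J (carrier R) \<noteq> \<infinity>"
proof -
  have "(\<forall>P. primeideal P R \<longrightarrow> J \<subseteq> P \<longrightarrow> P \<subseteq> Q \<longrightarrow> P = Q) \<longrightarrow> local_length 1 Q J (carrier R) \<noteq> \<infinity>"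
    using J
  proof (induction rule: ideal_induct)
    case carrier
    then show ?case using local_length_refl[OF Q power_submodule_carrier] by simp
  next
    case (prime P)
    interpret P: primeideal P R by fact
    show ?case
    proof (cases "P = Q")
      case True then show ?thesis using local_length_prime[OF Q] by simp
    next
      case False
      show ?thesis
      proof
        assume "\<forall>P'. primeideal P' R \<longrightarrow> P \<subseteq> P' \<longrightarrow> P' \<subseteq> Q \<longrightarrow> P' = Q"
        with False prime have "\<not> P \<subseteq> Q" by blast
        then obtain s where s: "s \<in> P" "s \<notin> Q" by auto
        have "torsion_modulo 1 Q (carrier R) P"
          unfolding torsion_modulo_def using s P.I_r_closed P.Icarr by (intro ballI bexI[of _ s]) auto
        then show "local_length 1 Q P (carrier R) \<noteq> \<infinity>"
          by (subst (asm) primeideal.local_length_eq_0_iff[OF Q, symmetric])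
             (auto intro: ideal_imp_power_submodule P.is_ideal P.Icarr)
      qed
    qed
  next
    case (step K a)
    then show ?case using local_length_split_colon[OF Q step(1,2), of 1] subset_colon[OF step(1,2)] add_PIdl_props(1)[OF step(1,2)]
      by (metis plus_eq_infty_iff_enat subset_trans)
  qed
  then show ?thesis using min by blast
qed

end

section \<open>The Frobenius degree of a prime\<close>

locale F_finite_domain = noetherian_domain R for R (structure) +
  fixes p :: nat
  assumes p_gt_1: "p > 1"
    and additive_power_p: "additive_power p"
    and F_finite: "\<exists>F. finite F \<and> F \<subseteq> carrier R \<and> (\<forall>N. power_submodule p N \<longrightarrow> F \<subseteq> N \<longrightarrow> N = carrier R)"
begin

text \<open>The elements \<open>\<pi> + a_1^p e_1 + \<dots> + a_n^p e_n\<close> with \<open>\<pi>\<close> in \<open>P\<close> and all \<open>a_i\<close> in \<open>A\<close>: up to \<open>P\<close>, the image of \<open>A^n\<close>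
  under the linear map from \<open>R^n\<close> to \<open>R\<close> through the Frobenius map.\<close>

primrec frob_span :: "'a set \<Rightarrow> 'a set \<Rightarrow> 'a list \<Rightarrow> 'a set" where
  "frob_span P A [] = P"
| "frob_span P A (e # es) = frob_span P A es <+> twist p e ` A"

text \<open>The classes in the residue field \<open>\<kappa>(P)\<close> are linearly independent over \<open>\<kappa>(P)^p\<close>.\<close>

primrec frob_indep :: "'a set \<Rightarrow> 'a list \<Rightarrow> bool" where
  "frob_indep P [] \<longleftrightarrow> True"
| "frob_indep P (e # es) \<longleftrightarrow> frob_indep P es \<and> (\<forall>s\<in>carrier R - P. twist p e s \<notin> frob_span P (carrier R) es)"

text \<open>The degree \<open>[\<kappa>(P) : \<kappa>(P)^p]\<close>.\<close>

definition frob_degree :: "'a set \<Rightarrow> nat" where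
  "frob_degree P = the_enat (local_length p P P (carrier R))"

lemma p_pos: "p > 0" using p_gt_1 by simp

lemma twist_p_image_submodule:
  "e \<in> carrier R \<Longrightarrow> ideal A R \<Longrightarrow> power_submodule p (twist p e ` A)"
  using power_submodule_twist_image[OF additive_power_p, of e 1 A] ideal_imp_power_submodule by simp

lemma frob_span_submodule:
  assumes "ideal P R" "ideal A R" "set es \<subseteq> carrier R"
  shows "power_submodule p (frob_span P A es)"
  using assms(3)
  by (induction es)
    (use assms in \<open>auto intro: power_submodule_add twist_p_image_submodule ideal_imp_power_submodule[OF assms(1)]\<close>)

lemma subset_frob_span:
  assumes "ideal P R" "ideal A R" "set es \<subseteq> carrier R"
  shows "P \<subseteq> frob_span P A es"
  using assms(3)
proof (induction es)
  case (Cons e es)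
  then show ?case
    using subset_set_add1[OF twist_p_image_submodule[of e A] power_submoduleD(1)[OF frob_span_submodule[of P A es]]] assms
    by auto
qed auto

lemma frob_span_mono: "A \<subseteq> B \<Longrightarrow> frob_span P A es \<subseteq> frob_span P B es"
  by (induction es) (simp_all add: set_add_mono image_mono)

lemma frob_span_self:
  assumes P: "ideal P R" and "set es \<subseteq> carrier R" shows "frob_span P P es = P"
  using assms(2)
proof (induction es)
  case (Cons e es)
  then have e: "e \<in> carrier R" by auto
  have "twist p e ` P \<subseteq> P"
  proof
    fix y assume "y \<in> twist p e ` P"
    then obtain z where z: "z \<in> P" "y = z [^] p \<otimes> e" by (auto simp: twist_def)
    obtain k where k: "p = Suc k" using p_pos by (cases p) auto
    have zc: "z \<in> carrier R" using z ideal.Icarr[OF P] by auto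
    have "z [^] p \<in> P" unfolding k using ideal.I_l_closed[OF P z(1)] zc by simp
    then show "y \<in> P" using z e ideal.I_r_closed[OF P] by auto
  qed
  then show ?case using Cons
      set_add_absorb(1)[OF ideal_imp_power_submodule[OF P] twist_p_image_submodule[OF e P]] by simp
qed simp

text \<open>Greedy choice: keep a generator exactly if it is independent of those kept before.\<close>

lemma frob_indep_spanning_exists:
  assumes P: "primeideal P R" and "set gs \<subseteq> carrier R"
  shows "\<exists>es. set es \<subseteq> carrier R \<and> frob_indep P es \<and>
     (\<forall>g\<in>set gs. \<exists>s\<in>carrier R - P. twist p g s \<in> frob_span P (carrier R) es)"
  using assms(2)
proof (induction gs)
  case Nil
  then show ?case by (intro exI[of _ "[]"]) auto
next
  case (Cons g gs)
  interpret P: primeideal P R by fact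
  obtain es where es: "set es \<subseteq> carrier R" "frob_indep P es"
     "\<forall>g\<in>set gs. \<exists>s\<in>carrier R - P. twist p g s \<in> frob_span P (carrier R) es"
    using Cons by auto
  have g: "g \<in> carrier R" using Cons by auto
  show ?case
  proof (cases "\<exists>s\<in>carrier R - P. twist p g s \<in> frob_span P (carrier R) es")
    case True
    then show ?thesis using es by (intro exI[of _ es]) auto
  next
    case False
    note G = frob_span_submodule[OF P.is_ideal oneideal es(1)]
    have sub: "frob_span P (carrier R) es \<subseteq> frob_span P (carrier R) (g # es)"
      using subset_set_add1[OF twist_p_image_submodule[OF g oneideal] power_submoduleD(1)[OF G]] by simp
    have "twist p g ` carrier R \<subseteq> frob_span P (carrier R) (g # es)"
      using subset_set_add2[OF G power_submoduleD(1)[OF twist_p_image_submodule[OF g oneideal]]] by simp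
    then have "twist p g \<one> \<in> frob_span P (carrier R) (g # es)" by auto
    then have "\<exists>s\<in>carrier R - P. twist p g s \<in> frob_span P (carrier R) (g # es)"
      using P.outside_one by blast
    moreover have "\<exists>s\<in>carrier R - P. twist p h s \<in> frob_span P (carrier R) (g # es)" if "h \<in> set gs" for h
      using es(3) sub that by blast
    ultimately show ?thesis using es(1,2) False g
      by (intro exI[of _ "g # es"]) (auto simp del: frob_span.simps(2))
  qed
qed

lemma common_denominator:
  assumes P: "primeideal P R" and N: "power_submodule p N" and "set gs \<subseteq> carrier R"
    and "\<forall>g\<in>set gs. \<exists>s\<in>carrier R - P. twist p g s \<in> N"
  shows "\<exists>c\<in>carrier R - P. \<forall>g\<in>set gs. twist p g c \<in> N"
  using assms(3,4)
proof (induction gs)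
  case Nil
  then show ?case using primeideal.outside_one[OF P] by auto
next
  case (Cons g gs)
  then obtain c where c: "c \<in> carrier R - P" "\<forall>g\<in>set gs. twist p g c \<in> N" by auto
  obtain s where s: "s \<in> carrier R - P" "twist p g s \<in> N" using Cons by auto
  have *: "twist p h (a \<otimes> b) \<in> N" if "twist p h b \<in> N" "h \<in> carrier R" "a \<in> carrier R" "b \<in> carrier R" for a b h
  proof -
    have "twist p h (a \<otimes> b) = a [^] p \<otimes> twist p h b"
      using that by (simp add: twist_def nat_pow_distrib m_assoc)
    then show ?thesis using that power_submoduleD(6)[OF N] by auto
  qed
  have "twist p g (c \<otimes> s) \<in> N" using * s c Cons by auto
  moreover have "\<forall>h\<in>set gs. twist p h (s \<otimes> c) \<in> N" using * s c Cons by auto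
  ultimately show ?case using s c primeideal.outside_mult[OF P c(1) s(1)] m_comm[of s c]
    by (intro bexI[of _ "c \<otimes> s"]) auto
qed

text \<open>The finitely many denominators from \<open>frob_indep_spanning_exists\<close> have a common multiple \<open>c\<close>; then \<open>c^p\<close>
  multiplies a generating set of \<open>R\<close> into the span.\<close>

lemma frob_basis_exists:
  assumes P: "primeideal P R"
  obtains es c where "set es \<subseteq> carrier R" "frob_indep P es" "c \<in> carrier R - P"
    "PIdl (c [^] p) \<subseteq> frob_span P (carrier R) es"
proof -
  interpret P: primeideal P R by fact
  obtain F where F: "finite F" "F \<subseteq> carrier R" "\<And>N. power_submodule p N \<Longrightarrow> F \<subseteq> N \<Longrightarrow> N = carrier R"
    using F_finite by blast
  obtain gs where gs: "set gs = F" using finite_list[OF F(1)] by auto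
  obtain es where es: "set es \<subseteq> carrier R" "frob_indep P es"
     "\<forall>g\<in>set gs. \<exists>s\<in>carrier R - P. twist p g s \<in> frob_span P (carrier R) es"
    using frob_indep_spanning_exists[OF P, of gs] F gs by auto
  note G = frob_span_submodule[OF P.is_ideal oneideal es(1)]
  obtain c where c: "c \<in> carrier R - P" "\<forall>g\<in>set gs. twist p g c \<in> frob_span P (carrier R) es"
    using common_denominator[OF P G _ es(3)] F gs by auto
  have "F \<subseteq> colon (frob_span P (carrier R) es) (c [^] p)"
    using c F gs by (auto simp: colon_def twist_def m_comm subset_eq)
  then have "colon (frob_span P (carrier R) es) (c [^] p) = carrier R"
    using c by (intro F(3) colon_power_submodule G) auto
  then have "PIdl (c [^] p) \<subseteq> frob_span P (carrier R) es"
    by (auto simp: cgenideal_def colon_def)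
  then show ?thesis using es c that by blast
qed

lemma twist_one: "x \<in> carrier R \<Longrightarrow> twist (Suc 0) \<one> x = x"
  by (simp add: twist_def)

lemma frob_indepD:
  assumes P: "primeideal P R" and "frob_indep P (e # es)" "x \<in> carrier R" "twist p e x \<in> frob_span P (carrier R) es"
  shows "x \<in> P"
  using assms by auto

text \<open>Modulo \<open>P\<close> the span is free on the list, so enlarging the coefficients from \<open>A\<close> to \<open>R\<close> contributes one
  copy of \<open>R/A\<close> for each element of the list.\<close>

lemma local_length_frob_span:
  assumes P: "primeideal P R" and Q: "primeideal Q R" and A: "ideal A R" and PA: "P \<subseteq> A"
    and "set es \<subseteq> carrier R" "frob_indep P es"
  shows "local_length p Q (frob_span P A es) (frob_span P (carrier R) es)
     = enat (length es) * local_length 1 Q A (carrier R)"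
  using assms(5,6)
proof (induction es)
  case Nil
  then show ?case using local_length_refl[OF Q] P by (simp add: ideal_imp_power_submodule primeideal.axioms(1) zero_enat_def[symmetric])
next
  case (Cons e es)
  interpret P: primeideal P R by fact
  interpret Q: primeideal Q R by fact
  define V where "V = frob_span P A es"
  define G where "G = frob_span P (carrier R) es"
  define \<psi> where "\<psi> = twist p e"
  have e: "e \<in> carrier R" and es: "set es \<subseteq> carrier R" "frob_indep P es" using Cons by auto
  have V: "power_submodule p V" and G: "power_submodule p G"
    unfolding V_def G_def using A es P.is_ideal oneideal by (auto intro!: frob_span_submodule)
  have VG: "V \<subseteq> G" unfolding V_def G_def using A by (intro frob_span_mono) (auto simp: ideal.Icarr)
  have PV: "P \<subseteq> V" unfolding V_def using A es P.is_ideal by (intro subset_frob_span)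
  have psiA: "power_submodule p (\<psi> ` A)" and psiR: "power_submodule p (\<psi> ` carrier R)"
    unfolding \<psi>_def using e A oneideal by (auto intro!: twist_p_image_submodule)
  have psi_sub: "\<psi> ` A \<subseteq> \<psi> ` carrier R" using A by (auto simp: ideal.Icarr)
  note cV = power_submoduleD(1)[OF V] and cG = power_submoduleD(1)[OF G]
    and cA = power_submoduleD(1)[OF psiA] and cR = power_submoduleD(1)[OF psiR]
  have indep: "x \<in> P" if "x \<in> carrier R" "\<psi> x \<in> G" for x
    using frob_indepD[OF P Cons.prems(2)] that unfolding \<psi>_def G_def by auto
  let ?B = "V <+> \<psi> ` A" and ?B' = "V <+> \<psi> ` carrier R" and ?G = "G <+> \<psi> ` carrier R"
  have B: "power_submodule p ?B" and B': "power_submodule p ?B'" and G': "power_submodule p ?G"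
    using V G psiA psiR by (auto intro: power_submodule_add)
  \<comment> \<open>First the coefficients of \<open>e\<close> grow from \<open>A\<close> to \<open>R\<close>, then those of the other elements.\<close>
  have "local_length p Q ?B ?G = local_length p Q ?B ?B' + local_length p Q ?B' ?G"
    using psi_sub VG by (intro Q.local_length_add B B' G' set_add_mono) auto
  also have "local_length p Q ?B ?B' = local_length 1 Q A (carrier R)"
  proof -
    have "{z \<in> carrier R. \<psi> z \<in> ?B} = A"
    proof (intro equalityI subsetI)
      fix z assume "z \<in> {z \<in> carrier R. \<psi> z \<in> ?B}"
      then have z: "z \<in> carrier R" "\<psi> z \<in> ?B" by auto
      from z(2) obtain v w where "v \<in> V" "w \<in> \<psi> ` A" "\<psi> z = v \<oplus> w" by (rule set_addE)
      then obtain a where a: "v \<in> V" "a \<in> A" "\<psi> z = v \<oplus> \<psi> a" by auto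
      have carr: "a \<in> carrier R" "v \<in> carrier R" using a A cV by (auto simp: ideal.Icarr)
      have "\<psi> (z \<ominus> a) = (v \<oplus> \<psi> a) \<ominus> \<psi> a"
        using carr z e a(3) by (simp add: \<psi>_def twist_diff additive_power_p)
      also have "\<dots> = v" using carr e by (simp add: minus_eq a_assoc r_neg \<psi>_def)
      finally have "\<psi> (z \<ominus> a) \<in> G" using a VG by auto
      then have "z \<ominus> a \<in> A" using indep[of "z \<ominus> a"] carr z PA by auto
      then have "z \<ominus> a \<oplus> a \<in> A" using a A by (meson additive_subgroup.a_closed ideal.axioms(1))
      then show "z \<in> A" using carr z by (simp add: minus_eq a_assoc l_neg)
    next
      fix z assume z: "z \<in> A"
      then have "\<psi> z \<in> ?B" using subset_set_add2[OF V cA] by auto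
      then show "z \<in> {z \<in> carrier R. \<psi> z \<in> ?B}" using z A by (auto simp: ideal.Icarr)
    qed
    moreover have "?B <+> \<psi> ` carrier R = ?B'"
      using set_add_assoc[OF cV cA cR] set_add_absorb(2)[OF psiR psiA psi_sub] by simp
    ultimately show ?thesis
      using Q.local_length_twist[OF additive_power_p e, of 1 ?B "carrier R"] B power_submodule_carrier
      by (simp add: \<psi>_def)
  qed
  also have "local_length p Q ?B' ?G = local_length p Q V G"
  proof -
    have "{z \<in> G. twist 1 \<one> z \<in> ?B'} = V"
    proof (intro equalityI subsetI)
      fix z assume "z \<in> {z \<in> G. twist 1 \<one> z \<in> ?B'}"
      then have z: "z \<in> G" "z \<in> ?B'" using cG by (auto simp: twist_one)
      from z(2) obtain v w where "v \<in> V" "w \<in> \<psi> ` carrier R" "z = v \<oplus> w" by (rule set_addE)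
      then obtain x where x: "v \<in> V" "x \<in> carrier R" "z = v \<oplus> \<psi> x" by auto
      have carr: "v \<in> carrier R" "\<psi> x \<in> carrier R" using x cV e by (auto simp: \<psi>_def)
      have "\<psi> x = z \<ominus> v" using carr unfolding x(3) by (simp add: minus_eq a_comm[of v] a_assoc r_neg)
      moreover have "z \<ominus> v \<in> G" by (rule power_submoduleD(5)[OF G]) (use z x VG in auto)
      ultimately have "\<psi> x \<in> G" by simp
      then have "x \<in> P" using indep x by auto
      then have "\<psi> x \<in> frob_span P P [e]"
        using subset_set_add2[OF ideal_imp_power_submodule[OF P.is_ideal] power_submoduleD(1)[OF twist_p_image_submodule[OF e P.is_ideal]]]
        by (auto simp: \<psi>_def)
      then have "\<psi> x \<in> V" using frob_span_self[OF P.is_ideal, of "[e]"] e PV by auto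
      then show "z \<in> V" using x power_submoduleD(3)[OF V] by auto
    next
      fix z assume "z \<in> V"
      then show "z \<in> {z \<in> G. twist 1 \<one> z \<in> ?B'}"
        using VG subset_set_add1[OF psiR cV] cV by (auto simp: twist_one subset_eq)
    qed
    moreover have "?B' <+> G = ?G"
    proof -
      have "?B' <+> G = G <+> ?B'" by (rule set_add_comm[OF power_submoduleD(1)[OF B'] cG])
      also have "\<dots> = (G <+> V) <+> \<psi> ` carrier R" by (rule set_add_assoc[symmetric, OF cG cV cR])
      also have "G <+> V = G" by (rule set_add_absorb(1)[OF G V VG])
      finally show ?thesis .
    qed
    moreover have "twist 1 \<one> ` G = G" using cG by (auto simp: twist_one subset_eq image_def)
    ultimately show ?thesis
      using Q.local_length_twist[OF additive_power_1 one_closed, of p ?B' G] B' G by simp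
  qed
  also have "local_length p Q V G = enat (length es) * local_length 1 Q A (carrier R)"
    unfolding V_def G_def by (rule Cons.IH[OF es])
  finally show ?case
    by (simp add: V_def G_def \<psi>_def eSuc_enat[symmetric] mult_eSuc add.commute)
qed

lemma torsion_of_multiple:
  assumes P: "primeideal P R" and c: "c \<in> carrier R - P" "PIdl (c [^] p) \<subseteq> G"
  shows "torsion_modulo p P (carrier R) G"
  unfolding torsion_modulo_def
proof
  fix x assume x: "x \<in> carrier R"
  then have "c [^] p \<otimes> x \<in> PIdl (c [^] p)" using c by (auto simp: cgenideal_def m_comm)
  then show "\<exists>s\<in>carrier R - P. s [^] p \<otimes> x \<in> G" using c by auto
qed

text \<open>At \<open>P\<close> the common denominator is invertible, so there the span is everything.\<close>

lemma frob_basis_length: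
  assumes P: "primeideal P R" and es: "set es \<subseteq> carrier R" "frob_indep P es" and c: "c \<in> carrier R - P"
    "PIdl (c [^] p) \<subseteq> frob_span P (carrier R) es"
  shows "local_length p P P (carrier R) = enat (length es)"
proof -
  interpret P: primeideal P R by fact
  let ?G = "frob_span P (carrier R) es"
  have G: "power_submodule p ?G" by (intro frob_span_submodule P.is_ideal oneideal es)
  have PG: "P \<subseteq> ?G" by (intro subset_frob_span P.is_ideal oneideal es)
  have "local_length p P P (carrier R) = local_length p P P ?G + local_length p P ?G (carrier R)"
    using PG by (intro P.local_length_add G ideal_imp_power_submodule P.is_ideal oneideal power_submoduleD(1)[OF G])
  also have "local_length p P ?G (carrier R) = 0"
    using torsion_of_multiple[OF P c] by (subst P.local_length_eq_0_iff[OF G power_submoduleD(1)[OF G] order_refl])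
  also have "local_length p P P ?G = enat (length es)"
    using local_length_frob_span[OF P P P.is_ideal order_refl es] frob_span_self[OF P.is_ideal es(1)] local_length_prime[OF P]
    by simp
  finally show ?thesis by simp
qed

lemma frob_degree:
  assumes P: "primeideal P R" shows "local_length p P P (carrier R) = enat (frob_degree P)"
  using frob_basis_exists[OF P] frob_basis_length[OF P] unfolding frob_degree_def by (metis the_enat.simps)

lemma frob_degree_pos:
  assumes P: "primeideal P R" shows "frob_degree P \<ge> 1"
  using local_length_prime_ge_1[OF P, of p] frob_degree[OF P] by (simp add: one_enat_def)

lemma local_length_frob_scale:
  assumes Q: "primeideal Q R" and "ideal A R" and "local_length 1 Q A (carrier R) \<noteq> \<infinity>"
  shows "local_length p Q A (carrier R) = enat (frob_degree Q) * local_length 1 Q A (carrier R)"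
  using local_length_scale[OF Q assms(2) oneideal _ assms(3) p_pos] frob_degree[OF Q] ideal.Icarr[OF assms(2)]
  by (simp add: mult.commute subset_eq)

lemma mem_add_PIdl:
  assumes "z \<in> K <+> PIdl a" "a \<in> carrier R"
  obtains k y where "k \<in> K" "y \<in> carrier R" "z = k \<oplus> y \<otimes> a"
  using assms(1) by (rule set_addE) (auto simp: cgenideal_def that)

lemma add_PIdl_memI: "k \<in> K \<Longrightarrow> y \<in> carrier R \<Longrightarrow> k \<oplus> y \<otimes> a \<in> K <+> PIdl a"
  by (auto intro!: set_addI simp: cgenideal_def)

lemma PIdl_one: "PIdl \<one> = carrier R"
  by (force simp: cgenideal_def)

text \<open>\<open>P + x^i R\<close> modulo \<open>P + x^(i+1) R\<close> is a copy of \<open>R/(P + x R)\<close>, as \<open>x\<close> is not a zero divisor modulo the prime \<open>P\<close>.\<close>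

lemma local_length_power_generator:
  assumes P: "primeideal P R" and Q: "primeideal Q R" and x: "x \<in> carrier R - P"
  shows "local_length q Q (P <+> PIdl (x [^] (i::nat))) (carrier R)
    = enat i * local_length q Q (P <+> PIdl x) (carrier R)"
proof (induction i)
  interpret P: primeideal P R by fact
  note psub = ideal_imp_power_submodule
  case 0
  have "P <+> PIdl (x [^] (0::nat)) = carrier R"
    using set_add_absorb(2)[OF psub[OF oneideal] psub[OF P.is_ideal]] P.Icarr by (simp add: PIdl_one subset_eq)
  then show ?case using local_length_refl[OF Q power_submodule_carrier] by (simp add: zero_enat_def[symmetric])
next
  interpret P: primeideal P R by fact
  interpret Q: primeideal Q R by fact
  note psub = ideal_imp_power_submodule
  case (Suc i)
  have xc: "x \<in> carrier R" using x by simp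
  let ?K = "P <+> PIdl (x [^] Suc i)" and ?L = "P <+> PIdl (x [^] i)"
  have K: "ideal ?K R" and L: "ideal ?L R" using xc P.is_ideal by (auto intro!: add_PIdl_ideal)
  have cK: "?K \<subseteq> carrier R" using ideal.Icarr[OF K] by auto
  have "x [^] Suc i \<in> ?L"
    using ideal.I_r_closed[OF L add_PIdl_props(2)[OF P.is_ideal, of "x [^] i"] xc] xc by simp
  then have KL: "?K \<subseteq> ?L" using xc add_PIdl_props[OF P.is_ideal] L P.is_ideal by auto
  have KL': "?K <+> PIdl (x [^] i) = ?L"
  proof
    show "?K <+> PIdl (x [^] i) \<subseteq> ?L"
      using add_PIdl_props(3)[OF K _ L KL] add_PIdl_props(2)[OF P.is_ideal] xc by auto
    show "?L \<subseteq> ?K <+> PIdl (x [^] i)"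
      using add_PIdl_props(1)[OF P.is_ideal] xc by (intro set_add_mono) auto
  qed
  have "local_length q Q ?K (carrier R) = local_length q Q ?K ?L + local_length q Q ?L (carrier R)"
    using KL by (intro Q.local_length_add psub K L oneideal) (auto simp: ideal.Icarr[OF L])
  also have "local_length q Q ?K ?L = local_length q Q (colon ?K (x [^] i)) (carrier R)"
    using local_length_colon[OF Q psub[OF K, of q], of "x [^] i"] xc KL' by simp
  also have "colon ?K (x [^] i) = P <+> PIdl x"
  proof (intro equalityI subsetI)
    fix z assume "z \<in> colon ?K (x [^] i)"
    then have z: "z \<in> carrier R" "z \<otimes> x [^] i \<in> ?K" by (auto simp: colon_def)
    from z(2) obtain k y where ky: "k \<in> P" "y \<in> carrier R" "z \<otimes> x [^] i = k \<oplus> y \<otimes> x [^] Suc i"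
      using xc by (auto elim: mem_add_PIdl)
    have kc: "k \<in> carrier R" using ky P.Icarr by auto
    have "(z \<ominus> y \<otimes> x) \<otimes> x [^] i = z \<otimes> x [^] i \<ominus> y \<otimes> x [^] Suc i"
      using z(1) ky(1,2) xc by (simp add: minus_eq l_distr r_distr l_minus r_minus m_ac)
    also have "\<dots> = k" unfolding ky(3) using kc ky(2) xc by (simp add: minus_eq a_assoc r_neg)
    finally have "(z \<ominus> y \<otimes> x) \<otimes> x [^] i \<in> P" using ky by simp
    then have "z \<ominus> y \<otimes> x \<in> P" using P.outside_power[OF x, of i] P.I_prime[of "z \<ominus> y \<otimes> x" "x [^] i"] z ky xc by auto
    from add_PIdl_memI[OF this ky(2), of x] show "z \<in> P <+> PIdl x"
      using z ky xc by (simp add: minus_eq a_assoc l_neg)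
  next
    fix z assume "z \<in> P <+> PIdl x"
    then obtain k y where ky: "k \<in> P" "y \<in> carrier R" "z = k \<oplus> y \<otimes> x"
      using xc by (auto elim: mem_add_PIdl)
    have kc: "k \<in> carrier R" using ky P.Icarr by auto
    have "z \<otimes> x [^] i = k \<otimes> x [^] i \<oplus> y \<otimes> x [^] Suc i" using ky kc xc by (simp add: l_distr r_distr m_ac)
    moreover have "k \<otimes> x [^] i \<in> P" using ky xc P.I_r_closed by auto
    ultimately show "z \<in> colon ?K (x [^] i)"
      using add_PIdl_memI[of "k \<otimes> x [^] i" P y "x [^] Suc i"] ky kc xc by (auto simp: colon_def)
  qed
  finally show ?case using Suc.IH by (simp add: eSuc_enat[symmetric] mult_eSuc)
qed

text \<open>With coefficients in \<open>P + x R\<close>, the span is \<open>P + x^p G\<close> for the full span \<open>G\<close>.\<close>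

lemma frob_span_multiple:
  assumes P: "ideal P R" and x: "x \<in> carrier R" and es: "set es \<subseteq> carrier R"
  shows "v \<in> frob_span P (P <+> PIdl x) es \<Longrightarrow>
     \<exists>\<pi>\<in>P. \<exists>g\<in>frob_span P (carrier R) es. v = \<pi> \<oplus> g \<otimes> x [^] p"
    and "g \<in> frob_span P (carrier R) es \<Longrightarrow> g \<otimes> x [^] p \<in> frob_span P (P <+> PIdl x) es"
proof -
  have K: "ideal (P <+> PIdl x) R" by (intro add_PIdl_ideal P x)
  have "(v \<in> frob_span P (P <+> PIdl x) es \<longrightarrow>
     (\<exists>\<pi>\<in>P. \<exists>g\<in>frob_span P (carrier R) es. v = \<pi> \<oplus> g \<otimes> x [^] p)) \<and>
    (g \<in> frob_span P (carrier R) es \<longrightarrow> g \<otimes> x [^] p \<in> frob_span P (P <+> PIdl x) es)" for v g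
    using es
  proof (induction es arbitrary: v g)
    case Nil
    show ?case
    proof safe
      assume v: "v \<in> frob_span P (P <+> PIdl x) []"
      then show "\<exists>\<pi>\<in>P. \<exists>g\<in>frob_span P (carrier R) []. v = \<pi> \<oplus> g \<otimes> x [^] p"
        using x P by (intro bexI[of _ v] bexI[of _ \<zero>]) (auto simp: ideal.Icarr additive_subgroup.zero_closed ideal.axioms(1))
    qed (use x P in \<open>auto simp: ideal.I_r_closed\<close>)
  next
    case (Cons e es)
    then have e: "e \<in> carrier R" and es: "set es \<subseteq> carrier R" by auto
    have G: "power_submodule p (frob_span P (carrier R) es)" by (intro frob_span_submodule P oneideal es)
    note cG = power_submoduleD(7)[OF G]
    show ?case
    proof (intro conjI impI)
      assume "v \<in> frob_span P (P <+> PIdl x) (e # es)"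
      then have "v \<in> frob_span P (P <+> PIdl x) es <+> twist p e ` (P <+> PIdl x)" by simp
      then obtain v' w where "v' \<in> frob_span P (P <+> PIdl x) es" "w \<in> twist p e ` (P <+> PIdl x)" "v = v' \<oplus> w"
        by (rule set_addE)
      then obtain a where v: "v' \<in> frob_span P (P <+> PIdl x) es" "a \<in> P <+> PIdl x" "v = v' \<oplus> twist p e a"
        by blast
      obtain \<pi> g where pg: "\<pi> \<in> P" "g \<in> frob_span P (carrier R) es" "v' = \<pi> \<oplus> g \<otimes> x [^] p"
        using Cons.IH[OF es] v by blast
      obtain k y where ky: "k \<in> P" "y \<in> carrier R" "a = k \<oplus> y \<otimes> x" using v(2) x by (rule mem_add_PIdl)
      have carr: "k \<in> carrier R" "\<pi> \<in> carrier R" "g \<in> carrier R" using ky pg cG P by (auto simp: ideal.Icarr)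
      have ke: "twist p e k \<in> P"
      proof -
        have "twist p e k \<in> frob_span P P [e]"
          using ky subset_set_add2[OF ideal_imp_power_submodule[OF P] power_submoduleD(1)[OF twist_p_image_submodule[OF e P]]]
          by auto
        then show ?thesis using frob_span_self[OF P, of "[e]"] e by simp
      qed
      have "twist p e a = twist p e k \<oplus> twist p e (y \<otimes> x)"
        unfolding ky(3) using carr ky x e by (simp add: twist_add additive_power_p)
      also have "twist p e (y \<otimes> x) = twist p e y \<otimes> x [^] p"
        using ky x e by (simp add: twist_def nat_pow_distrib m_ac)
      finally have "v = (\<pi> \<oplus> twist p e k) \<oplus> (g \<oplus> twist p e y) \<otimes> x [^] p"
        using v(3) pg(3) carr ky x e by (simp add: l_distr a_ac)
      moreover have "\<pi> \<oplus> twist p e k \<in> P" using pg ke P by (simp add: additive_subgroup.a_closed ideal.axioms(1))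
      moreover have "g \<oplus> twist p e y \<in> frob_span P (carrier R) (e # es)"
        using pg ky by (auto intro!: set_addI)
      ultimately show "\<exists>\<pi>\<in>P. \<exists>g\<in>frob_span P (carrier R) (e # es). v = \<pi> \<oplus> g \<otimes> x [^] p" by blast
    next
      assume "g \<in> frob_span P (carrier R) (e # es)"
      then obtain g' y where g: "g' \<in> frob_span P (carrier R) es" "y \<in> carrier R" "g = g' \<oplus> twist p e y"
        by (auto elim!: set_addE)
      have "g \<otimes> x [^] p = g' \<otimes> x [^] p \<oplus> twist p e (y \<otimes> x)"
        using g cG x e by (simp add: twist_def nat_pow_distrib l_distr r_distr m_ac)
      moreover have "y \<otimes> x \<in> P <+> PIdl x"
        using subset_set_add2[OF ideal_imp_power_submodule[OF P] PIdl_closed[OF x]] g x by (auto simp: cgenideal_def)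
      ultimately show "g \<otimes> x [^] p \<in> frob_span P (P <+> PIdl x) (e # es)"
        using Cons.IH[OF es, of _ g'] g by (auto intro!: set_addI)
    qed
  qed
  then show "v \<in> frob_span P (P <+> PIdl x) es \<Longrightarrow>
     \<exists>\<pi>\<in>P. \<exists>g\<in>frob_span P (carrier R) es. v = \<pi> \<oplus> g \<otimes> x [^] p"
    and "g \<in> frob_span P (carrier R) es \<Longrightarrow> g \<otimes> x [^] p \<in> frob_span P (P <+> PIdl x) es"
    by blast+
qed

end

section \<open>Frobenius degrees along chains of primes\<close>

text \<open>The \<open>n\<close>-th power of this relation relates the ends of chains of primes of length \<open>n\<close>.\<close>

definition prime_inclusion :: "('a, 'c) ring_scheme \<Rightarrow> ('a set \<times> 'a set) set" where
  "prime_inclusion R = {(P, Q). primeideal P R \<and> primeideal Q R \<and> P \<subset> Q}"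

text \<open>The homogeneous recursion grows like \<open>p^(n(e+1))\<close>, and the inhomogeneous term is smaller by the factor
  \<open>p^n\<close>, so it does not change the order of growth.\<close>

lemma polynomial_recursion_bound:
  fixes u :: "nat \<Rightarrow> nat"
  assumes p: "p \<ge> 2" and step: "\<And>n. u (Suc n) \<le> p ^ Suc e * u n + D * p ^ (n * e)"
  shows "u n \<le> (u 0 + D) * p ^ (n * Suc e)"
proof -
  \<comment> \<open>The added term absorbs the inhomogeneity, as \<open>1 + p^e \<le> p^(e+1)\<close>.\<close>
  have "u n + D * p ^ (n * e) \<le> (u 0 + D) * p ^ (n * Suc e)"
  proof (induction n)
    case (Suc n)
    have "1 + p ^ e \<le> p ^ Suc e"
    proof -
      have "1 + p ^ e \<le> 2 * p ^ e" using p by simp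
      also have "\<dots> \<le> p ^ Suc e" using p by simp
      finally show ?thesis .
    qed
    have "u (Suc n) + D * p ^ (Suc n * e) \<le> p ^ Suc e * u n + D * p ^ (n * e) * (1 + p ^ e)"
      using step[of n] by (simp add: power_add algebra_simps)
    also have "\<dots> \<le> p ^ Suc e * u n + D * p ^ (n * e) * p ^ Suc e"
      using \<open>1 + p ^ e \<le> p ^ Suc e\<close> by (intro add_left_mono mult_left_mono) auto
    also have "\<dots> = p ^ Suc e * (u n + D * p ^ (n * e))" by (simp add: algebra_simps)
    also have "\<dots> \<le> p ^ Suc e * ((u 0 + D) * p ^ (n * Suc e))" by (intro mult_left_mono Suc.IH) auto
    also have "\<dots> = (u 0 + D) * p ^ (Suc n * Suc e)" by (simp add: power_add algebra_simps)
    finally show ?case .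
  qed simp
  then show ?thesis by simp
qed

context F_finite_domain
begin

lemma twist_one_image: "U \<subseteq> carrier R \<Longrightarrow> twist (Suc 0) \<one> ` U = U"
proof -
  assume U: "U \<subseteq> carrier R"
  have "twist (Suc 0) \<one> ` U = (\<lambda>x. x) ` U" by (rule image_cong) (use U twist_one in auto)
  then show ?thesis by simp
qed

text \<open>All lengths here are through the Frobenius map and at \<open>Q\<close>, unless said otherwise. Let \<open>x\<close> lie in \<open>Q\<close> outside
  \<open>P\<close>, let \<open>G\<close> be the span of a basis at \<open>P\<close>, and let \<open>V = P + x^p G\<close>. Multiplication by \<open>x^p\<close> shows that \<open>R/G\<close> and
  \<open>(P + x^p R)/V\<close> have the same length; it is finite as \<open>P\<close> and \<open>Q\<close> are adjacent and \<open>G\<close> contains \<open>P + c^p R\<close> for some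
  \<open>c\<close> outside \<open>P\<close>. So \<open>G/V\<close> has the same length as \<open>R/(P + x^p R)\<close>. If \<open>l\<close> is the ordinary length of
  \<open>R/(P + x R)\<close> at \<open>Q\<close>, the former is \<open>l\<close> times the degree of \<open>P\<close>, the latter \<open>p l\<close> times the degree of \<open>Q\<close>.\<close>

lemma frob_degree_adjacent:
  assumes P: "primeideal P R" and Q: "primeideal Q R" and PQ: "P \<subset> Q"
    and adj: "\<And>P'. primeideal P' R \<Longrightarrow> P \<subset> P' \<Longrightarrow> P' \<subset> Q \<Longrightarrow> False"
  shows "frob_degree P = p * frob_degree Q"
proof -
  interpret P: primeideal P R by fact
  interpret Q: primeideal Q R by fact
  note psub = ideal_imp_power_submodule
  obtain es c where es: "set es \<subseteq> carrier R" "frob_indep P es" and c: "c \<in> carrier R - P"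
    "PIdl (c [^] p) \<subseteq> frob_span P (carrier R) es"
    using frob_basis_exists[OF P] .
  have r: "frob_degree P = length es" using frob_basis_length[OF P es c] frob_degree[OF P] by simp
  obtain x where x: "x \<in> Q" "x \<notin> P" using PQ by auto
  then have xc: "x \<in> carrier R" and xP: "x \<in> carrier R - P" using Q.Icarr by auto
  have fin: "local_length 1 Q K (carrier R) \<noteq> \<infinity>" if "ideal K R" "P \<subset> K" for K
    using that adj by (intro finite_local_length Q) blast+
  define U where "U = P <+> PIdl x"
  define Up where "Up = P <+> PIdl (x [^] p)"
  define V where "V = frob_span P U es"
  define G where "G = frob_span P (carrier R) es"
  have U: "ideal U R" and Up: "ideal Up R" unfolding U_def Up_def by (auto intro!: add_PIdl_ideal P.is_ideal xc)
  have PU: "P \<subset> U" using add_PIdl_props(1,2)[OF P.is_ideal xc] x unfolding U_def by auto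
  have UQ: "U \<subseteq> Q" unfolding U_def using x PQ by (intro add_PIdl_props(3) P.is_ideal xc Q.is_ideal) auto
  obtain l where l: "local_length 1 Q U (carrier R) = enat l" using fin[OF U PU] by auto
  have "1 \<le> local_length 1 Q U (carrier R)"
    using local_length_prime[OF Q] local_length_mono[OF UQ order_refl, of 1 Q "carrier R"] by simp
  then have l1: "l \<ge> 1" using l by (simp add: one_enat_def)
  have V: "power_submodule p V" and G: "power_submodule p G"
    unfolding V_def G_def by (intro frob_span_submodule P.is_ideal U oneideal es)+
  have VG: "V \<subseteq> G" unfolding V_def G_def using ideal.Icarr[OF U] by (intro frob_span_mono) auto
  have PV: "P \<subseteq> V" unfolding V_def by (intro subset_frob_span P.is_ideal U es)
  have PG: "P \<subseteq> G" using PV VG by simp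
  note cG = power_submoduleD(7)[OF G]
  have xp: "x [^] p \<in> carrier R - P" by (rule P.outside_power[OF xP])
  have Vmem: "\<exists>\<pi>\<in>P. \<exists>g\<in>G. v = \<pi> \<oplus> g \<otimes> x [^] p" if "v \<in> V" for v
    using frob_span_multiple(1)[OF P.is_ideal xc es(1)] that unfolding V_def U_def G_def by blast
  have VUp: "V \<subseteq> Up"
  proof
    fix v assume "v \<in> V"
    then obtain \<pi> g where "\<pi> \<in> P" "g \<in> G" "v = \<pi> \<oplus> g \<otimes> x [^] p" using Vmem by blast
    then show "v \<in> Up" unfolding Up_def using cG by (auto intro: add_PIdl_memI)
  qed
  have sum: "V <+> PIdl (x [^] p) = Up"
  proof
    show "V <+> PIdl (x [^] p) \<subseteq> Up"
      using VUp add_PIdl_props(2)[OF P.is_ideal, of "x [^] p"] xp cgenideal_minimal[OF Up]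
      by (intro set_add_least[OF psub[OF Up, of 1]]) (auto simp: Up_def)
    show "Up \<subseteq> V <+> PIdl (x [^] p)" unfolding Up_def by (intro set_add_mono PV order_refl)
  qed
  have colon: "colon V (x [^] p) = G"
  proof (intro equalityI subsetI)
    fix z assume "z \<in> colon V (x [^] p)"
    then have z: "z \<in> carrier R" "z \<otimes> x [^] p \<in> V" by (auto simp: colon_def)
    then obtain \<pi> g where pg: "\<pi> \<in> P" "g \<in> G" "z \<otimes> x [^] p = \<pi> \<oplus> g \<otimes> x [^] p" using Vmem by blast
    have carr: "\<pi> \<in> carrier R" "g \<in> carrier R" using pg cG P.Icarr by auto
    have "(z \<ominus> g) \<otimes> x [^] p = z \<otimes> x [^] p \<ominus> g \<otimes> x [^] p"
      using z carr xc by (simp add: minus_eq l_distr l_minus)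
    also have "\<dots> = \<pi>" unfolding pg(3) using carr xc by (simp add: minus_eq a_assoc r_neg)
    finally have "(z \<ominus> g) \<otimes> x [^] p \<in> P" using pg by simp
    then have "z \<ominus> g \<in> P" using P.I_prime[of "z \<ominus> g" "x [^] p"] xp z carr by auto
    then have "z \<ominus> g \<oplus> g \<in> G" using PG pg power_submoduleD(3)[OF G] by auto
    then show "z \<in> G" using z carr by (simp add: minus_eq a_assoc l_neg)
  next
    fix z assume "z \<in> G"
    then show "z \<in> colon V (x [^] p)"
      using frob_span_multiple(2)[OF P.is_ideal xc es(1)] cG unfolding V_def U_def G_def colon_def by auto
  qed
  have LUp: "local_length 1 Q Up (carrier R) = enat (p * l)"
    using local_length_power_generator[OF P Q xP, of 1 p] l unfolding U_def Up_def by simp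
  have LpUp: "local_length p Q Up (carrier R) = enat (frob_degree Q * (p * l))"
    using local_length_frob_scale[OF Q Up] LUp by simp
  have "local_length p Q V (carrier R) = local_length p Q V Up + local_length p Q Up (carrier R)"
    using VUp ideal.Icarr[OF Up] by (intro Q.local_length_add V psub Up oneideal) auto
  also have "local_length p Q V Up = local_length p Q G (carrier R)"
    using local_length_colon[OF Q V, of "x [^] p"] colon sum xc by simp
  finally have eq1: "local_length p Q V (carrier R) = local_length p Q G (carrier R) + enat (frob_degree Q * (p * l))"
    using LpUp by simp
  have "local_length p Q V (carrier R) = local_length p Q V G + local_length p Q G (carrier R)"
    using VG cG by (intro Q.local_length_add V G psub oneideal) auto
  also have "local_length p Q V G = enat (length es * l)"
    using local_length_frob_span[OF P Q U _ es] PU l unfolding V_def G_def by auto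
  finally have eq2: "local_length p Q V (carrier R) = local_length p Q G (carrier R) + enat (length es * l)"
    by (simp add: add.commute)
  have "local_length p Q G (carrier R) \<noteq> \<infinity>"
  proof -
    let ?K = "P <+> PIdl (c [^] p)"
    have cp: "c [^] p \<in> carrier R - P" by (rule P.outside_power[OF c(1)])
    then have K: "ideal ?K R" by (intro add_PIdl_ideal P.is_ideal) auto
    have PK: "P \<subset> ?K" using add_PIdl_props(1,2)[OF P.is_ideal, of "c [^] p"] cp by blast
    have KG: "?K \<subseteq> G" using c PG by (intro set_add_least[OF G]) (auto simp: G_def)
    have "local_length p Q ?K (carrier R) \<noteq> \<infinity>"
      using local_length_frob_scale[OF Q K fin[OF K PK]] fin[OF K PK] by auto
    then show ?thesis using local_length_mono[OF KG order_refl, of p Q "carrier R"] by (metis enat_ord_simps(5) infinity_ileE)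
  qed
  then have "length es * l = frob_degree Q * (p * l)"
    using eq1 eq2 by auto
  then show ?thesis using l1 r by simp
qed

text \<open>A chain with ends \<open>P\<close> and \<open>P'\<close> that admits no longer one between the same ends is saturated.\<close>

lemma frob_degree_chain:
  assumes "primeideal P R"
  shows "(P, P') \<in> prime_inclusion R ^^ t \<Longrightarrow> (P, P') \<notin> prime_inclusion R ^^ Suc t \<Longrightarrow>
     frob_degree P = p ^ t * frob_degree P'"
proof (induction t arbitrary: P')
  case (Suc t)
  then obtain P1 where P1: "(P, P1) \<in> prime_inclusion R ^^ t" "(P1, P') \<in> prime_inclusion R" by auto
  have "(P, P1) \<notin> prime_inclusion R ^^ Suc t"
    using P1 Suc.prems by auto
  then have 1: "frob_degree P = p ^ t * frob_degree P1" by (rule Suc.IH[OF P1(1)])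
  have "frob_degree P1 = p * frob_degree P'"
  proof (rule frob_degree_adjacent)
    show "primeideal P1 R" "primeideal P' R" "P1 \<subset> P'" using P1 by (auto simp: prime_inclusion_def)
    fix P2 assume "primeideal P2 R" "P1 \<subset> P2" "P2 \<subset> P'"
    then have "(P1, P2) \<in> prime_inclusion R" "(P2, P') \<in> prime_inclusion R"
      using P1 by (auto simp: prime_inclusion_def)
    then have "(P, P') \<in> prime_inclusion R ^^ Suc (Suc t)" using P1 by auto
    then show False using Suc.prems by auto
  qed
  then show ?case using 1 by simp
qed auto

text \<open>\<open>R/B\<close> is an extension of \<open>R/(B + c^p R)\<close> by a subquotient of \<open>G/V\<close>, where \<open>G\<close> is the span and \<open>V \<subseteq> B\<close> the span
  with coefficients in \<open>A\<close>.\<close>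

lemma frob_length_upper:
  assumes P: "primeideal P R" and Q: "primeideal Q R" and es: "set es \<subseteq> carrier R" "frob_indep P es"
    and c: "c \<in> carrier R" "PIdl (c [^] p) \<subseteq> frob_span P (carrier R) es"
    and A: "ideal A R" "P \<subseteq> A" and B: "ideal B R" "P \<subseteq> B" and AB: "\<And>x. x \<in> A \<Longrightarrow> x [^] p \<in> B"
  shows "local_length p Q B (carrier R) \<le> enat (length es) * local_length 1 Q A (carrier R)
     + local_length p Q (B <+> PIdl (c [^] p)) (carrier R)"
proof -
  interpret P: primeideal P R by fact
  interpret Q: primeideal Q R by fact
  note psub = ideal_imp_power_submodule
  define V where "V = frob_span P A es"
  define G where "G = frob_span P (carrier R) es"
  let ?B = "B <+> PIdl (c [^] p)"
  have B': "ideal ?B R" by (intro add_PIdl_ideal B) (use c in auto)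
  have BB: "B \<subseteq> ?B" using c by (intro add_PIdl_props(1) B) auto
  have V: "power_submodule p V" and G: "power_submodule p G"
    unfolding V_def G_def by (intro frob_span_submodule P.is_ideal A oneideal es)+
  have VG: "V \<subseteq> G" unfolding V_def G_def using ideal.Icarr[OF A(1)] by (intro frob_span_mono) auto
  have VB: "V \<subseteq> B" unfolding V_def using es(1)
  proof (induction es)
    case (Cons e es)
    have "twist p e ` A \<subseteq> B" using AB Cons.prems ideal.I_r_closed[OF B(1)] by (force simp: twist_def)
    then show ?case using Cons set_add_least[OF psub[OF B(1), of p], of "frob_span P A es" "twist p e ` A"] by simp
  qed (use B in auto)
  have "local_length p Q B ?B \<le> local_length p Q B (B <+> G)"
    using c by (intro local_length_mono set_add_mono) (auto simp: G_def)
  also have "\<dots> = local_length p Q {z \<in> G. twist 1 \<one> z \<in> B} G"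
  proof -
    have "twist 1 \<one> ` G = G" using twist_one_image[OF power_submoduleD(1)[OF G]] by simp
    then show ?thesis
      using Q.local_length_twist[OF additive_power_1 one_closed, of p B G] psub[OF B(1)] G by simp
  qed
  also have "\<dots> \<le> local_length p Q V G"
    using VG VB power_submoduleD(7)[OF G] by (intro local_length_mono) (auto simp: twist_one subset_eq)
  also have "\<dots> = enat (length es) * local_length 1 Q A (carrier R)"
    unfolding V_def G_def by (rule local_length_frob_span[OF P Q A es])
  finally have 1: "local_length p Q B ?B \<le> enat (length es) * local_length 1 Q A (carrier R)" .
  have "local_length p Q B (carrier R) = local_length p Q B ?B + local_length p Q ?B (carrier R)"
    using BB ideal.Icarr[OF B'] by (intro Q.local_length_add psub B B' oneideal) auto
  then show ?thesis using 1 by (simp add: add_right_mono)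
qed

lemma frob_span_add_PIdl:
  assumes P: "ideal P R" and A: "ideal A R" and c: "c \<in> carrier R" and "set es \<subseteq> carrier R"
  shows "frob_span P (A <+> PIdl c) es \<subseteq> frob_span P A es <+> PIdl (c [^] p)"
  using assms(4)
proof (induction es)
  case Nil
  then show ?case
    using subset_set_add1[OF ideal_imp_power_submodule[OF cgenideal_ideal, of "c [^] p" 1], of P] c ideal.Icarr[OF P]
    by auto
next
  case (Cons e es)
  then have e: "e \<in> carrier R" and es: "set es \<subseteq> carrier R" by auto
  have VV: "power_submodule p (frob_span P A es)" "power_submodule p (frob_span P A (e # es))"
    using Cons by (auto intro!: frob_span_submodule P A simp del: frob_span.simps)
  have I: "ideal (PIdl (c [^] p)) R" using c by (intro cgenideal_ideal) auto
  note psub = ideal_imp_power_submodule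
  have W: "power_submodule p (frob_span P A (e # es) <+> PIdl (c [^] p))"
    by (intro power_submodule_add VV psub I)
  have "frob_span P A es \<subseteq> frob_span P A (e # es)"
    using subset_set_add1[OF twist_p_image_submodule[OF e A] power_submoduleD(1)[OF VV(1)]] by simp
  then have 1: "frob_span P (A <+> PIdl c) es \<subseteq> frob_span P A (e # es) <+> PIdl (c [^] p)"
    using Cons.IH[OF es] set_add_mono[of "frob_span P A es" _ "PIdl (c [^] p)", OF _ order_refl] by blast
  have "twist p e ` (A <+> PIdl c) \<subseteq> frob_span P A (e # es) <+> PIdl (c [^] p)"
  proof
    fix z assume "z \<in> twist p e ` (A <+> PIdl c)"
    then obtain a y where ay: "a \<in> A" "y \<in> carrier R" "z = twist p e (a \<oplus> y \<otimes> c)"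
      using c by (auto elim!: mem_add_PIdl)
    have carr: "a \<in> carrier R" using ay ideal.Icarr[OF A] by auto
    have "twist p e (y \<otimes> c) = (y [^] p \<otimes> e) \<otimes> c [^] p"
      using ay c e by (simp add: twist_def nat_pow_distrib m_ac)
    then have "z = twist p e a \<oplus> (y [^] p \<otimes> e) \<otimes> c [^] p"
      unfolding ay(3) using ay carr c e by (simp add: twist_add additive_power_p)
    moreover have "twist p e a \<in> frob_span P A (e # es)"
      using subset_set_add2[OF VV(1) power_submoduleD(1)[OF twist_p_image_submodule[OF e A]]] ay by auto
    ultimately show "z \<in> frob_span P A (e # es) <+> PIdl (c [^] p)"
      using ay e by (auto intro!: add_PIdl_memI simp del: frob_span.simps)
  qed
  then show ?case using 1 set_add_least[OF W] by simp
qed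

text \<open>The length of \<open>G/V\<close>, where \<open>V\<close> is the span with coefficients in \<open>A\<close> and \<open>G\<close> the full span, is split at
  \<open>V + c^p R\<close>. Below, \<open>c^p\<close> multiplies \<open>B\<close> into \<open>V\<close>; above, the span with coefficients in
  \<open>A + c R\<close> is already contained.\<close>

lemma frob_length_lower:
  assumes P: "primeideal P R" and Q: "primeideal Q R" and es: "set es \<subseteq> carrier R" "frob_indep P es"
    and c: "c \<in> carrier R" "PIdl (c [^] p) \<subseteq> frob_span P (carrier R) es"
    and A: "ideal A R" "P \<subseteq> A" and AB: "\<And>z. z \<in> B \<Longrightarrow> z \<in> carrier R" "\<And>z. z \<in> B \<Longrightarrow> z \<otimes> c [^] p \<in> frob_span P A es"
  shows "enat (length es) * local_length 1 Q A (carrier R) \<le> local_length p Q B (carrier R)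
     + enat (length es) * local_length 1 Q (A <+> PIdl c) (carrier R)"
proof -
  interpret P: primeideal P R by fact
  interpret Q: primeideal Q R by fact
  note psub = ideal_imp_power_submodule
  define V where "V = frob_span P A es"
  define G where "G = frob_span P (carrier R) es"
  let ?V = "V <+> PIdl (c [^] p)" and ?A = "A <+> PIdl c"
  have cp: "c [^] p \<in> carrier R" using c by auto
  have V: "power_submodule p V" and G: "power_submodule p G"
    unfolding V_def G_def by (intro frob_span_submodule P.is_ideal A oneideal es)+
  have V': "power_submodule p ?V" using cp by (intro power_submodule_add V psub cgenideal_ideal)
  have A': "ideal ?A R" by (intro add_PIdl_ideal A c)
  have VG: "V \<subseteq> G" unfolding V_def G_def using ideal.Icarr[OF A(1)] by (intro frob_span_mono) auto
  have V'G: "?V \<subseteq> G" using VG c by (intro set_add_least[OF G]) (auto simp: G_def)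
  have VV': "V \<subseteq> ?V"
    using cp by (intro subset_set_add1[OF psub[OF cgenideal_ideal]] power_submoduleD(1)[OF V])
  have "enat (length es) * local_length 1 Q A (carrier R) = local_length p Q V G"
    unfolding V_def G_def by (rule local_length_frob_span[OF P Q A es, symmetric])
  also have "\<dots> = local_length p Q V ?V + local_length p Q ?V G"
    using VV' V'G by (intro Q.local_length_add V V' G)
  also have "\<dots> \<le> local_length p Q B (carrier R) + enat (length es) * local_length 1 Q ?A (carrier R)"
  proof (rule add_mono)
    have "B \<subseteq> colon V (c [^] p)" using AB by (auto simp: colon_def V_def)
    then show "local_length p Q V ?V \<le> local_length p Q B (carrier R)"
      unfolding local_length_colon[OF Q V cp] by (rule local_length_mono) simp
    have "local_length p Q ?V G \<le> local_length p Q (frob_span P ?A es) G"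
      unfolding V_def by (intro local_length_mono frob_span_add_PIdl P.is_ideal A c es order_refl)
    also have "\<dots> = enat (length es) * local_length 1 Q ?A (carrier R)"
      unfolding G_def using A add_PIdl_props(1)[OF A(1) c(1)]
      by (intro local_length_frob_span[OF P Q A' _ es]) auto
    finally show "local_length p Q ?V G \<le> enat (length es) * local_length 1 Q ?A (carrier R)" .
  qed
  finally show ?thesis .
qed

text \<open>\<open>c^p R\<close> lies in the full span, and \<open>a^p\<close> multiplies the full span into the one with coefficients in \<open>A\<close>.\<close>

lemma frob_power_mem_span:
  assumes P: "ideal P R" and A: "ideal A R" and es: "set es \<subseteq> carrier R"
    and c: "c \<in> carrier R" "PIdl (c [^] p) \<subseteq> frob_span P (carrier R) es"
    and z: "z \<in> Idl {x [^] p | x. x \<in> A}"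
  shows "z \<otimes> c [^] p \<in> frob_span P A es"
proof -
  define V where "V = frob_span P A es"
  have V: "power_submodule p V" unfolding V_def by (intro frob_span_submodule P A es)
  have mult: "a [^] p \<otimes> g \<in> frob_span P A es" if "a \<in> A" "g \<in> frob_span P (carrier R) es" for a g
    using es that(2)
  proof (induction es arbitrary: g)
    case Nil
    then show ?case using that(1) ideal.Icarr[OF A] ideal.I_l_closed[OF P] by auto
  next
    case (Cons e es)
    then obtain g' y where g: "g' \<in> frob_span P (carrier R) es" "y \<in> carrier R" "g = g' \<oplus> twist p e y"
      by (auto elim!: set_addE)
    have carr: "a \<in> carrier R" "g' \<in> carrier R" "e \<in> carrier R"
      using that(1) ideal.Icarr[OF A] power_submoduleD(7)[OF frob_span_submodule[OF P oneideal], of es] g Cons.prems by auto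
    have "a [^] p \<otimes> g = a [^] p \<otimes> g' \<oplus> twist p e (a \<otimes> y)"
      using g carr by (simp add: twist_def nat_pow_distrib r_distr m_ac)
    moreover have "a \<otimes> y \<in> A" using that(1) g ideal.I_r_closed[OF A] by auto
    ultimately show ?case using Cons.IH g Cons.prems by (auto intro!: set_addI)
  qed
  define K where "K = {z \<in> carrier R. \<forall>r\<in>carrier R. (r \<otimes> z) \<otimes> c [^] p \<in> V}"
  have "power_submodule 1 K"
  proof (rule power_submoduleI)
    show "K \<subseteq> carrier R" by (auto simp: K_def)
    show "\<zero> \<in> K" using c power_submoduleD(2)[OF V] by (auto simp: K_def)
    show "x \<oplus> y \<in> K" if "x \<in> K" "y \<in> K" for x y
      using that c power_submoduleD(3)[OF V] by (auto simp: K_def r_distr l_distr)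
    show "\<ominus> x \<in> K" if "x \<in> K" for x
      using that c power_submoduleD(4)[OF V] by (auto simp: K_def r_minus l_minus)
    show "a [^] (1::nat) \<otimes> x \<in> K" if "a \<in> carrier R" "x \<in> K" for a x
      using that c by (auto simp: K_def m_assoc[symmetric])
  qed
  then have K: "ideal K R" using power_submodule_1_iff by simp
  have "{x [^] p | x. x \<in> A} \<subseteq> K"
  proof clarsimp
    fix x assume x: "x \<in> A"
    then have xc: "x \<in> carrier R" using ideal.Icarr[OF A] by auto
    show "x [^] p \<in> K" unfolding K_def
    proof (intro CollectI conjI ballI)
      fix r assume r: "r \<in> carrier R"
      have "r \<otimes> c [^] p \<in> frob_span P (carrier R) es" using c r by (auto simp: cgenideal_def)
      from mult[OF x this] show "r \<otimes> x [^] p \<otimes> c [^] p \<in> V"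
        using xc r c by (simp add: m_ac V_def)
    qed (use xc in auto)
  qed
  then have "z \<in> K" using z genideal_minimal[OF K] by auto
  then have "\<one> \<otimes> z \<otimes> c [^] p \<in> V" "z \<in> carrier R" unfolding K_def by blast+
  then show ?thesis by (simp add: V_def)
qed

end

section \<open>Growth of colengths along Frobenius powers\<close>

text \<open>The Krull dimension \<open>d\<close> enters only through the lengths of chains of primes.\<close>

locale F_finite_local_domain = F_finite_domain +
  fixes M :: "'a set" and d :: nat
  assumes M_prime: "primeideal M R"
    and proper_subset_M: "ideal K R \<Longrightarrow> K \<noteq> carrier R \<Longrightarrow> K \<subseteq> M"
    and maximal_chain: "({\<zero>}, M) \<in> prime_inclusion R ^^ d"
    and no_longer_chain: "n > d \<Longrightarrow> prime_inclusion R ^^ n = {}"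
begin

lemma frob_degree_strict:
  assumes P: "primeideal P R" and P': "primeideal P' R" and "P \<subset> P'"
  obtains t where "frob_degree P = p ^ Suc t * frob_degree P'"
proof -
  have 1: "(P, P') \<in> prime_inclusion R ^^ 1" using assms by (simp add: prime_inclusion_def)
  let ?S = "\<lambda>t. (P, P') \<in> prime_inclusion R ^^ t"
  have bound: "\<forall>t. ?S t \<longrightarrow> t \<le> d" using no_longer_chain by (metis empty_iff not_le)
  define t where "t = Greatest ?S"
  have t: "?S t" unfolding t_def by (rule GreatestI_nat[of ?S, OF 1]) (use bound in auto)
  have "t \<ge> 1" unfolding t_def by (rule Greatest_le_nat[of ?S, OF 1]) (use bound in auto)
  moreover have "\<not> ?S (Suc t)"
  proof
    assume "?S (Suc t)"
    then have "Suc t \<le> t" unfolding t_def[symmetric] using Greatest_le_nat[of ?S "Suc t" d] bound t_def by auto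
    then show False by simp
  qed
  ultimately show ?thesis using frob_degree_chain[OF P t] that[of "t - 1"] by (cases t) auto
qed

lemma frob_degree_zero: "frob_degree {\<zero>} = p ^ d * frob_degree M"
  using frob_degree_chain[OF zeroprimeideal maximal_chain] no_longer_chain[of "Suc d"] by auto

lemma prime_subset_M: "primeideal P R \<Longrightarrow> P \<subseteq> M"
  using proper_subset_M[of P] by (auto simp: primeideal_def primeideal_axioms_def)

text \<open>By devissage \<open>J\<close> may be taken to be a prime \<open>P\<close>. If it is maximal, the length is at most one. Otherwise
  \<open>frob_length_upper\<close> bounds the length for \<open>P + I (Suc n)\<close> by the length for \<open>P + I n\<close>, times the
  quotient of the degrees of \<open>P\<close> and \<open>M\<close>, plus the length for an ideal strictly above \<open>P\<close>. Primes above
  that ideal have degree smaller by a factor \<open>p\<close>, so the induction hypothesis bounds the latter with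
  exponent \<open>\<delta> - 1\<close>, and \<open>polynomial_recursion_bound\<close> applies.\<close>

lemma local_length_growth:
  assumes I: "\<And>n. ideal (I n) R" and pow: "\<And>n x. x \<in> I n \<Longrightarrow> x [^] p \<in> I (Suc n)"
    and prim: "\<And>P. primeideal P R \<Longrightarrow> I 0 \<subseteq> P \<Longrightarrow> P = M"
    and J: "ideal J R" and deg: "\<And>P. primeideal P R \<Longrightarrow> J \<subseteq> P \<Longrightarrow> frob_degree P \<le> p ^ \<delta> * frob_degree M"
  shows "\<exists>C. \<forall>n. local_length 1 M (J <+> I n) (carrier R) \<le> enat (C * p ^ (n * \<delta>))"
proof -
  note psub = ideal_imp_power_submodule
  have cI: "I n \<subseteq> carrier R" for n using ideal.Icarr[OF I] by auto
  have sub1: "I n \<subseteq> K <+> I n" if "ideal K R" for K n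
    by (rule subset_set_add2[OF psub[OF that, of 1] cI])
  have sub2: "K \<subseteq> K <+> I n" if "ideal K R" for K n
    using ideal.Icarr[OF that] by (intro subset_set_add1[OF psub[OF I, of 1]]) auto
  have prim': "I n \<subseteq> P \<Longrightarrow> P = M" if P: "primeideal P R" for n P
  proof (induction n)
    case (Suc n)
    interpret P: primeideal P R by fact
    have "I n \<subseteq> P"
    proof
      fix x assume x: "x \<in> I n"
      then have "x [^] p \<in> P" "x \<in> carrier R" using pow Suc.prems cI[of n] by auto
      then show "x \<in> P" using P.outside_power[of x p] by auto
    qed
    then show ?case by (rule Suc.IH)
  qed (use prim P in auto)
  have fin: "local_length 1 M (K <+> I n) (carrier R) \<noteq> \<infinity>" if K: "ideal K R" for K n
    using prim' sub1[OF K] by (intro finite_local_length add_ideals K I M_prime) blast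
  have "\<forall>\<delta>. (\<forall>P. primeideal P R \<longrightarrow> J \<subseteq> P \<longrightarrow> frob_degree P \<le> p ^ \<delta> * frob_degree M) \<longrightarrow>
     (\<exists>C. \<forall>n. local_length 1 M (J <+> I n) (carrier R) \<le> enat (C * p ^ (n * \<delta>)))"
    using J
  proof (induction rule: ideal_induct)
    case carrier
    have "carrier R <+> I n = carrier R" for n
      using set_add_absorb(1)[OF psub[OF oneideal] psub[OF I]] cI by auto
    then show ?case using local_length_refl[OF M_prime power_submodule_carrier] by simp
  next
    case (step K a)
    note col = subset_colon[OF step(1,2)] and ad = add_PIdl_props(1)[OF step(1,2)]
    show ?case
    proof (intro allI impI)
      fix \<delta> assume "\<forall>P. primeideal P R \<longrightarrow> K \<subseteq> P \<longrightarrow> frob_degree P \<le> p ^ \<delta> * frob_degree M"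
      then obtain C1 C2 where C1: "\<And>n. local_length 1 M (colon K a <+> I n) (carrier R) \<le> enat (C1 * p ^ (n * \<delta>))"
        and C2: "\<And>n. local_length 1 M (K <+> PIdl a <+> I n) (carrier R) \<le> enat (C2 * p ^ (n * \<delta>))"
        using step(4,5) col ad by (meson subset_trans)
      have "local_length 1 M (K <+> I n) (carrier R) \<le> enat ((C1 + C2) * p ^ (n * \<delta>))" for n
      proof -
        have KI: "ideal (K <+> I n) R" by (intro add_ideals step I)
        have "colon K a <+> I n \<subseteq> colon (K <+> I n) a"
        proof (rule set_add_least[OF psub[OF colon_ideal[OF KI step(2)], of 1]])
          show "colon K a \<subseteq> colon (K <+> I n) a" using sub2[OF step(1)] by (auto simp: colon_def)
          show "I n \<subseteq> colon (K <+> I n) a" using subset_colon[OF KI step(2)] sub1[OF step(1)] by auto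
        qed
        moreover have "K <+> PIdl a <+> I n \<subseteq> K <+> I n <+> PIdl a"
        proof -
          have "K <+> PIdl a <+> I n = K <+> (PIdl a <+> I n)"
            using cI PIdl_closed[OF step(2)] ideal.Icarr[OF step(1)] by (intro set_add_assoc) auto
          also have "PIdl a <+> I n = I n <+> PIdl a" by (rule set_add_comm[OF PIdl_closed[OF step(2)] cI])
          also have "K <+> (I n <+> PIdl a) = K <+> I n <+> PIdl a"
            using cI PIdl_closed[OF step(2)] ideal.Icarr[OF step(1)] by (intro set_add_assoc[symmetric]) auto
          finally show ?thesis by simp
        qed
        ultimately have "local_length 1 M (K <+> I n) (carrier R) \<le>
           local_length 1 M (colon K a <+> I n) (carrier R) + local_length 1 M (K <+> PIdl a <+> I n) (carrier R)"
          unfolding local_length_split_colon[OF M_prime KI step(2)] by (intro add_mono local_length_mono) auto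
        also have "\<dots> \<le> enat (C1 * p ^ (n * \<delta>)) + enat (C2 * p ^ (n * \<delta>))" by (intro add_mono C1 C2)
        finally show ?thesis by (simp add: algebra_simps)
      qed
      then show "\<exists>C. \<forall>n. local_length 1 M (K <+> I n) (carrier R) \<le> enat (C * p ^ (n * \<delta>))" by blast
    qed
  next
    case (prime P)
    interpret P: primeideal P R by fact
    show ?case
    proof (intro allI impI)
      fix \<delta> assume deg: "\<forall>P'. primeideal P' R \<longrightarrow> P \<subseteq> P' \<longrightarrow> frob_degree P' \<le> p ^ \<delta> * frob_degree M"
      show "\<exists>C. \<forall>n. local_length 1 M (P <+> I n) (carrier R) \<le> enat (C * p ^ (n * \<delta>))"
      proof (cases "P = M")
        case True
        have "local_length 1 M (P <+> I n) (carrier R) \<le> enat (1 * p ^ (n * \<delta>))" for n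
        proof -
          have "local_length 1 M (P <+> I n) (carrier R) \<le> local_length 1 M M (carrier R)"
            using sub2[OF P.is_ideal] True by (intro local_length_mono) auto
          also have "\<dots> = enat 1" using local_length_prime[OF M_prime] by (simp add: one_enat_def)
          also have "\<dots> \<le> enat (1 * p ^ (n * \<delta>))" using p_pos by simp
          finally show ?thesis .
        qed
        then show ?thesis by blast
      next
        case False
        then have PM: "P \<subset> M" using prime_subset_M[OF prime(1)] by auto
        define a where "a = frob_degree M"
        have a: "a \<ge> 1" unfolding a_def by (rule frob_degree_pos[OF M_prime])
        obtain es c where es: "set es \<subseteq> carrier R" "frob_indep P es" and c: "c \<in> carrier R - P"
          "PIdl (c [^] p) \<subseteq> frob_span P (carrier R) es"
          using frob_basis_exists[OF prime(1)] .
        have r: "frob_degree P = length es" using frob_basis_length[OF prime(1) es c] frob_degree[OF prime(1)] by simp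
        obtain t where t: "frob_degree P = p ^ Suc t * a" using frob_degree_strict[OF prime(1) M_prime PM] a_def by metis
        have "p ^ Suc t * a \<le> p ^ \<delta> * a" using deg prime(1) t a_def by auto
        then have "p ^ Suc t \<le> p ^ \<delta>" using a by simp
        then have "Suc t \<le> \<delta>" by (simp only: power_increasing_iff[OF p_gt_1])
        then obtain e where e: "\<delta> = Suc e" by (cases \<delta>) auto
        let ?K = "P <+> PIdl (c [^] p)"
        have cp: "c [^] p \<in> carrier R - P" by (rule P.outside_power[OF c(1)])
        then have K: "ideal ?K R" by (intro add_PIdl_ideal P.is_ideal) auto
        have PK: "P \<subset> ?K" using add_PIdl_props(1,2)[OF P.is_ideal, of "c [^] p"] cp by blast
        have "frob_degree P' \<le> p ^ e * frob_degree M" if P': "primeideal P' R" "?K \<subseteq> P'" for P'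
        proof -
          obtain t' where t': "frob_degree P = p ^ Suc t' * frob_degree P'"
            using frob_degree_strict[OF prime(1) P'(1)] P'(2) PK by blast
          have "p * frob_degree P' \<le> p * (p ^ t' * frob_degree P')" using p_pos by simp
          also have "\<dots> \<le> p ^ \<delta> * a" using t' deg prime(1) a_def by auto
          finally have "p * frob_degree P' \<le> p * (p ^ e * a)" using e by simp
          then show ?thesis using p_pos a_def by simp
        qed
        then obtain C where C: "\<And>n. local_length 1 M (?K <+> I n) (carrier R) \<le> enat (C * p ^ (n * e))"
          using prime(2)[OF K PK] by blast
        define u where "u n = the_enat (local_length 1 M (P <+> I n) (carrier R))" for n
        have u: "local_length 1 M (P <+> I n) (carrier R) = enat (u n)" for n
          unfolding u_def using fin[OF P.is_ideal, of n] by (cases "local_length 1 M (P <+> I n) (carrier R)") auto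
        have "u (Suc n) \<le> p ^ Suc e * u n + (C * p ^ e) * p ^ (n * e)" for n
        proof -
          let ?A = "P <+> I n" and ?B = "P <+> I (Suc n)"
          have A: "ideal ?A R" and B: "ideal ?B R" by (intro add_ideals P.is_ideal I)+
          have AB: "x [^] p \<in> ?B" if x: "x \<in> ?A" for x
          proof -
            obtain y z where yz: "y \<in> P" "z \<in> I n" "x = y \<oplus> z" using x by (rule set_addE)
            have carr: "y \<in> carrier R" "z \<in> carrier R" using yz cI P.Icarr by auto
            then have "x [^] p = y [^] p \<oplus> z [^] p" using additive_power_p yz by (simp add: additive_power_def)
            moreover have "y [^] p \<in> P"
            proof -
              obtain k where k: "p = Suc k" using p_pos by (cases p) auto
              show ?thesis using P.I_l_closed[OF yz(1)] carr by (simp add: k)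
            qed
            ultimately show ?thesis using pow yz by (auto intro: set_addI)
          qed
          have KB: "?B <+> PIdl (c [^] p) = ?K <+> I (Suc n)"
          proof -
            have "?B <+> PIdl (c [^] p) = P <+> (I (Suc n) <+> PIdl (c [^] p))"
              using cI PIdl_closed cp P.Icarr by (intro set_add_assoc) auto
            also have "I (Suc n) <+> PIdl (c [^] p) = PIdl (c [^] p) <+> I (Suc n)"
              using PIdl_closed cp by (intro set_add_comm cI) auto
            also have "P <+> (PIdl (c [^] p) <+> I (Suc n)) = ?K <+> I (Suc n)"
              using cI PIdl_closed cp P.Icarr by (intro set_add_assoc[symmetric]) auto
            finally show ?thesis .
          qed
          have "local_length p M ?B (carrier R) \<le> enat (length es) * local_length 1 M ?A (carrier R)
             + local_length p M (?K <+> I (Suc n)) (carrier R)"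
            using frob_length_upper[OF prime(1) M_prime es _ c(2) A _ B _ AB] c sub2[OF P.is_ideal] KB by auto
          also have "local_length p M (?K <+> I (Suc n)) (carrier R) = enat a * local_length 1 M (?K <+> I (Suc n)) (carrier R)"
            unfolding a_def using local_length_frob_scale[OF M_prime _ fin[OF K]] add_ideals[OF K I] by simp
          also have "\<dots> \<le> enat a * enat (C * p ^ (Suc n * e))" by (intro mult_left_mono C) auto
          also have "local_length p M ?B (carrier R) = enat a * enat (u (Suc n))"
            unfolding a_def using local_length_frob_scale[OF M_prime B fin[OF P.is_ideal]] u by simp
          finally have "a * u (Suc n) \<le> length es * u n + a * (C * p ^ (Suc n * e))"
            using u by (simp add: add_left_mono)
          also have "length es * u n \<le> (p ^ \<delta> * a) * u n"
            using deg prime(1) r a_def by (intro mult_right_mono) auto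
          finally have "a * u (Suc n) \<le> a * (p ^ \<delta> * u n + C * p ^ (Suc n * e))" by (simp add: algebra_simps)
          then have "u (Suc n) \<le> p ^ \<delta> * u n + C * p ^ (Suc n * e)" using a by simp
          then show ?thesis using e by (simp add: power_add algebra_simps)
        qed
        then have "u n \<le> (u 0 + C * p ^ e) * p ^ (n * Suc e)" for n
          using p_gt_1 by (intro polynomial_recursion_bound) auto
        then show ?thesis using u e by (intro exI[of _ "u 0 + C * p ^ e"]) auto
      qed
    qed
  qed
  then show ?thesis using deg by blast
qed

end

section \<open>The Frobenius map in prime characteristic\<close>

context cring
begin

lemma binomial_theorem:
  assumes x: "x \<in> carrier R" and y: "y \<in> carrier R"
  shows "(x \<oplus> y) [^] n = (\<Oplus>k\<in>{..n}. [(n choose k)] \<cdot> (x [^] k \<otimes> y [^] (n - k)))"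
proof (induction n)
  case 0
  then show ?case using x y by simp
next
  case (Suc n)
  define c where "c k = [(n choose k)] \<cdot> (x [^] k \<otimes> y [^] (n - k))" for k
  define e where "e k = [(n choose k)] \<cdot> (x [^] k \<otimes> y [^] (Suc n - k))" for k
  define c' where "c' k = [(Suc n choose k)] \<cdot> (x [^] k \<otimes> y [^] (Suc n - k))" for k
  have carr: "c \<in> UNIV \<rightarrow> carrier R" "e \<in> UNIV \<rightarrow> carrier R" "c' \<in> UNIV \<rightarrow> carrier R"
    using x y by (auto simp: c_def e_def c'_def)
  then have carr': "c k \<in> carrier R" "e k \<in> carrier R" "c' k \<in> carrier R" for k by auto
  have y_eq: "y \<otimes> c k = e k" if "k \<le> n" for k
    using that x y by (simp add: c_def e_def Suc_diff_le add_pow_rdistr m_ac)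
  have pascal: "c' (Suc k) = x \<otimes> c k \<oplus> e (Suc k)" for k
    using x y by (simp add: c_def e_def c'_def add_pow_rdistr add.nat_pow_mult[symmetric] m_ac)
  have e0: "c' 0 = e 0" using x y by (simp add: c'_def e_def)
  have "(\<Oplus>k\<in>{..Suc n}. c' k) = (\<Oplus>k\<in>{..n}. c' (Suc k)) \<oplus> c' 0"
    using carr by (intro finsum_Suc2) auto
  also have "(\<Oplus>k\<in>{..n}. c' (Suc k)) = (\<Oplus>k\<in>{..n}. x \<otimes> c k) \<oplus> (\<Oplus>k\<in>{..n}. e (Suc k))"
    unfolding pascal using carr' x by (intro finsum_addf) auto
  also have "\<dots> \<oplus> c' 0 = (\<Oplus>k\<in>{..n}. x \<otimes> c k) \<oplus> ((\<Oplus>k\<in>{..n}. e (Suc k)) \<oplus> e 0)"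
    unfolding e0 using carr' x by (intro a_assoc finsum_closed) auto
  also have "(\<Oplus>k\<in>{..n}. e (Suc k)) \<oplus> e 0 = (\<Oplus>k\<in>{..Suc n}. e k)"
    using carr by (intro finsum_Suc2[symmetric]) auto
  also have "\<dots> = e (Suc n) \<oplus> (\<Oplus>k\<in>{..n}. e k)"
    using carr by (intro finsum_Suc) auto
  also have "e (Suc n) = \<zero>" unfolding e_def by (subst binomial_eq_0) auto
  also have "(\<Oplus>k\<in>{..n}. e k) = (\<Oplus>k\<in>{..n}. y \<otimes> c k)"
    using carr' y y_eq by (intro add.finprod_cong') auto
  also have "(\<Oplus>k\<in>{..n}. y \<otimes> c k) = y \<otimes> (\<Oplus>k\<in>{..n}. c k)"
    using carr y by (intro finsum_rdistr[symmetric]) auto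
  also have "(\<Oplus>k\<in>{..n}. x \<otimes> c k) = x \<otimes> (\<Oplus>k\<in>{..n}. c k)"
    using carr x by (intro finsum_rdistr[symmetric]) auto
  also have "(\<Oplus>k\<in>{..n}. c k) = (x \<oplus> y) [^] n" using Suc.IH by (simp add: c_def)
  finally show ?case using x y by (simp add: c'_def l_distr m_comm)
qed

lemma additive_power_prime:
  assumes p: "Factorial_Ring.prime (p :: nat)" and char: "[p] \<cdot> \<one> = \<zero>"
  shows "additive_power p"
  unfolding additive_power_def
proof (intro ballI)
  fix x y assume x: "x \<in> carrier R" and y: "y \<in> carrier R"
  define c where "c k = [(p choose k)] \<cdot> (x [^] k \<otimes> y [^] (p - k))" for k
  have carr: "c k \<in> carrier R" for k using x y by (simp add: c_def)
  have p1: "p > 1" using p prime_gt_1_nat by auto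
  have mult: "[(p * m)] \<cdot> z = \<zero>" if "z \<in> carrier R" for m z
  proof -
    have "[p] \<cdot> z = ([p] \<cdot> \<one>) \<otimes> z" using that add_pow_ldistr[of \<one> z p] by simp
    also have "\<dots> = \<zero>" using that char by simp
    finally have "[p] \<cdot> z = \<zero>" .
    then show ?thesis using that by (simp add: add.nat_pow_pow[symmetric])
  qed
  have mid: "c k = \<zero>" if "0 < k" "k < p" for k
  proof -
    have "p dvd (p choose k)" using that p by (intro dvd_choose_prime) auto
    then obtain m where "(p choose k) = p * m" by (auto elim: dvdE)
    then show ?thesis using mult x y by (simp add: c_def)
  qed
  obtain r where r: "p = Suc (Suc r)" using p1 by (intro that[of "p - 2"]) simp
  have "(x \<oplus> y) [^] p = (\<Oplus>k\<in>{..Suc (Suc r)}. c k)"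
    using binomial_theorem[OF x y, of p] by (simp only: c_def r)
  also have "\<dots> = c (Suc (Suc r)) \<oplus> (\<Oplus>k\<in>{..Suc r}. c k)" using carr by (intro finsum_Suc) auto
  also have "(\<Oplus>k\<in>{..Suc r}. c k) = (\<Oplus>k\<in>{..r}. c (Suc k)) \<oplus> c 0" using carr by (intro finsum_Suc2) auto
  also have "(\<Oplus>k\<in>{..r}. c (Suc k)) = (\<Oplus>k\<in>{..r}. \<zero>)" using mid r by (intro add.finprod_cong') auto
  also have "\<dots> = \<zero>" by simp
  also have "c (Suc (Suc r)) \<oplus> (\<zero> \<oplus> c 0) = x [^] p \<oplus> y [^] p"
    using x y by (simp add: c_def r)
  finally show "(x \<oplus> y) [^] p = x [^] p \<oplus> y [^] p" .
qed

lemma F_finite_generators: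
  assumes "F_finite R p"
  shows "\<exists>F. finite F \<and> F \<subseteq> carrier R \<and> (\<forall>N. power_submodule p N \<longrightarrow> F \<subseteq> N \<longrightarrow> N = carrier R)"
proof -
  let ?M = "module_via (\<lambda>x. x [^] p) R"
  have inv_eq: "inv\<^bsub>add_monoid ?M\<^esub> x = \<ominus> x" if "x \<in> carrier R" for x
    by (simp add: module_via_def m_inv_def a_inv_def)
  obtain F where F: "F \<subseteq> carrier R" "finite F" "\<Inter>{N. submodule N R ?M \<and> F \<subseteq> N} = carrier R"
    using assms unfolding F_finite_def finite_ring_hom_def finitely_generated_module_def
    by (auto simp: module_via_def)
  have "N = carrier R" if N: "power_submodule p N" "F \<subseteq> N" for N
  proof -
    have "submodule N R ?M"
    proof (rule submodule.intro)
      show "subgroup N (add_monoid ?M)"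
        using power_submoduleD[OF N(1)] inv_eq
        by (intro subgroup.intro) (auto simp: module_via_def)
      show "submodule_axioms N R ?M" using power_submoduleD(6)[OF N(1)]
        by unfold_locales (auto simp: module_via_def)
    qed
    then have "carrier R \<subseteq> N" using F(3) N(2) by blast
    then show ?thesis using power_submoduleD(1)[OF N(1)] by auto
  qed
  then show ?thesis using F by blast
qed

end

section \<open>The length of a quotient module\<close>

context cring
begin

text \<open>Submodules of \<open>R/A\<close> correspond to ideals above \<open>A\<close>.\<close>

lemma
  assumes A: "ideal A R"
  shows quotient_submodule_vimage: "submodule N R (quotient_module R A) \<Longrightarrow>
      ideal {x \<in> carrier R. A +> x \<in> N} R \<and> A \<subseteq> {x \<in> carrier R. A +> x \<in> N} \<and>
      N = (\<lambda>x. A +> x) ` {x \<in> carrier R. A +> x \<in> N}"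
    and quotient_submodule_image: "ideal B R \<Longrightarrow> A \<subseteq> B \<Longrightarrow> submodule ((\<lambda>x. A +> x) ` B) R (quotient_module R A)
      \<and> {x \<in> carrier R. A +> x \<in> (\<lambda>x. A +> x) ` B} = B"
proof -
  interpret A: ideal A R by fact
  let ?Q = "quotient_module R A"
  have "carrier ?Q = (\<Union>a\<in>carrier R. {A +> a})"
    unfolding quotient_module_def module_via_def FactRing_def A_RCOSETS_def' by simp
  then have carQ: "carrier ?Q = (\<lambda>x. A +> x) ` carrier R" by blast
  interpret Q: module R ?Q by (rule quotient_module_is_module[OF is_cring A])
  interpret hom: ring_hom_ring R "R Quot A" "\<lambda>x. A +> x" by (rule A.rcos_ring_hom_ring)
  have zero: "\<zero>\<^bsub>?Q\<^esub> = A +> \<zero>" using hom.hom_zero by (simp add: quotient_module_def module_via_def)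
  have add: "(A +> x) \<oplus>\<^bsub>?Q\<^esub> (A +> y) = A +> (x \<oplus> y)" if "x \<in> carrier R" "y \<in> carrier R" for x y
    using hom.hom_add that by (simp add: quotient_module_def module_via_def)
  have smult: "a \<odot>\<^bsub>?Q\<^esub> (A +> x) = A +> (a \<otimes> x)" if "x \<in> carrier R" "a \<in> carrier R" for x a
    using hom.hom_mult that by (simp add: quotient_module_def module_via_def)
  have minus: "\<ominus>\<^bsub>?Q\<^esub> (A +> x) = A +> (\<ominus> x)" if "x \<in> carrier R" for x
  proof -
    have "(A +> \<ominus> x) \<oplus>\<^bsub>?Q\<^esub> (A +> x) = \<zero>\<^bsub>?Q\<^esub>" using add[of "\<ominus> x" x] that zero by (simp add: l_neg)
    moreover have "A +> x \<in> carrier ?Q" "A +> \<ominus> x \<in> carrier ?Q" unfolding carQ using that by blast+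
    ultimately show ?thesis by (rule Q.minus_equality)
  qed
  have eq_iff: "A +> x = A +> y \<longleftrightarrow> x \<ominus> y \<in> A" if "x \<in> carrier R" "y \<in> carrier R" for x y
    using quotient_eq_iff_same_a_r_cos[OF A] that by simp
  show "ideal {x \<in> carrier R. A +> x \<in> N} R \<and> A \<subseteq> {x \<in> carrier R. A +> x \<in> N} \<and>
      N = (\<lambda>x. A +> x) ` {x \<in> carrier R. A +> x \<in> N}" if N: "submodule N R ?Q"
  proof (intro conjI)
    note E = Q.submoduleE[OF N]
    have z: "\<zero>\<^bsub>?Q\<^esub> \<in> N"
      using subgroup.one_closed[OF submodule.axioms(1)[OF N]] by simp
    have E': "A +> (x \<oplus> y) \<in> N" if "x \<in> carrier R" "y \<in> carrier R" "A +> x \<in> N" "A +> y \<in> N" for x y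
      using E(5)[OF that(3,4)] unfolding add[OF that(1,2)] .
    have E2: "A +> (\<ominus> x) \<in> N" if "x \<in> carrier R" "A +> x \<in> N" for x
      using E(3)[OF that(2)] unfolding minus[OF that(1)] .
    have E3: "A +> (a \<otimes> x) \<in> N" if "a \<in> carrier R" "x \<in> carrier R" "A +> x \<in> N" for a x
      using E(4)[OF that(1,3)] unfolding smult[OF that(2,1)] .
    have "power_submodule 1 {x \<in> carrier R. A +> x \<in> N}"
    proof (rule power_submoduleI)
      show "\<zero> \<in> {x \<in> carrier R. A +> x \<in> N}" using z zero by simp
    qed (use E' E2 E3 in \<open>auto simp del: hom.hom_add hom.hom_mult hom.hom_a_inv\<close>)
    then show "ideal {x \<in> carrier R. A +> x \<in> N} R" using power_submodule_1_iff by simp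
    show "A \<subseteq> {x \<in> carrier R. A +> x \<in> N}"
    proof
      fix a assume a: "a \<in> A"
      then have "A +> a = A +> \<zero>" using eq_iff[of a \<zero>] A.Icarr by (simp add: minus_eq)
      then show "a \<in> {x \<in> carrier R. A +> x \<in> N}" using z zero a A.Icarr by simp
    qed
    show "N = (\<lambda>x. A +> x) ` {x \<in> carrier R. A +> x \<in> N}" using E(1) carQ by auto
  qed
  show "submodule ((\<lambda>x. A +> x) ` B) R ?Q \<and> {x \<in> carrier R. A +> x \<in> (\<lambda>x. A +> x) ` B} = B"
    if B: "ideal B R" "A \<subseteq> B"
  proof
    interpret B: ideal B R by fact
    show "submodule ((\<lambda>x. A +> x) ` B) R ?Q"
    proof (rule Q.submoduleI)
      show "(\<lambda>x. A +> x) ` B \<subseteq> carrier ?Q" using carQ B.Icarr by auto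
      show "\<zero>\<^bsub>?Q\<^esub> \<in> (\<lambda>x. A +> x) ` B" using zero B.zero_closed by blast
    next
      fix a assume "a \<in> (\<lambda>x. A +> x) ` B"
      then obtain x where x: "x \<in> B" "a = A +> x" by auto
      have "A +> (\<ominus> x) \<in> (\<lambda>x. A +> x) ` B"
        using power_submoduleD(4)[OF ideal_imp_power_submodule[OF B(1), of 1] x(1)] by (rule imageI)
      then show "\<ominus>\<^bsub>?Q\<^esub> a \<in> (\<lambda>x. A +> x) ` B" unfolding x(2) minus[OF B.Icarr[OF x(1)]] .
      show "r \<odot>\<^bsub>?Q\<^esub> a \<in> (\<lambda>x. A +> x) ` B" if "r \<in> carrier R" for r
        unfolding x(2) smult[OF B.Icarr[OF x(1)] that] using B.I_l_closed[OF x(1) that] by (rule imageI)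
      fix b assume "b \<in> (\<lambda>x. A +> x) ` B"
      then obtain y where y: "y \<in> B" "b = A +> y" by auto
      show "a \<oplus>\<^bsub>?Q\<^esub> b \<in> (\<lambda>x. A +> x) ` B"
        unfolding x(2) \<open>b = A +> y\<close> add[OF B.Icarr[OF x(1)] B.Icarr[OF y(1)]]
        by (rule imageI[OF B.a_closed[OF x(1) y(1)]])
    qed
    show "{x \<in> carrier R. A +> x \<in> (\<lambda>x. A +> x) ` B} = B"
    proof (intro equalityI subsetI)
      fix x assume "x \<in> {x \<in> carrier R. A +> x \<in> (\<lambda>x. A +> x) ` B}"
      then obtain b where b: "x \<in> carrier R" "b \<in> B" "A +> x = A +> b" by auto
      then have "x \<ominus> b \<in> B" using eq_iff B.Icarr that by auto
      then have "x \<ominus> b \<oplus> b \<in> B" using b by simp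
      then show "x \<in> B" using b B.Icarr by (simp add: minus_eq a_assoc l_neg)
    qed (use B.Icarr in auto)
  qed
qed

text \<open>Elements outside \<open>\<mm>\<close> are units, so torsion modulo an ideal means inclusion in it, and chains of submodules
  of \<open>R/A\<close> correspond to local chains.\<close>

lemma module_length_quotient:
  assumes A: "ideal A R" and unit: "\<And>s. s \<in> carrier R - \<mm> \<Longrightarrow> s \<in> Units R" and m: "\<one> \<notin> \<mm>"
  shows "module_length R (quotient_module R A) = local_length 1 \<mm> A (carrier R)"
proof -
  let ?Q = "quotient_module R A"
  define f where "f N = {x \<in> carrier R. A +> x \<in> N}" for N
  define g where "g B = (\<lambda>x. A +> x) ` B" for B
  note f_props = quotient_submodule_vimage[OF A, folded f_def, folded g_def]
  note g_props = quotient_submodule_image[OF A, folded g_def, folded f_def]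
  have torsion: "torsion_modulo 1 \<mm> B' B \<longleftrightarrow> B' \<subseteq> B" if B: "ideal B R" "ideal B' R" for B B'
  proof
    assume t: "torsion_modulo 1 \<mm> B' B"
    show "B' \<subseteq> B"
    proof
      fix x assume x: "x \<in> B'"
      then have xc: "x \<in> carrier R" using ideal.Icarr[OF B(2)] by auto
      obtain s where s: "s \<in> carrier R - \<mm>" "s \<otimes> x \<in> B" using t x unfolding torsion_modulo_def by auto
      have "inv s \<otimes> (s \<otimes> x) \<in> B" using s unit by (intro ideal.I_l_closed[OF B(1) s(2)]) auto
      moreover have "inv s \<otimes> (s \<otimes> x) = x" using s unit[of s] xc by (simp add: m_assoc[symmetric])
      ultimately show "x \<in> B" by simp
    qed
  next
    assume "B' \<subseteq> B"
    then show "torsion_modulo 1 \<mm> B' B"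
      unfolding torsion_modulo_def using m ideal.Icarr[OF B(2)] by (auto intro!: bexI[of _ \<one>] simp: subset_eq)
  qed
  have "local_chain 1 \<mm> n A (carrier R)"
    if N: "\<And>i. i \<le> n \<Longrightarrow> submodule (N i) R ?Q" "\<And>i. i < n \<Longrightarrow> N i \<subset> N (Suc i)" for n N
  proof -
    have "local_chain 1 \<mm> i A (f (N i))" if "i \<le> n" for i
      using that
    proof (induction i)
      case 0
      then show ?case using f_props[OF N(1)] by simp
    next
      case (Suc i)
      have sub: "submodule (N i) R ?Q" "submodule (N (Suc i)) R ?Q" "N i \<subset> N (Suc i)" using N Suc.prems by auto
      have "\<not> f (N (Suc i)) \<subseteq> f (N i)"
      proof
        assume "f (N (Suc i)) \<subseteq> f (N i)"
        then have "g (f (N (Suc i))) \<subseteq> g (f (N i))" by (auto simp: g_def)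
        moreover have "N (Suc i) = g (f (N (Suc i)))" "N i = g (f (N i))"
          using f_props[OF sub(1)] f_props[OF sub(2)] by (simp_all add: g_def)
        ultimately show False using sub(3) by simp
      qed
      moreover have "f (N i) \<subseteq> f (N (Suc i))" using sub(3) by (auto simp: f_def)
      moreover have "ideal (f (N i)) R" "ideal (f (N (Suc i))) R" using f_props sub by blast+
      moreover have "local_chain 1 \<mm> i A (f (N i))" using Suc by simp
      ultimately show ?case
        unfolding local_chain.simps using torsion ideal_imp_power_submodule by (intro exI[of _ "f (N i)"]) simp
    qed
    then have "local_chain 1 \<mm> n A (f (N n))" by simp
    then show ?thesis by (rule local_chain_mono) (auto simp: f_def)
  qed
  moreover have "\<exists>N. (\<forall>i\<le>n. submodule (N i) R ?Q) \<and> (\<forall>i<n. N i \<subset> N (Suc i)) \<and> N n = g B"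
    if "local_chain 1 \<mm> n A B" "ideal B R" for n B
    using that
  proof (induction n arbitrary: B)
    case 0
    then show ?case using g_props by (intro exI[of _ "\<lambda>_. g B"]) auto
  next
    case (Suc n)
    obtain C where C: "power_submodule 1 C" "local_chain 1 \<mm> n A C" "C \<subseteq> B" "\<not> torsion_modulo 1 \<mm> B C"
      using Suc.prems(1) unfolding local_chain.simps by blast
    then have Ci: "ideal C R" using power_submodule_1_iff by simp
    obtain N where N: "\<forall>i\<le>n. submodule (N i) R ?Q" "\<forall>i<n. N i \<subset> N (Suc i)" "N n = g C"
      using Suc.IH[OF C(2) Ci] by blast
    have AC: "A \<subseteq> C" "A \<subseteq> B" using local_chain_subset[OF C(2)] C(3) by auto
    have "g C \<subseteq> g B" using C(3) by (auto simp: g_def)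
    moreover have "g C \<noteq> g B"
    proof
      assume "g C = g B"
      then have "f (g C) = f (g B)" by simp
      moreover have "f (g C) = C" "f (g B) = B"
        using g_props[OF Ci AC(1)] g_props[OF Suc.prems(2) AC(2)] unfolding f_def by blast+
      ultimately show False using C(4) torsion[OF Ci Suc.prems(2)] by simp
    qed
    ultimately have gCB: "g C \<subset> g B" by blast
    define N' where "N' i = (if i \<le> n then N i else g B)" for i
    have "submodule (N' i) R ?Q" if "i \<le> Suc n" for i
      using that N(1) g_props[OF Suc.prems(2) AC(2)] by (simp add: N'_def)
    moreover have "N' i \<subset> N' (Suc i)" if "i < Suc n" for i
      using that N(2,3) gCB by (cases "i = n") (simp_all add: N'_def)
    moreover have "N' (Suc n) = g B" by (simp add: N'_def)
    ultimately show ?case by blast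
  qed
  ultimately have "{enat n | n. \<exists>N :: nat \<Rightarrow> 'a set set. (\<forall>i\<le>n. submodule (N i) R ?Q) \<and> (\<forall>i<n. N i \<subset> N (Suc i))}
    = {enat n | n. local_chain 1 \<mm> n A (carrier R)}"
    using oneideal by (intro Collect_cong iff_exI) meson
  then show ?thesis unfolding module_length_def local_length_def by simp
qed

end

section \<open>Powers and Frobenius powers of ideals\<close>

context cring
begin

definition ideal_pow :: "'a set \<Rightarrow> nat \<Rightarrow> 'a set" where
  "ideal_pow I k = I [^]\<^bsub>ideals_set R\<^esub> k"

lemma ideal_power_eq: "ideal_power R I z = ideal_pow I (nat z)"
  by (simp add: ideal_power_def ideal_pow_def)

lemma ideal_pow_0 [simp]: "ideal_pow I 0 = carrier R"
  by (simp add: ideal_pow_def nat_pow_def ideals_set_def)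

lemma ideal_pow_Suc: "ideal_pow I (Suc k) = ideal_prod R (ideal_pow I k) I"
  by (simp add: ideal_pow_def nat_pow_def ideals_set_def)

lemma ideal_pow_ideal: "ideal I R \<Longrightarrow> ideal (ideal_pow I k) R"
  by (induction k) (auto simp: ideal_pow_Suc intro: oneideal ideal_prod_is_ideal)

lemma ideal_pow_Suc_subset: "ideal I R \<Longrightarrow> ideal_pow I (Suc k) \<subseteq> ideal_pow I k"
  unfolding ideal_pow_Suc using ideal_prod_inter[OF ideal_pow_ideal] by blast

lemma ideal_pow_antimono: "ideal I R \<Longrightarrow> j \<le> k \<Longrightarrow> ideal_pow I k \<subseteq> ideal_pow I j"
proof (induction k)
  case (Suc k)
  then show ?case using ideal_pow_Suc_subset[of I k] by (cases "j = Suc k") auto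
qed auto

lemma ideal_pow_closed: "ideal I R \<Longrightarrow> x \<in> ideal_pow I k \<Longrightarrow> x \<in> carrier R"
  using ideal.Icarr[OF ideal_pow_ideal] by blast

lemma ideal_pow_mult:
  assumes I: "ideal I R"
  shows "x \<in> ideal_pow I j \<Longrightarrow> y \<in> ideal_pow I k \<Longrightarrow> x \<otimes> y \<in> ideal_pow I (j + k)"
proof (induction k arbitrary: y)
  case 0
  then show ?case using ideal.I_r_closed[OF ideal_pow_ideal[OF I]] by auto
next
  case (Suc k)
  have xc: "x \<in> carrier R" using Suc ideal_pow_closed[OF I] by auto
  from Suc.prems(2) have "y \<in> ideal_prod R (ideal_pow I k) I" by (simp add: ideal_pow_Suc)
  then show ?case
  proof induction
    case (prod i f)
    have "i \<in> carrier R" "f \<in> carrier R" using prod ideal_pow_closed[OF I] ideal.Icarr[OF I] by auto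
    then have "x \<otimes> (i \<otimes> f) = (x \<otimes> i) \<otimes> f" using xc by (simp add: m_assoc)
    also have "\<dots> \<in> ideal_prod R (ideal_pow I (j + k)) I"
      using Suc.IH[OF Suc.prems(1) prod(1)] prod(2) by (rule ideal_prod.prod)
    finally show ?case by (simp add: ideal_pow_Suc)
  next
    case (sum s1 s2)
    have "s1 \<in> carrier R" "s2 \<in> carrier R"
      using sum(1,2) ideal_prod_in_carrier[OF ideal_pow_ideal[OF I] I] by auto
    then have "x \<otimes> (s1 \<oplus> s2) = x \<otimes> s1 \<oplus> x \<otimes> s2" using xc by (simp add: r_distr)
    then show ?case using sum(3,4) additive_subgroup.a_closed[OF ideal.axioms(1)[OF ideal_pow_ideal[OF I]]] by simp
  qed
qed

lemma ideal_pow_1: "ideal I R \<Longrightarrow> x \<in> I \<Longrightarrow> x \<in> ideal_pow I 1"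
  using ideal_prod.prod[of \<one> "carrier R" x I R] ideal.Icarr by (fastforce simp: ideal_pow_Suc)

lemma ideal_pow_power:
  assumes I: "ideal I R" and x: "x \<in> ideal_pow I k"
  shows "x [^] (m::nat) \<in> ideal_pow I (k * m)"
proof (induction m)
  case (Suc m)
  then show ?case using ideal_pow_mult[OF I Suc x] by (simp add: add.commute)
qed simp

lemma ideal_pow_subset_prime:
  assumes P: "primeideal P R" and I: "ideal I R" and sub: "ideal_pow I k \<subseteq> P"
  shows "I \<subseteq> P"
proof
  interpret P: primeideal P R by fact
  fix x assume x: "x \<in> I"
  then have "x [^] k \<in> ideal_pow I (1 * k)" by (intro ideal_pow_power[OF I] ideal_pow_1[OF I])
  then have "x [^] k \<in> P" "x \<in> carrier R" using sub ideal.Icarr[OF I x] by auto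
  then show "x \<in> P" using P.outside_power[of x k] by blast
qed

lemma ideal_power_vimage:
  assumes t: "additive_power t" and t0: "t > 0" and K: "ideal K R"
  shows "ideal {x \<in> carrier R. x [^] t \<in> K} R"
proof -
  have "{x \<in> carrier R. x [^] t \<in> K} = {x \<in> carrier R. twist t \<one> x \<in> K}" by (auto simp: twist_def)
  then show ?thesis
    using power_submodule_twist_vimage[OF t one_closed, of 1 K "carrier R"] K ideal_imp_power_submodule[OF K]
      power_submodule_carrier power_submodule_1_iff by simp
qed

lemma frobenius_power_ideal: "J \<subseteq> carrier R \<Longrightarrow> ideal (frobenius_power R J q) R"
  unfolding frobenius_power_def by (intro genideal_ideal) auto

lemma frobenius_power_mem: "J \<subseteq> carrier R \<Longrightarrow> f \<in> J \<Longrightarrow> f [^] q \<in> frobenius_power R J q"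
  unfolding frobenius_power_def by (intro genideal_self[THEN subsetD]) auto

lemma frobenius_power_least:
  "ideal K R \<Longrightarrow> (\<And>f. f \<in> J \<Longrightarrow> f [^] q \<in> K) \<Longrightarrow> frobenius_power R J q \<subseteq> K"
  unfolding frobenius_power_def by (intro genideal_minimal) auto

lemma frobenius_power_mono: "J \<subseteq> J' \<Longrightarrow> J' \<subseteq> carrier R \<Longrightarrow> frobenius_power R J q \<subseteq> frobenius_power R J' q"
  by (intro frobenius_power_least frobenius_power_ideal frobenius_power_mem) auto

lemma frobenius_power_Suc_subset:
  assumes J: "J \<subseteq> carrier R" and A: "A \<subseteq> carrier R" and sub: "frobenius_power R J (p ^ n) \<subseteq> A"
  shows "frobenius_power R J (p ^ Suc n) \<subseteq> frobenius_power R A p"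
proof (rule frobenius_power_least[OF frobenius_power_ideal[OF A]])
  fix f assume f: "f \<in> J"
  then have "f [^] p ^ n \<in> A" using frobenius_power_mem[OF J f] sub by blast
  then have "(f [^] p ^ n) [^] p \<in> frobenius_power R A p" by (rule frobenius_power_mem[OF A])
  then show "f [^] p ^ Suc n \<in> frobenius_power R A p"
    using f J by (simp add: nat_pow_pow mult.commute subset_eq)
qed

lemma frobenius_power_step:
  assumes t: "additive_power p" "p > 0" and J: "J \<subseteq> carrier R" and x: "x \<in> frobenius_power R J (p ^ n)"
  shows "x [^] p \<in> frobenius_power R J (p ^ Suc n)"
proof -
  have "frobenius_power R J (p ^ n) \<subseteq> {x \<in> carrier R. x [^] p \<in> frobenius_power R J (p ^ Suc n)}"
  proof (rule frobenius_power_least[OF ideal_power_vimage[OF t frobenius_power_ideal[OF J]]])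
    fix f assume f: "f \<in> J"
    then have fc: "f \<in> carrier R" using J by auto
    have "(f [^] p ^ n) [^] p = f [^] p ^ Suc n" using fc by (simp add: nat_pow_pow mult.commute)
    then show "f [^] p ^ n \<in> {x \<in> carrier R. x [^] p \<in> frobenius_power R J (p ^ Suc n)}"
      using frobenius_power_mem[OF J f, of "p ^ Suc n"] fc by simp
  qed
  then show ?thesis using x by auto
qed

lemma finprod_power:
  assumes "finite G" "f \<in> G \<rightarrow> carrier R"
  shows "finprod R f G [^] (m::nat) = finprod R (\<lambda>g. f g [^] m) G"
  using assms by (induction G rule: finite_induct) (auto simp: nat_pow_distrib Pi_def)

lemma finprod_mem_ideal_pow:
  assumes I: "ideal I R" and "finite G" "G \<subseteq> I"
  shows "finprod R (\<lambda>g. g [^] (\<alpha> g :: nat)) G \<in> ideal_pow I (sum \<alpha> G)"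
  using assms(2,3)
proof (induction G rule: finite_induct)
  case (insert g G)
  have carr: "g \<in> carrier R" "G \<subseteq> carrier R" using insert.prems ideal.Icarr[OF I] by auto
  have "g [^] \<alpha> g \<in> ideal_pow I (1 * \<alpha> g)" using insert.prems by (intro ideal_pow_power ideal_pow_1 I) auto
  then have "g [^] \<alpha> g \<otimes> finprod R (\<lambda>g. g [^] \<alpha> g) G \<in> ideal_pow I (\<alpha> g + sum \<alpha> G)"
    using insert by (intro ideal_pow_mult[OF I]) auto
  then show ?case using insert.hyps carr by (simp add: finprod_insert Pi_def subset_eq)
qed simp

definition monomials :: "'a set \<Rightarrow> nat \<Rightarrow> 'a set" where
  "monomials G k = {finprod R (\<lambda>g. g [^] (\<alpha> g :: nat)) G | \<alpha>. sum \<alpha> G = k}"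

lemma monomials_closed: "G \<subseteq> carrier R \<Longrightarrow> monomials G k \<subseteq> carrier R"
  by (auto simp: monomials_def Pi_def intro!: finprod_closed)

lemma monomials_mult:
  assumes G: "finite G" "G \<subseteq> carrier R" and h: "h \<in> G" and x: "x \<in> monomials G k"
  shows "x \<otimes> h \<in> monomials G (Suc k)"
proof -
  obtain \<alpha> where a: "x = finprod R (\<lambda>g. g [^] (\<alpha> g :: nat)) G" "sum \<alpha> G = k"
    using x by (auto simp: monomials_def)
  define \<beta> where "\<beta> = \<alpha>(h := Suc (\<alpha> h))"
  have G': "G = insert h (G - {h})" "finite (G - {h})" "h \<notin> G - {h}" using G h by auto
  have carr: "h \<in> carrier R" "\<And>\<gamma>. (\<lambda>g. g [^] (\<gamma> g :: nat)) \<in> G - {h} \<rightarrow> carrier R" using G h by auto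
  have split: "finprod R (\<lambda>g. g [^] (\<gamma> g :: nat)) G = h [^] \<gamma> h \<otimes> finprod R (\<lambda>g. g [^] \<gamma> g) (G - {h})" for \<gamma>
    using finprod_insert[OF G'(2,3) carr(2), of \<gamma>] carr(1) G'(1) by simp
  have same: "finprod R (\<lambda>g. g [^] \<beta> g) (G - {h}) = finprod R (\<lambda>g. g [^] \<alpha> g) (G - {h})"
    using carr by (intro finprod_cong') (auto simp: \<beta>_def)
  have "x \<otimes> h = finprod R (\<lambda>g. g [^] \<beta> g) G"
    unfolding a split same using carr by (simp add: \<beta>_def m_ac finprod_closed)
  moreover have "sum \<beta> G = Suc k"
  proof -
    have "sum \<gamma> G = \<gamma> h + sum \<gamma> (G - {h})" for \<gamma> :: "'a \<Rightarrow> nat"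
      using sum.insert[OF G'(2,3), of \<gamma>] G'(1) by simp
    then show ?thesis using a(2) by (simp add: \<beta>_def)
  qed
  ultimately show ?thesis by (auto simp: monomials_def)
qed

lemma ideal_pow_subset_monomials:
  assumes G: "finite G" "G \<subseteq> carrier R" and I: "I = Idl G"
  shows "ideal_pow I k \<subseteq> Idl (monomials G k)"
proof (induction k)
  case 0
  have "finprod R (\<lambda>g. g [^] (0::nat)) G = \<one>" by (simp add: finprod_one_eqI)
  then have "\<one> \<in> monomials G 0" unfolding monomials_def by (intro CollectI exI[of _ "\<lambda>_. 0"]) auto
  then have "\<one> \<in> Idl (monomials G 0)" using genideal_self[OF monomials_closed[OF G(2)]] by blast
  then show ?case using ideal.one_imp_carrier[OF genideal_ideal[OF monomials_closed[OF G(2)]]] by simp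
next
  case (Suc k)
  let ?K = "Idl (monomials G (Suc k))"
  have I': "ideal I R" unfolding I by (rule genideal_ideal[OF G(2)])
  have K: "ideal ?K R" by (rule genideal_ideal[OF monomials_closed[OF G(2)]])
  have 1: "x \<otimes> h \<in> ?K" if "x \<in> Idl (monomials G k)" "h \<in> G" for x h
  proof -
    have h: "h \<in> carrier R" using that G by auto
    have "monomials G k \<subseteq> colon ?K h"
      using monomials_mult[OF G that(2)] monomials_closed[OF G(2)] genideal_self[OF monomials_closed[OF G(2)]]
      by (fastforce simp: colon_def)
    then have "Idl (monomials G k) \<subseteq> colon ?K h" by (rule genideal_minimal[OF colon_ideal[OF K h]])
    then show ?thesis using that by (auto simp: colon_def)
  qed
  have 2: "x \<otimes> j \<in> ?K" if "x \<in> Idl (monomials G k)" "j \<in> I" for x j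
  proof -
    have x: "x \<in> carrier R" using that ideal.Icarr[OF genideal_ideal[OF monomials_closed[OF G(2)]]] by blast
    have "G \<subseteq> colon ?K x" using 1[OF that(1)] G x by (auto simp: colon_def m_comm[OF _ x])
    then have "I \<subseteq> colon ?K x" unfolding I by (rule genideal_minimal[OF colon_ideal[OF K x]])
    then show ?thesis using that x ideal.Icarr[OF I'] by (auto simp: colon_def m_comm)
  qed
  show ?case
  proof
    fix y assume "y \<in> ideal_pow I (Suc k)"
    then have "y \<in> ideal_prod R (ideal_pow I k) I" by (simp add: ideal_pow_Suc)
    then show "y \<in> ?K"
    proof induction
      case (prod i j)
      then show ?case using 2 Suc.IH by blast
    next
      case (sum s1 s2)
      then show ?case using additive_subgroup.a_closed[OF ideal.axioms(1)[OF K]] by blast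
    qed
  qed
qed

end

context noetherian_domain
begin

lemma finprod_nonzero:
  assumes "finite G" "f \<in> G \<rightarrow> carrier R - {\<zero>}"
  shows "finprod R f G \<in> carrier R - {\<zero>}"
  using assms
proof (induction G rule: finite_induct)
  case (insert g G)
  have "f g \<in> carrier R - {\<zero>}" "finprod R f G \<in> carrier R - {\<zero>}" "f \<in> G \<rightarrow> carrier R" using insert by auto
  then show ?case using insert.hyps by (auto simp: finprod_insert integral_iff)
qed simp

lemma power_nonzero: "x \<in> carrier R - {\<zero>} \<Longrightarrow> x [^] (n::nat) \<in> carrier R - {\<zero>}"
  by (induction n) (auto simp: integral_iff)

text \<open>Let \<open>c\<close> be the product of the \<open>g^(2p)\<close> over nonzero generators \<open>g\<close> of \<open>I\<close>. A monomial of degree \<open>a\<close> with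
  exponents \<open>\<alpha> g\<close>, times \<open>c\<close>, has exponents \<open>\<alpha> g + 2p = p \<beta> g + (\<alpha> g mod p)\<close> with \<open>\<beta> g = 2 + \<alpha> g div p\<close>, so it is a multiple of the
  \<open>p\<close>-th power of the monomial with exponents \<open>\<beta> g\<close>, whose degree is at least \<open>k\<close>.\<close>

lemma frobenius_power_comparison:
  assumes I: "ideal I R" and p: "p > 0"
  shows "\<exists>c\<in>carrier R - {\<zero>}. \<forall>a k. p * k < a + p \<longrightarrow>
     (\<forall>x\<in>ideal_pow I a. x \<otimes> c \<in> frobenius_power R (ideal_pow I k) p)"
proof -
  obtain F where F: "F \<subseteq> carrier R" "finite F" "I = Idl F" using finetely_gen[OF I] by blast
  define G where "G = F - {\<zero>}"
  have G: "finite G" "G \<subseteq> carrier R" "\<And>g. g \<in> G \<Longrightarrow> g \<noteq> \<zero>" using F by (auto simp: G_def)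
  have IG: "I = Idl G"
  proof
    have z: "\<zero> \<in> Idl G"
      using additive_subgroup.zero_closed[OF ideal.axioms(1)[OF genideal_ideal[OF G(2)]]] .
    have "F \<subseteq> Idl G" using genideal_self[OF G(2)] z by (auto simp: G_def)
    then show "I \<subseteq> Idl G" unfolding F(3) by (rule genideal_minimal[OF genideal_ideal[OF G(2)]])
    show "Idl G \<subseteq> I" unfolding F(3)
      using genideal_self[OF F(1)] by (intro genideal_minimal genideal_ideal F(1)) (auto simp: G_def)
  qed
  have GI: "G \<subseteq> I" unfolding IG by (rule genideal_self[OF G(2)])
  define mon where "mon \<alpha> = finprod R (\<lambda>g. g [^] (\<alpha> g :: nat)) G" for \<alpha>
  define c where "c = mon (\<lambda>_. 2 * p)"
  have carr: "(\<lambda>g. g [^] (\<alpha> g :: nat)) \<in> G \<rightarrow> carrier R" for \<alpha> using G by auto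
  have monc: "mon \<alpha> \<in> carrier R" for \<alpha> unfolding mon_def using carr by (rule finprod_closed)
  have cn: "c \<in> carrier R - {\<zero>}" unfolding c_def mon_def
    using G power_nonzero by (intro finprod_nonzero) auto
  have mon_mult: "mon \<alpha> \<otimes> mon \<beta> = mon (\<lambda>g. \<alpha> g + \<beta> g)" for \<alpha> \<beta>
  proof -
    have "mon \<alpha> \<otimes> mon \<beta> = finprod R (\<lambda>g. g [^] \<alpha> g \<otimes> g [^] \<beta> g) G"
      unfolding mon_def by (rule finprod_multf[OF carr carr, symmetric])
    also have "\<dots> = mon (\<lambda>g. \<alpha> g + \<beta> g)" unfolding mon_def
      using G by (intro finprod_cong') (auto simp: nat_pow_mult)
    finally show ?thesis .
  qed
  have mon_pow: "mon \<alpha> [^] m = mon (\<lambda>g. \<alpha> g * m)" for \<alpha> and m :: nat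
  proof -
    have "mon \<alpha> [^] m = finprod R (\<lambda>g. (g [^] \<alpha> g) [^] m) G"
      unfolding mon_def by (rule finprod_power[OF G(1) carr])
    also have "\<dots> = mon (\<lambda>g. \<alpha> g * m)" unfolding mon_def
      using G by (intro finprod_cong') (auto simp: nat_pow_pow)
    finally show ?thesis .
  qed
  have "\<forall>x\<in>ideal_pow I a. x \<otimes> c \<in> frobenius_power R (ideal_pow I k) p" if ak: "p * k < a + p" for a k
  proof -
    let ?K = "frobenius_power R (ideal_pow I k) p"
    have Ik: "ideal_pow I k \<subseteq> carrier R" using ideal_pow_closed[OF I] by auto
    have K: "ideal ?K R" by (rule frobenius_power_ideal[OF Ik])
    have "monomials G a \<subseteq> colon ?K c"
    proof
      fix x assume "x \<in> monomials G a"
      then obtain \<alpha> where x: "x = mon \<alpha>" and a: "sum \<alpha> G = a" by (auto simp: monomials_def mon_def)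
      define \<beta> where "\<beta> g = 2 + \<alpha> g div p" for g
      have "x \<otimes> c = mon (\<lambda>g. \<alpha> g + 2 * p)" unfolding x c_def mon_mult ..
      also have "(\<lambda>g. \<alpha> g + 2 * p) = (\<lambda>g. \<beta> g * p + \<alpha> g mod p)"
        by (rule ext) (simp add: \<beta>_def algebra_simps)
      also have "mon \<dots> = mon \<beta> [^] p \<otimes> mon (\<lambda>g. \<alpha> g mod p)" unfolding mon_pow mon_mult ..
      also have "\<dots> \<in> ?K"
      proof -
        have "k \<le> sum \<beta> G"
        proof (cases "G = {}")
          case True
          \<comment> \<open>Without generators the only monomial is \<open>\<one>\<close>, of degree \<open>0\<close>.\<close>
          then have "p * k < p * 1" using a ak by simp
          then show ?thesis using p by simp
        next
          case False
          \<comment> \<open>The gain of \<open>p\<close> at one generator makes up for the assumption being \<open>p k < a + p\<close> rather than \<open>p k \<le> a\<close>.\<close>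
          have "\<alpha> g + p \<le> p * \<beta> g" for g
          proof -
            have "\<alpha> g = p * (\<alpha> g div p) + \<alpha> g mod p" by simp
            also have "\<dots> \<le> p * (\<alpha> g div p) + p"
              using mod_less_divisor[OF p, of "\<alpha> g"] by (intro add_left_mono less_imp_le)
            finally show ?thesis by (simp add: \<beta>_def algebra_simps)
          qed
          then have "(\<Sum>g\<in>G. \<alpha> g + p) \<le> (\<Sum>g\<in>G. p * \<beta> g)" by (rule sum_mono)
          then have "a + card G * p \<le> p * sum \<beta> G" by (simp add: sum.distrib a sum_distrib_left)
          moreover have "1 * p \<le> card G * p" using False G by (intro mult_right_mono) (auto simp: Suc_le_eq card_gt_0_iff)
          ultimately have "p * k < p * sum \<beta> G" using ak by linarith
          then show ?thesis by simp
        qed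
        then have "mon \<beta> \<in> ideal_pow I k"
          using finprod_mem_ideal_pow[OF I G(1) GI, of \<beta>] ideal_pow_antimono[OF I] by (auto simp: mon_def)
        then have "mon \<beta> [^] p \<in> ?K" by (rule frobenius_power_mem[OF Ik])
        then show ?thesis using monc by (rule ideal.I_r_closed[OF K])
      qed
      finally show "x \<in> colon ?K c" using x monc by (auto simp: colon_def)
    qed
    then have "Idl (monomials G a) \<subseteq> colon ?K c"
      using cn by (intro genideal_minimal colon_ideal K) auto
    then show ?thesis using ideal_pow_subset_monomials[OF G(1,2) IG, of a] by (auto simp: colon_def)
  qed
  then show ?thesis using cn by blast
qed

end

context cring
begin

lemma additive_power_power:
  assumes "additive_power p" shows "additive_power (p ^ n)"
proof (induction n)
  case 0
  then show ?case using additive_power_1 by simp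
next
  case (Suc n)
  have eq: "x [^] (p ^ Suc n) = (x [^] (p ^ n)) [^] p" if "x \<in> carrier R" for x
    using that by (simp add: nat_pow_pow mult.commute)
  show ?case
    unfolding additive_power_def
  proof (intro ballI)
    fix x y assume xy: "x \<in> carrier R" "y \<in> carrier R"
    then have "(x \<oplus> y) [^] (p ^ n) = x [^] (p ^ n) \<oplus> y [^] (p ^ n)" using Suc by (simp add: additive_power_def)
    then show "(x \<oplus> y) [^] (p ^ Suc n) = x [^] (p ^ Suc n) \<oplus> y [^] (p ^ Suc n)"
      using xy assms by (simp add: eq additive_power_def del: power_Suc)
  qed
qed

end

section \<open>Colengths of the ideals defining the h-function\<close>

locale h_function_setting = F_finite_local_domain +
  fixes I J :: "'a set"
  assumes I_ideal: "ideal I R" and J_ideal: "ideal J R"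
    and prime_over: "primeideal P R \<Longrightarrow> I <+> J \<subseteq> P \<Longrightarrow> P = M"
begin

text \<open>For \<open>k = \<lceil>s p^n\<rceil>\<close> the colength of this ideal is the value at \<open>s\<close> of the \<open>n\<close>-th function.\<close>

definition h_ideal :: "nat \<Rightarrow> nat \<Rightarrow> 'a set" where
  "h_ideal n k = ideal_pow I k <+> frobenius_power R J (p ^ n)"

definition colength :: "'a set \<Rightarrow> nat" where
  "colength K = the_enat (local_length 1 M K (carrier R))"

text \<open>\<open>(I^N + J)^[p^n]\<close> lies in all \<open>h_ideal n k\<close> with \<open>k \<le> N p^n\<close>, and each term of this sequence contains the \<open>p\<close>-th
  powers of the previous one. It makes one application of \<open>local_length_growth\<close> serve all such \<open>k\<close>.\<close>

definition bracket_ideal :: "nat \<Rightarrow> nat \<Rightarrow> 'a set" where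
  "bracket_ideal N n = frobenius_power R (ideal_pow I N <+> J) (p ^ n)"

lemma J_closed: "J \<subseteq> carrier R" using ideal.Icarr[OF J_ideal] by auto

lemma ideal_pow_sub: "ideal_pow I k \<subseteq> carrier R" using ideal_pow_closed[OF I_ideal] by auto

lemma frob_J_ideal: "ideal (frobenius_power R J q) R"
  by (rule frobenius_power_ideal[OF J_closed])

lemma h_ideal_ideal: "ideal (h_ideal n k) R"
  unfolding h_ideal_def by (intro add_ideals ideal_pow_ideal I_ideal frob_J_ideal)

lemma h_ideal_upper: "ideal_pow I k \<subseteq> h_ideal n k" "frobenius_power R J (p ^ n) \<subseteq> h_ideal n k"
  unfolding h_ideal_def
  using subset_set_add1[OF ideal_imp_power_submodule[OF frob_J_ideal, of 1] ideal_pow_sub]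
   subset_set_add2[OF ideal_imp_power_submodule[OF ideal_pow_ideal[OF I_ideal], of 1]] ideal.Icarr[OF frob_J_ideal]
  by blast+

lemma h_ideal_least: "ideal K R \<Longrightarrow> ideal_pow I k \<subseteq> K \<Longrightarrow> frobenius_power R J (p ^ n) \<subseteq> K \<Longrightarrow> h_ideal n k \<subseteq> K"
  unfolding h_ideal_def by (intro set_add_least[OF ideal_imp_power_submodule[of K 1]])

lemma h_ideal_antimono: "j \<le> k \<Longrightarrow> h_ideal n k \<subseteq> h_ideal n j"
  using h_ideal_upper ideal_pow_antimono[OF I_ideal] by (intro h_ideal_least h_ideal_ideal) blast+

lemma bracket_base_ideal: "ideal (ideal_pow I N <+> J) R"
  by (intro add_ideals ideal_pow_ideal I_ideal J_ideal)

lemma bracket_base_sub: "ideal_pow I N <+> J \<subseteq> carrier R"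
  using ideal.Icarr[OF bracket_base_ideal] by auto

lemma bracket_ideal_ideal: "ideal (bracket_ideal N n) R"
  unfolding bracket_ideal_def by (rule frobenius_power_ideal[OF bracket_base_sub])

lemma bracket_ideal_step: "x \<in> bracket_ideal N n \<Longrightarrow> x [^] p \<in> bracket_ideal N (Suc n)"
  unfolding bracket_ideal_def by (rule frobenius_power_step[OF additive_power_p p_pos bracket_base_sub])

lemma bracket_ideal_prime:
  assumes P: "primeideal P R" and sub: "bracket_ideal N 0 \<subseteq> P"
  shows "P = M"
proof (rule prime_over[OF P])
  interpret P: primeideal P R by fact
  have "ideal_pow I N <+> J \<subseteq> P"
  proof
    fix x assume x: "x \<in> ideal_pow I N <+> J"
    then have "x [^] (1::nat) \<in> bracket_ideal N 0" unfolding bracket_ideal_def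
      using frobenius_power_mem[OF bracket_base_sub x, of 1] by simp
    then show "x \<in> P" using sub subsetD[OF bracket_base_sub x] by auto
  qed
  then have "ideal_pow I N \<subseteq> P" "J \<subseteq> P"
    using subset_set_add1[OF ideal_imp_power_submodule[OF J_ideal, of 1] ideal_pow_sub]
      subset_set_add2[OF ideal_imp_power_submodule[OF ideal_pow_ideal[OF I_ideal], of 1] J_closed] by blast+
  then show "I <+> J \<subseteq> P"
    using ideal_pow_subset_prime[OF P I_ideal]
    by (intro set_add_least[OF ideal_imp_power_submodule[OF P.is_ideal, of 1]])
qed

lemma bracket_ideal_subset:
  assumes k: "k \<le> N * p ^ n" shows "bracket_ideal N n \<subseteq> h_ideal n k"
  unfolding bracket_ideal_def
proof (rule frobenius_power_least[OF h_ideal_ideal])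
  fix f assume "f \<in> ideal_pow I N <+> J"
  then obtain x y where xy: "x \<in> ideal_pow I N" "y \<in> J" "f = x \<oplus> y" by (rule set_addE)
  have carr: "x \<in> carrier R" "y \<in> carrier R" using xy ideal_pow_sub J_closed by auto
  have "f [^] (p ^ n) = x [^] (p ^ n) \<oplus> y [^] (p ^ n)"
    using additive_power_power[OF additive_power_p] carr xy by (simp add: additive_power_def)
  moreover have "x [^] (p ^ n) \<in> ideal_pow I k"
    using ideal_pow_power[OF I_ideal xy(1), of "p ^ n"] ideal_pow_antimono[OF I_ideal k] by auto
  moreover have "y [^] (p ^ n) \<in> frobenius_power R J (p ^ n)" by (rule frobenius_power_mem[OF J_closed xy(2)])
  ultimately show "f [^] (p ^ n) \<in> h_ideal n k" by (simp add: h_ideal_def set_addI)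
qed

lemma local_length_above_bracket_ideal:
  assumes K: "ideal K R" and sub: "bracket_ideal N n \<subseteq> K"
  shows "local_length 1 M K (carrier R) = enat (colength K)"
proof -
  have "local_length 1 M (bracket_ideal N n) (carrier R) \<noteq> \<infinity>"
  proof (rule finite_local_length[OF bracket_ideal_ideal M_prime])
    fix P assume P: "primeideal P R" "bracket_ideal N n \<subseteq> P"
    from P(2) have "bracket_ideal N 0 \<subseteq> P"
    proof (induction n)
      case (Suc n)
      have "bracket_ideal N n \<subseteq> P"
      proof
        fix x assume x: "x \<in> bracket_ideal N n"
        then have "x [^] p \<in> P" "x \<in> carrier R" using Suc.prems bracket_ideal_step ideal.Icarr[OF bracket_ideal_ideal] by blast+
        then show "x \<in> P" using primeideal.outside_power[OF P(1), of x p] by auto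
      qed
      then show ?case by (rule Suc.IH)
    qed
    then show "P = M" by (rule bracket_ideal_prime[OF P(1)])
  qed
  then have "local_length 1 M K (carrier R) \<noteq> \<infinity>"
    using local_length_mono[OF sub order_refl, of 1 M "carrier R"] by (metis enat_ord_simps(5) infinity_ileE)
  then show ?thesis unfolding colength_def by (cases "local_length 1 M K (carrier R)") auto
qed

lemma colength_mono:
  assumes "ideal K R" "ideal K' R" "bracket_ideal N n \<subseteq> K" "K \<subseteq> K'" shows "colength K' \<le> colength K"
proof -
  have "local_length 1 M K' (carrier R) \<le> local_length 1 M K (carrier R)"
    using assms(4) by (intro local_length_mono) auto
  then show ?thesis
    using local_length_above_bracket_ideal[OF assms(1,3)] local_length_above_bracket_ideal[OF assms(2), of N n] assms(3,4) by auto
qed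

text \<open>\<open>c\<close> multiplies \<open>K'\<close> into \<open>K\<close>, so \<open>R/K\<close> is an extension of \<open>R/(K + c R)\<close> by a quotient of \<open>R/K'\<close>.\<close>

lemma colength_colon_le:
  assumes K: "ideal K R" "ideal K' R" "bracket_ideal N n \<subseteq> K" "K \<subseteq> K'" and c: "c \<in> carrier R" "\<And>x. x \<in> K' \<Longrightarrow> x \<otimes> c \<in> K"
  shows "colength K \<le> colength K' + colength (K <+> PIdl c)"
proof -
  have sub: "bracket_ideal N n \<subseteq> K'" "bracket_ideal N n \<subseteq> K <+> PIdl c" using K add_PIdl_props(1)[OF K(1) c(1)] by auto
  have "K' \<subseteq> colon K c" using c ideal.Icarr[OF K(2)] by (auto simp: colon_def)
  then have "local_length 1 M (colon K c) (carrier R) \<le> local_length 1 M K' (carrier R)"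
    by (intro local_length_mono) auto
  then have "local_length 1 M K (carrier R) \<le> local_length 1 M K' (carrier R) + local_length 1 M (K <+> PIdl c) (carrier R)"
    unfolding local_length_split_colon[OF M_prime K(1) c(1)] by (rule add_right_mono)
  then show ?thesis
    using local_length_above_bracket_ideal[OF K(1,3)] local_length_above_bracket_ideal[OF K(2) sub(1)]
      local_length_above_bracket_ideal[OF add_PIdl_ideal[OF K(1) c(1)] sub(2)] by simp
qed

text \<open>A prime that contains \<open>c\<close> is nonzero, so its Frobenius degree is at most \<open>p^(d-1)\<close> times that of \<open>M\<close>, and
  \<open>local_length_growth\<close> applies with exponent \<open>d - 1\<close>. The factor \<open>p^n\<close> on the left avoids the exponent
  \<open>d - 1\<close>, which would be meaningless for a field; there \<open>c\<close> is a unit and the colength is zero.\<close>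

lemma hypersurface_bound:
  assumes c: "c \<in> carrier R" "c \<noteq> \<zero>"
  shows "\<exists>C. \<forall>n K. ideal K R \<longrightarrow> bracket_ideal N n \<subseteq> K \<longrightarrow> colength (K <+> PIdl c) * p ^ n \<le> C * p ^ (n * d)"
proof -
  have J: "ideal (PIdl c) R" by (rule cgenideal_ideal[OF c(1)])
  have "\<exists>C. \<forall>n. colength (PIdl c <+> bracket_ideal N n) * p ^ n \<le> C * p ^ (n * d)"
  proof (cases d)
    case 0
    then have "M = {\<zero>}" using maximal_chain by auto
    then have "PIdl c = carrier R" using proper_subset_M[OF J] mem_PIdl[OF c(1)] c by auto
    moreover have "carrier R <+> bracket_ideal N n = carrier R" for n
      using set_add_absorb(1)[OF ideal_imp_power_submodule[OF oneideal] ideal_imp_power_submodule[OF bracket_ideal_ideal]]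
        ideal.Icarr[OF bracket_ideal_ideal] by blast
    ultimately have "colength (PIdl c <+> bracket_ideal N n) = 0" for n
      using local_length_refl[OF M_prime power_submodule_carrier] by (simp add: colength_def zero_enat_def)
    then show ?thesis by simp
  next
    case (Suc e)
    have deg: "frob_degree P \<le> p ^ e * frob_degree M" if P: "primeideal P R" "PIdl c \<subseteq> P" for P
    proof -
      have "c \<in> P" using P mem_PIdl[OF c(1)] by auto
      moreover have "\<zero> \<in> P" using P additive_subgroup.zero_closed ideal.axioms(1) primeideal.axioms(1) by metis
      ultimately have "{\<zero>} \<subset> P" using c by auto
      then obtain t where t: "frob_degree {\<zero>} = p ^ Suc t * frob_degree P"
        using frob_degree_strict[OF zeroprimeideal P(1)] by blast
      have "p * frob_degree P \<le> p * (p ^ t * frob_degree P)" using p_pos by simp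
      also have "\<dots> = frob_degree {\<zero>}" using t by simp
      also have "\<dots> = p * (p ^ e * frob_degree M)" using frob_degree_zero Suc by simp
      finally show ?thesis using p_pos by simp
    qed
    have "\<exists>C. \<forall>n. local_length 1 M (PIdl c <+> bracket_ideal N n) (carrier R) \<le> enat (C * p ^ (n * e))"
    proof (rule local_length_growth)
      show "x [^] p \<in> bracket_ideal N (Suc n)" if "x \<in> bracket_ideal N n" for n x by (rule bracket_ideal_step[OF that])
      show "P = M" if "primeideal P R" "bracket_ideal N 0 \<subseteq> P" for P by (rule bracket_ideal_prime[OF that])
    qed (use bracket_ideal_ideal J deg in auto)
    then obtain C where C: "\<And>n. local_length 1 M (PIdl c <+> bracket_ideal N n) (carrier R) \<le> enat (C * p ^ (n * e))" by blast
    have "colength (PIdl c <+> bracket_ideal N n) * p ^ n \<le> C * p ^ (n * d)" for n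
    proof -
      have "colength (PIdl c <+> bracket_ideal N n) \<le> C * p ^ (n * e)"
        using C[of n] unfolding colength_def by (cases "local_length 1 M (PIdl c <+> bracket_ideal N n) (carrier R)") auto
      then have "colength (PIdl c <+> bracket_ideal N n) * p ^ n \<le> C * p ^ (n * e) * p ^ n" by (rule mult_right_mono) simp
      also have "\<dots> = C * p ^ (n * d)" using Suc by (simp add: power_add algebra_simps)
      finally show ?thesis .
    qed
    then show ?thesis by blast
  qed
  then obtain C where C: "\<And>n. colength (PIdl c <+> bracket_ideal N n) * p ^ n \<le> C * p ^ (n * d)" by blast
  have "colength (K <+> PIdl c) * p ^ n \<le> C * p ^ (n * d)" if K: "ideal K R" "bracket_ideal N n \<subseteq> K" for n K
  proof -
    have "colength (K <+> PIdl c) \<le> colength (PIdl c <+> bracket_ideal N n)"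
    proof (rule colength_mono)
      show "ideal (PIdl c <+> bracket_ideal N n) R" by (intro add_ideals J bracket_ideal_ideal)
      show "ideal (K <+> PIdl c) R" by (intro add_PIdl_ideal K c)
      show "bracket_ideal N n \<subseteq> PIdl c <+> bracket_ideal N n"
        using subset_set_add2[OF ideal_imp_power_submodule[OF J, of 1]] ideal.Icarr[OF bracket_ideal_ideal] by blast
      show "PIdl c <+> bracket_ideal N n \<subseteq> K <+> PIdl c"
        using set_add_comm[OF PIdl_closed[OF c(1)], of "bracket_ideal N n"] ideal.Icarr[OF bracket_ideal_ideal]
          set_add_mono[OF K(2) order_refl, of "PIdl c"] by blast
    qed
    then have "colength (K <+> PIdl c) * p ^ n \<le> colength (PIdl c <+> bracket_ideal N n) * p ^ n" by (rule mult_right_mono) simp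
    also note C[of n]
    finally show ?thesis .
  qed
  then show ?thesis by blast
qed

text \<open>The zero ideal has Frobenius degree \<open>p^d\<close> times that of \<open>M\<close>, so the comparisons \<open>frob_length_upper\<close>
  and \<open>frob_length_lower\<close> with \<open>P = 0\<close> can be divided by the degree of \<open>M\<close>.\<close>

lemma colength_frobenius_power:
  shows "\<exists>c1\<in>carrier R - {\<zero>}. \<exists>c2\<in>carrier R - {\<zero>}. \<forall>A n. ideal A R \<longrightarrow> bracket_ideal N n \<subseteq> A \<longrightarrow>
     colength (frobenius_power R A p) \<le> p ^ d * colength A + colength (frobenius_power R A p <+> PIdl c2) \<and>
     p ^ d * colength A \<le> colength (frobenius_power R A p) + p ^ d * colength (A <+> PIdl c1)"
proof -
  obtain es c where es: "set es \<subseteq> carrier R" "frob_indep {\<zero>} es" and c: "c \<in> carrier R - {\<zero>}"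
    "PIdl (c [^] p) \<subseteq> frob_span {\<zero>} (carrier R) es"
    using frob_basis_exists[OF zeroprimeideal] .
  define a where "a = frob_degree M"
  have a: "a \<ge> 1" unfolding a_def by (rule frob_degree_pos[OF M_prime])
  have len: "length es = p ^ d * a"
    using frob_basis_length[OF zeroprimeideal es c] frob_degree[OF zeroprimeideal] frob_degree_zero a_def by simp
  have cc: "c \<in> carrier R" and cp: "c [^] p \<in> carrier R - {\<zero>}" using c power_nonzero by auto
  have "colength B \<le> p ^ d * colength A + colength (B <+> PIdl (c [^] p)) \<and>
     p ^ d * colength A \<le> colength B + p ^ d * colength (A <+> PIdl c)"
    if A: "ideal A R" "bracket_ideal N n \<subseteq> A" and B_def: "B = frobenius_power R A p" for A B n
  proof -
    have cA: "A \<subseteq> carrier R" using ideal.Icarr[OF A(1)] by auto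
    have B: "ideal B R" unfolding B_def by (rule frobenius_power_ideal[OF cA])
    have AB: "x [^] p \<in> B" if "x \<in> A" for x unfolding B_def by (rule frobenius_power_mem[OF cA that])
    have zero: "{\<zero>} \<subseteq> A" "{\<zero>} \<subseteq> B"
      using A B additive_subgroup.zero_closed ideal.axioms(1) by blast+
    have tB: "bracket_ideal N (Suc n) \<subseteq> B"
      using frobenius_power_Suc_subset[OF bracket_base_sub cA] A(2) unfolding bracket_ideal_def B_def .
    have B': "ideal (B <+> PIdl (c [^] p)) R" and A': "ideal (A <+> PIdl c) R"
      using cp cc by (auto intro!: add_PIdl_ideal A B)
    have tB': "bracket_ideal N (Suc n) \<subseteq> B <+> PIdl (c [^] p)" and tA': "bracket_ideal N n \<subseteq> A <+> PIdl c"
      using add_PIdl_props(1)[OF B, of "c [^] p"] add_PIdl_props(1)[OF A(1) cc] cp tB A by auto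
    note LA = local_length_above_bracket_ideal[OF A] and LB = local_length_above_bracket_ideal[OF B tB]
      and LA' = local_length_above_bracket_ideal[OF A' tA'] and LB' = local_length_above_bracket_ideal[OF B' tB']
    have scale: "local_length p M K (carrier R) = enat (a * colength K)"
      if "ideal K R" "local_length 1 M K (carrier R) = enat (colength K)" for K
      using local_length_frob_scale[OF M_prime that(1)] that(2) by (simp add: a_def)
    have "local_length p M B (carrier R) \<le> enat (length es) * local_length 1 M A (carrier R)
     + local_length p M (B <+> PIdl (c [^] p)) (carrier R)"
      by (rule frob_length_upper[OF zeroprimeideal M_prime es cc c(2) A(1) zero(1) B zero(2) AB])
    then have "a * colength B \<le> a * (p ^ d * colength A + colength (B <+> PIdl (c [^] p)))"
      unfolding LA scale[OF B LB] scale[OF B' LB'] len by (simp add: algebra_simps)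
    moreover have "enat (length es) * local_length 1 M A (carrier R) \<le> local_length p M B (carrier R)
     + enat (length es) * local_length 1 M (A <+> PIdl c) (carrier R)"
    proof (rule frob_length_lower[OF zeroprimeideal M_prime es cc c(2) A(1) zero(1)])
      fix z assume z: "z \<in> B"
      show "z \<in> carrier R" using z ideal.Icarr[OF B] by blast
      show "z \<otimes> c [^] p \<in> frob_span {\<zero>} A es"
        using frob_power_mem_span[OF zeroideal A(1) es(1) cc c(2)] z by (simp add: B_def frobenius_power_def)
    qed
    then have "a * (p ^ d * colength A) \<le> a * (colength B + p ^ d * colength (A <+> PIdl c))"
      unfolding LA LA' scale[OF B LB] len by (simp add: algebra_simps)
    ultimately show ?thesis using a by simp
  qed
  then show ?thesis using c(1) cp by blast
qed

text \<open>The assumptions on \<open>k\<close> and \<open>k'\<close> hold for \<open>k = \<lceil>s p^n\<rceil>\<close> and \<open>k' = \<lceil>s p^(n+1)\<rceil>\<close>. Passing from \<open>A = h_ideal n k\<close> to its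
  Frobenius power multiplies the colength by \<open>p^d\<close> up to an error; the Frobenius power is contained in
  \<open>h_ideal (Suc n) k'\<close>, and the element \<open>c\<close> from \<open>frobenius_power_comparison\<close> brings it back. All errors are
  of the type in \<open>hypersurface_bound\<close>.\<close>

lemma colength_recursion:
  "\<exists>C. \<forall>n k k'. k' \<le> N * p ^ Suc n \<longrightarrow> k \<le> N * p ^ n \<longrightarrow> p * k < k' + p \<longrightarrow> k' \<le> p * k \<longrightarrow>
    colength (h_ideal (Suc n) k') * p ^ n \<le> p ^ d * colength (h_ideal n k) * p ^ n + C * p ^ (n * d) \<and>
    p ^ d * colength (h_ideal n k) * p ^ n \<le> colength (h_ideal (Suc n) k') * p ^ n + C * p ^ (n * d)"
proof -
  obtain c1 c2 where c1: "c1 \<in> carrier R" "c1 \<noteq> \<zero>" and c2: "c2 \<in> carrier R" "c2 \<noteq> \<zero>"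
    and c12: "\<And>A n. ideal A R \<Longrightarrow> bracket_ideal N n \<subseteq> A \<Longrightarrow>
     colength (frobenius_power R A p) \<le> p ^ d * colength A + colength (frobenius_power R A p <+> PIdl c2) \<and>
     p ^ d * colength A \<le> colength (frobenius_power R A p) + p ^ d * colength (A <+> PIdl c1)"
    using colength_frobenius_power[of N] by blast
  obtain c3 where c3: "c3 \<in> carrier R" "c3 \<noteq> \<zero>"
    and c3': "\<And>a k x. p * k < a + p \<Longrightarrow> x \<in> ideal_pow I a \<Longrightarrow> x \<otimes> c3 \<in> frobenius_power R (ideal_pow I k) p"
    using frobenius_power_comparison[OF I_ideal p_pos] by blast
  obtain C1 where C1: "\<And>n K. ideal K R \<Longrightarrow> bracket_ideal N n \<subseteq> K \<Longrightarrow> colength (K <+> PIdl c1) * p ^ n \<le> C1 * p ^ (n * d)"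
    using hypersurface_bound[OF c1] by metis
  obtain C2 where C2: "\<And>n K. ideal K R \<Longrightarrow> bracket_ideal N n \<subseteq> K \<Longrightarrow> colength (K <+> PIdl c2) * p ^ n \<le> C2 * p ^ (n * d)"
    using hypersurface_bound[OF c2] by metis
  obtain C3 where C3: "\<And>n K. ideal K R \<Longrightarrow> bracket_ideal N n \<subseteq> K \<Longrightarrow> colength (K <+> PIdl c3) * p ^ n \<le> C3 * p ^ (n * d)"
    using hypersurface_bound[OF c3] by metis
  define C where "C = p ^ d * C1 + p ^ d * C2 + p ^ d * C3"
  have "colength (h_ideal (Suc n) k') * p ^ n \<le> p ^ d * colength (h_ideal n k) * p ^ n + C * p ^ (n * d) \<and>
    p ^ d * colength (h_ideal n k) * p ^ n \<le> colength (h_ideal (Suc n) k') * p ^ n + C * p ^ (n * d)"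
    if k: "k' \<le> N * p ^ Suc n" "k \<le> N * p ^ n" "p * k < k' + p" "k' \<le> p * k" for n k k'
  proof -
    define A where "A = h_ideal n k"
    define A' where "A' = h_ideal (Suc n) k'"
    define B where "B = frobenius_power R A p"
    have A: "ideal A R" and A': "ideal A' R" unfolding A_def A'_def by (rule h_ideal_ideal)+
    have cA: "A \<subseteq> carrier R" using ideal.Icarr[OF A] by auto
    have B: "ideal B R" unfolding B_def by (rule frobenius_power_ideal[OF cA])
    have tA: "bracket_ideal N n \<subseteq> A" and tA': "bracket_ideal N (Suc n) \<subseteq> A'"
      unfolding A_def A'_def using k by (auto intro!: bracket_ideal_subset[THEN subsetD])
    have frobJ: "frobenius_power R J (p ^ Suc n) \<subseteq> B"
      using frobenius_power_Suc_subset[OF J_closed cA] h_ideal_upper(2) unfolding A_def B_def by blast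
    have tB: "bracket_ideal N (Suc n) \<subseteq> B"
      using frobenius_power_Suc_subset[OF bracket_base_sub cA] tA unfolding bracket_ideal_def B_def .
    have BA': "B \<subseteq> A'" unfolding B_def
    proof (rule frobenius_power_least[OF A'])
      fix f assume "f \<in> A"
      then have "f \<in> ideal_pow I k <+> frobenius_power R J (p ^ n)" by (simp add: A_def h_ideal_def)
      then obtain x y where xy: "x \<in> ideal_pow I k" "y \<in> frobenius_power R J (p ^ n)" "f = x \<oplus> y" by (rule set_addE)
      have carr: "x \<in> carrier R" "y \<in> carrier R" using xy ideal_pow_sub ideal.Icarr[OF frob_J_ideal] by blast+
      have "f [^] p = x [^] p \<oplus> y [^] p"
        using additive_power_p carr xy by (simp add: additive_power_def)
      moreover have "x [^] p \<in> ideal_pow I k'"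
        using ideal_pow_power[OF I_ideal xy(1), of p] ideal_pow_antimono[OF I_ideal, of k' "k * p"] k(4) by (auto simp: mult.commute)
      moreover have "y [^] p \<in> frobenius_power R J (p ^ Suc n)"
        by (rule frobenius_power_step[OF additive_power_p p_pos J_closed xy(2)])
      ultimately show "f [^] p \<in> A'" unfolding A'_def h_ideal_def by (simp add: set_addI)
    qed
    have A'B: "x \<otimes> c3 \<in> B" if "x \<in> A'" for x
    proof -
      have "A' \<subseteq> colon B c3" unfolding A'_def
      proof (rule h_ideal_least[OF colon_ideal[OF B c3(1)]])
        show "ideal_pow I k' \<subseteq> colon B c3"
        proof
          fix x assume x: "x \<in> ideal_pow I k'"
          have "frobenius_power R (ideal_pow I k) p \<subseteq> B"
            unfolding B_def A_def using h_ideal_upper ideal.Icarr[OF h_ideal_ideal] by (intro frobenius_power_mono) blast+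
          then show "x \<in> colon B c3" using c3'[OF k(3) x] x ideal_pow_sub by (auto simp: colon_def)
        qed
        show "frobenius_power R J (p ^ Suc n) \<subseteq> colon B c3" using frobJ subset_colon[OF B c3(1)] by blast
      qed
      then show ?thesis using that by (auto simp: colon_def)
    qed
    have 1: "colength A' \<le> colength B" by (rule colength_mono[OF B A' tB BA'])
    have 2: "colength B \<le> colength A' + colength (B <+> PIdl c3)"
      by (rule colength_colon_le[OF B A' tB BA' c3(1) A'B])
    have 3: "colength B \<le> p ^ d * colength A + colength (B <+> PIdl c2)"
      and 4: "p ^ d * colength A \<le> colength B + p ^ d * colength (A <+> PIdl c1)"
      using c12[OF A tA] unfolding B_def by auto
    have e1: "colength (A <+> PIdl c1) * p ^ n \<le> C1 * p ^ (n * d)" by (rule C1[OF A tA])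
    have Suc_bound: "m * p ^ n \<le> p ^ d * C' * p ^ (n * d)" if "m * p ^ Suc n \<le> C' * p ^ (Suc n * d)" for m C'
    proof -
      have "m * p ^ n \<le> m * p ^ Suc n" using p_pos by simp
      also have "\<dots> \<le> C' * p ^ (Suc n * d)" by (rule that)
      finally show ?thesis by (simp add: power_add algebra_simps)
    qed
    have e2: "colength (B <+> PIdl c2) * p ^ n \<le> p ^ d * C2 * p ^ (n * d)" by (rule Suc_bound[OF C2[OF B tB]])
    have e3: "colength (B <+> PIdl c3) * p ^ n \<le> p ^ d * C3 * p ^ (n * d)" by (rule Suc_bound[OF C3[OF B tB]])
    have "colength A' * p ^ n \<le> (p ^ d * colength A + colength (B <+> PIdl c2)) * p ^ n"
      using 1 3 by (intro mult_right_mono) auto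
    also have "\<dots> \<le> p ^ d * colength A * p ^ n + C * p ^ (n * d)"
      using e2 unfolding C_def distrib_right by linarith
    finally have up: "colength A' * p ^ n \<le> p ^ d * colength A * p ^ n + C * p ^ (n * d)" .
    have "p ^ d * colength A * p ^ n \<le> (colength A' + colength (B <+> PIdl c3) + p ^ d * colength (A <+> PIdl c1)) * p ^ n"
      using 2 4 by (intro mult_right_mono) auto
    also have "\<dots> = colength A' * p ^ n + colength (B <+> PIdl c3) * p ^ n + p ^ d * (colength (A <+> PIdl c1) * p ^ n)"
      by (simp add: algebra_simps)
    also have "\<dots> \<le> colength A' * p ^ n + p ^ d * C3 * p ^ (n * d) + p ^ d * (C1 * p ^ (n * d))"
      by (intro add_mono mult_left_mono e3 e1) auto
    also have "\<dots> \<le> colength A' * p ^ n + C * p ^ (n * d)"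
      unfolding C_def distrib_right by (simp add: mult.assoc)
    finally show ?thesis using up unfolding A_def A'_def by blast
  qed
  then show ?thesis by blast
qed

text \<open>A nonzero \<open>f\<close> in \<open>I\<close> multiplies \<open>h_ideal n k\<close> into \<open>h_ideal n (Suc k)\<close>. If \<open>I\<close> is zero, all its positive powers agree;
  but its zeroth power is the unit ideal, whence \<open>1 \<le> k\<close>.\<close>

lemma colength_step:
  "\<exists>C. \<forall>n k. 1 \<le> k \<longrightarrow> Suc k \<le> N * p ^ n \<longrightarrow> colength (h_ideal n k) \<le> colength (h_ideal n (Suc k)) \<and>
    colength (h_ideal n (Suc k)) * p ^ n \<le> colength (h_ideal n k) * p ^ n + C * p ^ (n * d)"
proof -
  have mono: "colength (h_ideal n k) \<le> colength (h_ideal n (Suc k))" if "Suc k \<le> N * p ^ n" for n k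
    using that by (intro colength_mono[of _ _ N n] h_ideal_ideal bracket_ideal_subset h_ideal_antimono) auto
  show ?thesis
  proof (cases "I = {\<zero>}")
    case True
    have "ideal_pow I (Suc k) = {\<zero>}" for k
      using ideal_prod_inter[OF ideal_pow_ideal[OF I_ideal, of k] I_ideal] True
        additive_subgroup.zero_closed[OF ideal.axioms(1)[OF ideal_pow_ideal[OF I_ideal, of "Suc k"]]]
      by (auto simp: ideal_pow_Suc)
    then have "ideal_pow I (Suc k) = ideal_pow I k" if "1 \<le> k" for k using that by (cases k) simp_all
    then have "h_ideal n (Suc k) = h_ideal n k" if "1 \<le> k" for n k using that by (simp add: h_ideal_def)
    then show ?thesis by (intro exI[of _ 0]) simp
  next
    case False
    then obtain f where f: "f \<in> I" "f \<noteq> \<zero>"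
      using additive_subgroup.zero_closed[OF ideal.axioms(1)[OF I_ideal]] by blast
    then have fc: "f \<in> carrier R" using ideal.Icarr[OF I_ideal] by auto
    obtain C where C: "\<And>n K. ideal K R \<Longrightarrow> bracket_ideal N n \<subseteq> K \<Longrightarrow> colength (K <+> PIdl f) * p ^ n \<le> C * p ^ (n * d)"
      using hypersurface_bound[OF fc f(2)] by metis
    have "colength (h_ideal n (Suc k)) * p ^ n \<le> colength (h_ideal n k) * p ^ n + C * p ^ (n * d)"
      if k: "Suc k \<le> N * p ^ n" for n k
    proof -
      let ?K = "h_ideal n (Suc k)" and ?K' = "h_ideal n k"
      note K = h_ideal_ideal[of n "Suc k"] and K' = h_ideal_ideal[of n k]
      have t: "bracket_ideal N n \<subseteq> ?K" by (rule bracket_ideal_subset[OF k])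
      have "?K' \<subseteq> colon ?K f"
      proof (rule h_ideal_least[OF colon_ideal[OF K fc]])
        show "ideal_pow I k \<subseteq> colon ?K f"
        proof
          fix x assume x: "x \<in> ideal_pow I k"
          have "x \<otimes> f \<in> ideal_pow I (k + 1)" by (rule ideal_pow_mult[OF I_ideal x ideal_pow_1[OF I_ideal f(1)]])
          then show "x \<in> colon ?K f" using h_ideal_upper(1)[of "Suc k" n] x ideal_pow_sub by (auto simp: colon_def)
        qed
        show "frobenius_power R J (p ^ n) \<subseteq> colon ?K f"
          using h_ideal_upper(2) subset_colon[OF K fc] by blast
      qed
      then have "colength ?K \<le> colength ?K' + colength (?K <+> PIdl f)"
        by (intro colength_colon_le[OF K K' t h_ideal_antimono fc]) (auto simp: colon_def)
      then have "colength ?K * p ^ n \<le> (colength ?K' + colength (?K <+> PIdl f)) * p ^ n" by (rule mult_right_mono) simp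
      also have "\<dots> \<le> colength ?K' * p ^ n + C * p ^ (n * d)" using C[OF K t] by (simp add: algebra_simps)
      finally show ?thesis .
    qed
    then show ?thesis using mono by blast
  qed
qed

lemma h_ideal_finite: "local_length 1 M (h_ideal n k) (carrier R) = enat (colength (h_ideal n k))"
proof -
  have "k * 1 \<le> k * p ^ n" using p_pos by (intro mult_left_mono) (auto simp: Suc_le_eq)
  then show ?thesis
    by (intro local_length_above_bracket_ideal[of _ k n] h_ideal_ideal bracket_ideal_subset) simp
qed

end

section \<open>Scaled limits\<close>

lemma nat_ceiling_bounds:
  fixes s :: real and p n N :: nat
  assumes p: "p > 0"
  shows "s \<le> real N \<Longrightarrow> nat \<lceil>s * real p ^ n\<rceil> \<le> N * p ^ n"
    and "nat \<lceil>s * real p ^ Suc n\<rceil> \<le> p * nat \<lceil>s * real p ^ n\<rceil>"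
    and "p * nat \<lceil>s * real p ^ n\<rceil> < nat \<lceil>s * real p ^ Suc n\<rceil> + p"
proof -
  have le: "nat \<lceil>x\<rceil> \<le> m" if "x \<le> real m" for x :: real and m :: nat
    using that by (simp add: nat_le_iff ceiling_le_iff)
  show "nat \<lceil>s * real p ^ n\<rceil> \<le> N * p ^ n" if "s \<le> real N"
  proof -
    have "s * real p ^ n \<le> real N * real p ^ n" using that by (intro mult_right_mono) auto
    then show ?thesis by (simp add: nat_le_iff ceiling_le_iff)
  qed
  let ?k = "nat \<lceil>s * real p ^ n\<rceil>" and ?k' = "nat \<lceil>s * real p ^ Suc n\<rceil>"
  have "s * real p ^ Suc n = real p * (s * real p ^ n)" by simp
  also have "\<dots> \<le> real p * real ?k" by (intro mult_left_mono real_nat_ceiling_ge) auto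
  finally have "s * real p ^ Suc n \<le> real (p * ?k)" by (simp only: of_nat_mult)
  then show "?k' \<le> p * ?k" by (rule le)
  show "p * ?k < ?k' + p"
  proof (cases "?k = 0")
    case False
    then have "real ?k < s * real p ^ n + 1" using ceiling_correct[of "s * real p ^ n"] by linarith
    then have "real p * real ?k < real p * (s * real p ^ n + 1)" using p by (intro mult_strict_left_mono) auto
    also have "\<dots> = s * real p ^ Suc n + real p" by (simp add: algebra_simps)
    also have "\<dots> \<le> real ?k' + real p" by (intro add_right_mono real_nat_ceiling_ge)
    finally have "real (p * ?k) < real (?k' + p)" by simp
    then show ?thesis by (simp only: of_nat_less_iff)
  qed (use p in simp)
qed

text \<open>Consecutive \<open>f n s\<close> differ by at most \<open>C / p^n\<close>, and the geometric series of these bounds gives both the limit and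
  the rate. Between \<open>x\<close> and \<open>y\<close> the index \<open>\<lceil>s p^n\<rceil>\<close> moves by at most \<open>(y - x) p^n + 1\<close> steps, each of which
  changes \<open>f n\<close> by at most \<open>D / p^n\<close>; the extra step disappears in the limit.\<close>

lemma scaled_limit_exists:
  fixes g :: "nat \<Rightarrow> nat \<Rightarrow> nat" and p d :: nat and f :: "nat \<Rightarrow> real \<Rightarrow> real"
  assumes p: "p \<ge> 2"
    and rec: "\<And>N. \<exists>C. \<forall>n k k'. k' \<le> N * p ^ Suc n \<longrightarrow> k \<le> N * p ^ n \<longrightarrow> p * k < k' + p \<longrightarrow> k' \<le> p * k \<longrightarrow>
      g (Suc n) k' * p ^ n \<le> p ^ d * g n k * p ^ n + C * p ^ (n * d) \<and>
      p ^ d * g n k * p ^ n \<le> g (Suc n) k' * p ^ n + C * p ^ (n * d)"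
    and step: "\<And>N. \<exists>C. \<forall>n k. 1 \<le> k \<longrightarrow> Suc k \<le> N * p ^ n \<longrightarrow> g n k \<le> g n (Suc k) \<and>
      g n (Suc k) * p ^ n \<le> g n k * p ^ n + C * p ^ (n * d)"
    and f: "\<And>n s. f n s = real (g n (nat \<lceil>s * real p ^ n\<rceil>)) / real p ^ (n * d)"
  shows "\<exists>h :: real \<Rightarrow> real.
      (\<forall>s\<^sub>1 s\<^sub>2. \<exists>C. \<forall>s \<in> {s\<^sub>1..s\<^sub>2}. \<forall>n. \<bar>h s - f n s\<bar> \<le> C / real p ^ n) \<and>
      (\<forall>s. (\<lambda>n. f n s) \<longlonglongrightarrow> h s) \<and>
      (\<forall>K. compact K \<longrightarrow> uniform_limit K f h sequentially) \<and>
      (\<forall>s\<^sub>1 s\<^sub>2. 0 < s\<^sub>1 \<and> s\<^sub>1 < s\<^sub>2 \<longrightarrow>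
         (\<exists>C'. \<forall>x \<in> {s\<^sub>1..s\<^sub>2}. \<forall>y \<in> {s\<^sub>1..s\<^sub>2}. \<bar>h x - h y\<bar> \<le> C' * \<bar>x - y\<bar>))"
proof -
  have p0: "real p > 0" using p by simp
  have pn: "real p ^ n > 0" for n using p0 by simp
  have "\<exists>C\<ge>0. \<forall>s n m. s \<le> real N \<longrightarrow> n \<le> m \<longrightarrow> \<bar>f m s - f n s\<bar> \<le> C / real p ^ n" for N
  proof -
    obtain C where C: "\<And>n k k'. k' \<le> N * p ^ Suc n \<Longrightarrow> k \<le> N * p ^ n \<Longrightarrow> p * k < k' + p \<Longrightarrow> k' \<le> p * k \<Longrightarrow>
      g (Suc n) k' * p ^ n \<le> p ^ d * g n k * p ^ n + C * p ^ (n * d) \<and>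
      p ^ d * g n k * p ^ n \<le> g (Suc n) k' * p ^ n + C * p ^ (n * d)"
      using rec[of N] by blast
    have one: "\<bar>f (Suc n) s - f n s\<bar> \<le> C / real p ^ n" if s: "s \<le> real N" for s n
    proof -
      let ?k = "nat \<lceil>s * real p ^ n\<rceil>" and ?k' = "nat \<lceil>s * real p ^ Suc n\<rceil>"
      define G G' where "G = real (g n ?k)" and "G' = real (g (Suc n) ?k')"
      have "g (Suc n) ?k' * p ^ n \<le> p ^ d * g n ?k * p ^ n + C * p ^ (n * d) \<and>
         p ^ d * g n ?k * p ^ n \<le> g (Suc n) ?k' * p ^ n + C * p ^ (n * d)"
        using p s by (intro C nat_ceiling_bounds) auto
      then have "real (g (Suc n) ?k' * p ^ n) \<le> real (p ^ d * g n ?k * p ^ n + C * p ^ (n * d))"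
         "real (p ^ d * g n ?k * p ^ n) \<le> real (g (Suc n) ?k' * p ^ n + C * p ^ (n * d))"
        by (simp_all only: of_nat_le_iff)
      then have "G' * real p ^ n \<le> real p ^ d * G * real p ^ n + C * real p ^ (n * d)"
         "real p ^ d * G * real p ^ n \<le> G' * real p ^ n + C * real p ^ (n * d)"
        by (simp_all add: G_def G'_def)
      then have "\<bar>G' - real p ^ d * G\<bar> * real p ^ n \<le> C * real p ^ (n * d)"
        using pn[of n] by (simp add: abs_if algebra_simps)
      then have 1: "\<bar>G' - real p ^ d * G\<bar> \<le> C * real p ^ (n * d) / real p ^ n"
        using pn[of n] by (simp add: pos_le_divide_eq)
      have "f (Suc n) s - f n s = (G' - real p ^ d * G) / real p ^ (Suc n * d)"
        using p0 by (simp add: f G_def G'_def power_add field_simps)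
      then have "\<bar>f (Suc n) s - f n s\<bar> = \<bar>G' - real p ^ d * G\<bar> / real p ^ (Suc n * d)"
        using pn[of "Suc n * d"] by (simp add: abs_divide)
      also have "\<dots> \<le> (C * real p ^ (n * d) / real p ^ n) / real p ^ (Suc n * d)"
        using 1 pn[of "Suc n * d"] by (intro divide_right_mono) auto
      also have "\<dots> = C / real p ^ n / real p ^ d" using p0 by (simp add: power_add field_simps)
      also have "\<dots> \<le> C / real p ^ n / 1" using p by (intro divide_left_mono) auto
      finally show ?thesis by simp
    qed
    have "\<bar>f (n + j) s - f n s\<bar> \<le> 2 * C * (1 / real p ^ n - 1 / real p ^ (n + j))" if s: "s \<le> real N" for s n j
    proof (induction j)
      case (Suc j)
      have "1 / real p ^ (n + j) \<le> 2 * (1 / real p ^ (n + j) - 1 / real p ^ (n + Suc j))"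
        using p p0 by (simp add: field_simps)
      then have "C * (1 / real p ^ (n + j)) \<le> C * (2 * (1 / real p ^ (n + j) - 1 / real p ^ (n + Suc j)))"
        by (intro mult_left_mono) auto
      moreover have "\<bar>f (Suc (n + j)) s - f (n + j) s\<bar> \<le> C * (1 / real p ^ (n + j))" using one[OF s, of "n + j"] by simp
      ultimately have "\<bar>f (Suc (n + j)) s - f (n + j) s\<bar> \<le> C * (2 * (1 / real p ^ (n + j) - 1 / real p ^ (n + Suc j)))"
        by (rule order_trans[rotated])
      also have "\<dots> = 2 * C * (1 / real p ^ (n + j) - 1 / real p ^ (n + Suc j))" by simp
      finally have "\<bar>f (n + Suc j) s - f (n + j) s\<bar> \<le> 2 * C * (1 / real p ^ (n + j) - 1 / real p ^ (n + Suc j))"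
        by simp
      then show ?case using Suc by (simp add: algebra_simps)
    qed simp
    moreover have "2 * C * (1 / real p ^ n - 1 / real p ^ (n + j)) \<le> 2 * C / real p ^ n" for n j
    proof -
      have "2 * C * (1 / real p ^ n - 1 / real p ^ (n + j)) \<le> 2 * C * (1 / real p ^ n)"
        using pn[of "n + j"] by (intro mult_left_mono) auto
      then show ?thesis by simp
    qed
    ultimately have "\<bar>f (n + j) s - f n s\<bar> \<le> 2 * C / real p ^ n" if "s \<le> real N" for s n j
      using that by (meson order_trans)
    then have "\<bar>f m s - f n s\<bar> \<le> 2 * C / real p ^ n" if "s \<le> real N" "n \<le> m" for s n m
      using that by (metis le_add_diff_inverse)
    then show ?thesis by (intro exI[of _ "2 * real C"]) auto
  qed
  then obtain C where C0: "\<And>N. C N \<ge> 0" and C: "\<And>N s n m. s \<le> real N \<Longrightarrow> n \<le> m \<Longrightarrow> \<bar>f m s - f n s\<bar> \<le> C N / real p ^ n"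
    by metis
  have small: "(\<lambda>n. c / real p ^ n) \<longlonglongrightarrow> 0" for c
    using tendsto_mult_right_zero[OF LIMSEQ_inverse_realpow_zero, of "real p" c] p by (simp add: divide_inverse)
  have conv: "convergent (\<lambda>n. f n s)" for s
  proof -
    obtain N where N: "s \<le> real N" using real_arch_simple by blast
    have "Cauchy (\<lambda>n. f n s)"
    proof (rule CauchyI')
      fix e :: real assume "e > 0"
      then have "\<forall>\<^sub>F n in sequentially. C N / real p ^ n < e" by (rule order_tendstoD(2)[OF small])
      then obtain n0 where n0: "C N / real p ^ n0 < e / 1" by (auto simp: eventually_sequentially)
      have n1: "C N / real p ^ n \<le> C N / real p ^ n0" if "n \<ge> n0" for n
        using that p C0 by (intro divide_left_mono power_increasing) auto
      have "\<forall>m\<ge>n0. \<forall>n>m. dist (f m s) (f n s) < e"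
      proof (intro allI impI)
        fix m n assume mn: "m \<ge> n0" "n > m"
        then have "\<bar>f n s - f m s\<bar> \<le> C N / real p ^ m" using C[OF N] by auto
        then show "dist (f m s) (f n s) < e" using n1[OF mn(1)] n0 by (simp add: dist_real_def abs_minus_commute)
      qed
      then show "\<exists>M. \<forall>m\<ge>M. \<forall>n>m. dist (f m s) (f n s) < e" by blast
    qed
    then show ?thesis by (simp add: Cauchy_convergent_iff)
  qed
  define h where "h s = lim (\<lambda>n. f n s)" for s
  have lim: "(\<lambda>n. f n s) \<longlonglongrightarrow> h s" for s using conv convergent_LIMSEQ_iff by (auto simp: h_def)
  have bound: "\<bar>h s - f n s\<bar> \<le> C N / real p ^ n" if s: "s \<le> real N" for s n N
  proof (rule tendsto_upperbound)
    show "(\<lambda>m. \<bar>f m s - f n s\<bar>) \<longlonglongrightarrow> \<bar>h s - f n s\<bar>" by (intro tendsto_intros lim)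
    show "\<forall>\<^sub>F m in sequentially. \<bar>f m s - f n s\<bar> \<le> C N / real p ^ n"
      using C[OF s] by (auto simp: eventually_sequentially)
  qed simp
  have 1: "\<exists>C. \<forall>s \<in> {s\<^sub>1..s\<^sub>2}. \<forall>n. \<bar>h s - f n s\<bar> \<le> C / real p ^ n" for s\<^sub>1 s\<^sub>2
  proof -
    obtain N where N: "s\<^sub>2 \<le> real N" using real_arch_simple by blast
    then show ?thesis using bound by (intro exI[of _ "C N"]) auto
  qed
  have 2: "uniform_limit K f h sequentially" if K: "compact K" for K
  proof (rule uniform_limitI)
    fix e :: real assume e: "e > 0"
    obtain B where "\<forall>x\<in>K. norm x \<le> B" using compact_imp_bounded[OF K] by (auto simp: bounded_iff)
    then have B: "x \<le> B" if "x \<in> K" for x using that by (fastforce simp: abs_le_iff)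
    obtain N where N: "B \<le> real N" using real_arch_simple by blast
    have "\<forall>\<^sub>F n in sequentially. C N / real p ^ n < e" by (rule order_tendstoD(2)[OF small e])
    then show "\<forall>\<^sub>F n in sequentially. \<forall>x\<in>K. dist (f n x) (h x) < e"
    proof eventually_elim
      case (elim n)
      show ?case
      proof
        fix x assume "x \<in> K"
        then have "\<bar>h x - f n x\<bar> \<le> C N / real p ^ n" using B N by (intro bound) force
        then show "dist (f n x) (h x) < e" using elim by (simp add: dist_real_def abs_minus_commute)
      qed
    qed
  qed
  have 3: "\<exists>C'. \<forall>x \<in> {s\<^sub>1..s\<^sub>2}. \<forall>y \<in> {s\<^sub>1..s\<^sub>2}. \<bar>h x - h y\<bar> \<le> C' * \<bar>x - y\<bar>"
    if s: "0 < s\<^sub>1" for s\<^sub>1 s\<^sub>2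
  proof -
    obtain N where N: "s\<^sub>2 \<le> real N" using real_arch_simple by blast
    obtain D where D: "\<And>n k. 1 \<le> k \<Longrightarrow> Suc k \<le> N * p ^ n \<Longrightarrow> g n k \<le> g n (Suc k) \<and>
      g n (Suc k) * p ^ n \<le> g n k * p ^ n + D * p ^ (n * d)"
      using step[of N] by blast
    have D': "\<bar>real (g n (k + j)) - real (g n k)\<bar> * real p ^ n \<le> real j * (D * real p ^ (n * d))"
      if "1 \<le> k" "k + j \<le> N * p ^ n" for n k j
      using that(2)
    proof (induction j)
      case (Suc j)
      have *: "g n (k + j) \<le> g n (Suc (k + j))" "g n (Suc (k + j)) * p ^ n \<le> g n (k + j) * p ^ n + D * p ^ (n * d)"
        using D[of "k + j" n] that(1) Suc.prems by auto
      have "real (g n (Suc (k + j)) * p ^ n) \<le> real (g n (k + j) * p ^ n + D * p ^ (n * d))"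
        using *(2) by (simp only: of_nat_le_iff)
      then have "\<bar>real (g n (Suc (k + j))) - real (g n (k + j))\<bar> * real p ^ n \<le> D * real p ^ (n * d)"
        using *(1) by (simp add: algebra_simps)
      moreover have "\<bar>real (g n (k + j)) - real (g n k)\<bar> * real p ^ n \<le> real j * (D * real p ^ (n * d))"
        using Suc by simp
      moreover have "\<bar>real (g n (k + Suc j)) - real (g n k)\<bar> * real p ^ n \<le>
         (\<bar>real (g n (Suc (k + j))) - real (g n (k + j))\<bar> + \<bar>real (g n (k + j)) - real (g n k)\<bar>) * real p ^ n"
        using pn[of n] by (intro mult_right_mono) auto
      ultimately show ?case by (simp add: algebra_simps)
    qed simp
    have le: "\<bar>h y - h x\<bar> \<le> real D * (y - x)" if xy: "x \<in> {s\<^sub>1..s\<^sub>2}" "y \<in> {s\<^sub>1..s\<^sub>2}" "x \<le> y" for x y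
    proof (rule LIMSEQ_le)
      show "(\<lambda>n. \<bar>f n y - f n x\<bar>) \<longlonglongrightarrow> \<bar>h y - h x\<bar>" by (intro tendsto_intros lim)
      have "(\<lambda>n. real D * (y - x) + real D / real p ^ n) \<longlonglongrightarrow> real D * (y - x) + 0"
        by (intro tendsto_intros small)
      then show "(\<lambda>n. real D * (y - x) + real D / real p ^ n) \<longlonglongrightarrow> real D * (y - x)" by simp
      have "\<bar>f n y - f n x\<bar> \<le> real D * (y - x) + real D / real p ^ n" for n
      proof -
        let ?kx = "nat \<lceil>x * real p ^ n\<rceil>" and ?ky = "nat \<lceil>y * real p ^ n\<rceil>"
        have xp: "0 < x * real p ^ n" using xy s pn[of n] by simp
        then have kx: "1 \<le> ?kx" by (simp add: Suc_le_eq)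
        have "x * real p ^ n \<le> y * real p ^ n" using xy pn[of n] by (intro mult_right_mono) auto
        then have kxy: "?kx \<le> ?ky" by (intro nat_mono ceiling_mono)
        define j where "j = ?ky - ?kx"
        have ky: "?ky = ?kx + j" using kxy by (simp add: j_def)
        have "?kx + j \<le> N * p ^ n" using nat_ceiling_bounds(1)[of p y N n] p xy N ky by auto
        then have 1: "\<bar>real (g n ?ky) - real (g n ?kx)\<bar> * real p ^ n \<le> real j * (D * real p ^ (n * d))"
          using D'[OF kx] ky by metis
        have "real ?ky < y * real p ^ n + 1"
          using xp \<open>x * real p ^ n \<le> y * real p ^ n\<close> ceiling_correct[of "y * real p ^ n"] by linarith
        then have "real j \<le> (y - x) * real p ^ n + 1"
          using real_nat_ceiling_ge[of "x * real p ^ n"] kxy unfolding j_def of_nat_diff[OF kxy] by (simp add: algebra_simps)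
        then have "real j * (D * real p ^ (n * d)) \<le> ((y - x) * real p ^ n + 1) * (D * real p ^ (n * d))"
          by (intro mult_right_mono) auto
        with 1 have "\<bar>real (g n ?ky) - real (g n ?kx)\<bar> * real p ^ n \<le> ((y - x) * real p ^ n + 1) * (D * real p ^ (n * d))"
          by linarith
        then have 2: "\<bar>real (g n ?ky) - real (g n ?kx)\<bar> \<le> ((y - x) * real p ^ n + 1) * (D * real p ^ (n * d)) / real p ^ n"
          using pn[of n] by (simp add: pos_le_divide_eq)
        have "\<bar>f n y - f n x\<bar> = \<bar>real (g n ?ky) - real (g n ?kx)\<bar> / real p ^ (n * d)"
          using pn[of "n * d"] by (simp add: f abs_divide flip: diff_divide_distrib)
        also have "\<dots> \<le> (((y - x) * real p ^ n + 1) * (D * real p ^ (n * d)) / real p ^ n) / real p ^ (n * d)"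
          using 2 pn[of "n * d"] by (intro divide_right_mono) auto
        also have "\<dots> = real D * (y - x) + real D / real p ^ n"
          using p0 by (simp add: field_simps)
        finally show ?thesis .
      qed
      then show "\<exists>N. \<forall>n\<ge>N. \<bar>f n y - f n x\<bar> \<le> real D * (y - x) + real D / real p ^ n" by blast
    qed
    have "\<bar>h x - h y\<bar> \<le> real D * \<bar>x - y\<bar>" if "x \<in> {s\<^sub>1..s\<^sub>2}" "y \<in> {s\<^sub>1..s\<^sub>2}" for x y
      using le[OF that] le[OF that(2,1)] by (cases "x \<le> y") (auto simp: abs_minus_commute)
    then show ?thesis by blast
  qed
  show ?thesis using 1 2 3 lim by (intro exI[of _ h]) blast
qed

section \<open>Local rings and Krull dimension\<close>

context noetherian_domain
begin

text \<open>Noetherian induction replaces the existence of maximal ideals above a proper ideal: a proper prime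
  without proper ideals above it is maximal.\<close>

lemma noetherian_local_proper_subset:
  assumes loc: "local_ring R \<mm>" and K: "ideal K R" "K \<noteq> carrier R"
  shows "K \<subseteq> \<mm>"
proof -
  have "K \<noteq> carrier R \<longrightarrow> K \<subseteq> \<mm>" using K(1)
  proof (induction rule: ideal_induct)
    case (prime P)
    show ?case
    proof
      assume P: "P \<noteq> carrier R"
      show "P \<subseteq> \<mm>"
      proof (cases "\<exists>K. ideal K R \<and> P \<subset> K \<and> K \<noteq> carrier R")
        case True then show ?thesis using prime(2) by blast
      next
        case False
        have "maximalideal P R"
        proof (rule maximalidealI)
          show "ideal P R" using prime(1) by (rule primeideal.axioms(1))
          show "carrier R \<noteq> P" using P by simp
          fix K assume "ideal K R" "P \<subseteq> K" "K \<subseteq> carrier R"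
          then show "K = P \<or> K = carrier R" using False by blast
        qed
        then show ?thesis using loc by (auto simp: local_ring_def)
      qed
    qed
  next
    case (step K a)
    show ?case
    proof
      assume "K \<noteq> carrier R"
      show "K \<subseteq> \<mm>"
      proof (cases "K <+> PIdl a = carrier R")
        case False
        then show ?thesis using step(5) add_PIdl_props(1)[OF step(1,2)] by blast
      next
        case True
        have "colon K a \<noteq> carrier R"
        proof
          assume "colon K a = carrier R"
          then have "\<one> \<otimes> a \<in> K" using one_closed unfolding colon_def by blast
          then show False using step(2,3) by simp
        qed
        then show ?thesis using step(4) subset_colon[OF step(1,2)] by blast
      qed
    qed
  qed simp
  then show ?thesis using K by simp
qed

lemma unit_outside_maximal:
  assumes loc: "local_ring R \<mm>" and s: "s \<in> carrier R - \<mm>" shows "s \<in> Units R"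
proof -
  have "PIdl s = carrier R"
  proof (rule ccontr)
    assume "PIdl s \<noteq> carrier R"
    then have "PIdl s \<subseteq> \<mm>" using s by (intro noetherian_local_proper_subset[OF loc] cgenideal_ideal) auto
    then show False using s mem_PIdl[of s] by auto
  qed
  then have "\<one> \<in> PIdl s" by simp
  then obtain y where "y \<in> carrier R" "\<one> = y \<otimes> s" by (auto simp: cgenideal_def)
  then show ?thesis using s by (auto simp: Units_def m_comm intro!: bexI[of _ y])
qed

end

lemma prime_inclusion_power_iff:
  "(P, Q) \<in> prime_inclusion R ^^ n \<and> primeideal P R \<longleftrightarrow>
    (\<exists>f. f 0 = P \<and> f n = Q \<and> (\<forall>i\<le>n. primeideal (f i) R) \<and> (\<forall>i<n. f i \<subset> f (Suc i)))"
proof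
  assume *: "(P, Q) \<in> prime_inclusion R ^^ n \<and> primeideal P R"
  then obtain f where f: "f 0 = P" "f n = Q" "\<forall>i<n. (f i, f (Suc i)) \<in> prime_inclusion R"
    by (auto simp: relpow_fun_conv)
  have "primeideal (f i) R" if "i \<le> n" for i
    using that * f by (cases i) (auto simp: prime_inclusion_def)
  then show "\<exists>f. f 0 = P \<and> f n = Q \<and> (\<forall>i\<le>n. primeideal (f i) R) \<and> (\<forall>i<n. f i \<subset> f (Suc i))"
    using f by (intro exI[of _ f]) (auto simp: prime_inclusion_def)
next
  assume "\<exists>f. f 0 = P \<and> f n = Q \<and> (\<forall>i\<le>n. primeideal (f i) R) \<and> (\<forall>i<n. f i \<subset> f (Suc i))"
  then obtain f where f: "f 0 = P" "f n = Q" "\<forall>i\<le>n. primeideal (f i) R" "\<forall>i<n. f i \<subset> f (Suc i)" by blast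
  then have "(P, Q) \<in> prime_inclusion R ^^ n"
    unfolding relpow_fun_conv prime_inclusion_def by (intro exI[of _ f]) auto
  then show "(P, Q) \<in> prime_inclusion R ^^ n \<and> primeideal P R" using f by auto
qed

lemma krull_dimension_eq:
  fixes R :: "('a, 'b) ring_scheme"
  shows "krull_dimension R = Sup {enat n | n. \<exists>P Q. (P, Q) \<in> prime_inclusion R ^^ n \<and> primeideal P R}"
proof -
  have "(\<exists>f :: nat \<Rightarrow> 'a set. (\<forall>i\<le>n. primeideal (f i) R) \<and> (\<forall>i<n. f i \<subset> f (Suc i))) \<longleftrightarrow>
     (\<exists>P Q. (P, Q) \<in> prime_inclusion R ^^ n \<and> primeideal P R)" for n
  proof
    assume "\<exists>f :: nat \<Rightarrow> 'a set. (\<forall>i\<le>n. primeideal (f i) R) \<and> (\<forall>i<n. f i \<subset> f (Suc i))"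
    then obtain f :: "nat \<Rightarrow> 'a set" where "(\<forall>i\<le>n. primeideal (f i) R) \<and> (\<forall>i<n. f i \<subset> f (Suc i))" ..
    then have "(f 0, f n) \<in> prime_inclusion R ^^ n \<and> primeideal (f 0) R"
      by (subst prime_inclusion_power_iff) (intro exI[of _ f] conjI refl; simp)
    then show "\<exists>P Q. (P, Q) \<in> prime_inclusion R ^^ n \<and> primeideal P R" by (intro exI)
  next
    assume "\<exists>P Q. (P, Q) \<in> prime_inclusion R ^^ n \<and> primeideal P R"
    then obtain P Q where "(P, Q) \<in> prime_inclusion R ^^ n \<and> primeideal P R" by (elim exE)
    then obtain f where "f 0 = P \<and> f n = Q \<and> (\<forall>i\<le>n. primeideal (f i) R) \<and> (\<forall>i<n. f i \<subset> f (Suc i))"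
      unfolding prime_inclusion_power_iff ..
    then show "\<exists>f :: nat \<Rightarrow> 'a set. (\<forall>i\<le>n. primeideal (f i) R) \<and> (\<forall>i<n. f i \<subset> f (Suc i))"
      by (elim conjE, intro exI[of _ f] conjI)
  qed
  then show ?thesis unfolding krull_dimension_def by simp
qed

lemma Sup_enat_attained:
  assumes "Sup {enat n | n. T n} = enat d" "T m" shows "T d" "T n \<Longrightarrow> n \<le> d"
proof -
  have le: "n \<le> d" if "T n" for n
  proof -
    have "enat n \<le> Sup {enat n | n. T n}" using that by (intro Sup_upper) auto
    then show ?thesis using assms by simp
  qed
  then show "T n \<Longrightarrow> n \<le> d" .
  have "finite {n. T n}" by (rule finite_subset[of _ "{..d}"]) (use le in auto)
  then have *: "Max {n. T n} \<in> {n. T n}" using assms(2) by (intro Max_in) auto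
  have "Sup {enat n | n. T n} \<le> enat (Max {n. T n})"
    using \<open>finite {n. T n}\<close> by (intro Sup_least) (auto intro: Max_ge)
  then have "d \<le> Max {n. T n}" using assms(1) by simp
  then have "Max {n. T n} = d" using * le by (intro antisym) auto
  then show "T d" using * by simp
qed

section \<open>The h-function\<close>

theorem theoremA:
  fixes R :: "('a, 'c) ring_scheme" and \<mm> I J :: "'a set" and p d :: nat
  assumes "noetherian_domain R"
    and "local_ring R \<mm>"
    and "Factorial_Ring.prime p"
    and "ring_characteristic R = p"
    and "krull_dimension R = enat d"
    and "F_finite R p"
    and "ideal I R"
    and "ideal J R"
    and "primary_to R \<mm> (I <+>\<^bsub>R\<^esub> J)"
  shows "(\<forall>n s. h_length R p I J n s \<noteq> \<infinity>) \<and>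
    (\<exists>h :: real \<Rightarrow> real.
      (\<forall>s\<^sub>1 s\<^sub>2. \<exists>C. \<forall>s \<in> {s\<^sub>1..s\<^sub>2}. \<forall>n.
         \<bar>h s - h_fun R p I J n s / real p ^ (n * d)\<bar> \<le> C / real p ^ n) \<and>
      (\<forall>s. (\<lambda>n. h_fun R p I J n s / real p ^ (n * d)) \<longlonglongrightarrow> h s) \<and>
      (\<forall>K. compact K \<longrightarrow>
         uniform_limit K (\<lambda>n s. h_fun R p I J n s / real p ^ (n * d)) h sequentially) \<and>
      (\<forall>s\<^sub>1 s\<^sub>2. 0 < s\<^sub>1 \<and> s\<^sub>1 < s\<^sub>2 \<longrightarrow>
         (\<exists>C'. \<forall>x \<in> {s\<^sub>1..s\<^sub>2}. \<forall>y \<in> {s\<^sub>1..s\<^sub>2}. \<bar>h x - h y\<bar> \<le> C' * \<bar>x - y\<bar>)))"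
proof -
  interpret noetherian_domain R by fact
  have max: "maximalideal \<mm> R" using assms(2) by (simp add: local_ring_def)
  have m_prime: "primeideal \<mm> R" by (rule maximalideal_prime[OF max])
  interpret m: primeideal \<mm> R by fact
  have proper: "K \<subseteq> \<mm>" if "ideal K R" "K \<noteq> carrier R" for K
    by (rule noetherian_local_proper_subset[OF assms(2) that])
  have proper_prime: "P \<subseteq> \<mm>" if "primeideal P R" for P
    using that by (intro proper) (auto simp: primeideal_def primeideal_axioms_def)
  have char: "[p] \<cdot>\<^bsub>R\<^esub> \<one>\<^bsub>R\<^esub> = \<zero>\<^bsub>R\<^esub>"
    using add.pow_ord_eq_1[of "\<one>\<^bsub>R\<^esub>"] assms(4) by (simp add: ring_characteristic_def add_pow_def)
  have frob: "additive_power p" by (rule additive_power_prime[OF assms(3) char])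
  have p1: "p > 1" using assms(3) prime_gt_1_nat by auto
  let ?T = "\<lambda>n. \<exists>P Q. (P, Q) \<in> prime_inclusion R ^^ n \<and> primeideal P R"
  have T: "Sup {enat n | n. ?T n} = enat d" using assms(5) krull_dimension_eq by metis
  have T0: "?T 0" using m_prime by auto
  note Td = Sup_enat_attained(1)[where T = ?T, OF T T0]
    and T_le = Sup_enat_attained(2)[where T = ?T, OF T T0]
  have no_longer: "prime_inclusion R ^^ n = {}" if n: "n > d" for n
  proof (rule ccontr)
    assume "prime_inclusion R ^^ n \<noteq> {}"
    then obtain P Q where PQ: "(P, Q) \<in> prime_inclusion R ^^ n" by auto
    obtain k where k: "n = Suc k" using n by (cases n) auto
    have "primeideal P R" using PQ relpow_Suc_D2[OF PQ[unfolded k]] by (auto simp: prime_inclusion_def)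
    then have "n \<le> d" using PQ T_le by blast
    then show False using n by simp
  qed
  have chain: "({\<zero>\<^bsub>R\<^esub>}, \<mm>) \<in> prime_inclusion R ^^ d"
  proof -
    obtain P Q where PQ: "(P, Q) \<in> prime_inclusion R ^^ d" "primeideal P R" using Td by blast
    have Q: "primeideal Q R" using PQ by (cases d) (auto simp: prime_inclusion_def)
    have "P = {\<zero>\<^bsub>R\<^esub>}"
    proof (rule ccontr)
      assume "P \<noteq> {\<zero>\<^bsub>R\<^esub>}"
      moreover have "{\<zero>\<^bsub>R\<^esub>} \<subseteq> P" using PQ(2) additive_subgroup.zero_closed ideal.axioms(1) primeideal.axioms(1) by blast
      ultimately have "({\<zero>\<^bsub>R\<^esub>}, P) \<in> prime_inclusion R" using PQ zeroprimeideal by (auto simp: prime_inclusion_def)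
      then have "({\<zero>\<^bsub>R\<^esub>}, Q) \<in> prime_inclusion R ^^ Suc d" using PQ(1) by (rule relpow_Suc_I2)
      then show False using no_longer[of "Suc d"] by auto
    qed
    moreover have "Q = \<mm>"
    proof (rule ccontr)
      assume "Q \<noteq> \<mm>"
      then have "(Q, \<mm>) \<in> prime_inclusion R" using Q m_prime proper_prime[OF Q] by (auto simp: prime_inclusion_def)
      then have "(P, \<mm>) \<in> prime_inclusion R ^^ Suc d" using PQ(1) by (intro relpow_Suc_I)
      then show False using no_longer[of "Suc d"] by auto
    qed
    ultimately show ?thesis using PQ by simp
  qed
  have prime_over: "P = \<mm>" if P: "primeideal P R" "I <+>\<^bsub>R\<^esub> J \<subseteq> P" for P
  proof
    show "P \<subseteq> \<mm>" by (rule proper_prime[OF P(1)])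
    show "\<mm> \<subseteq> P"
    proof
      interpret P: primeideal P R by fact
      fix x assume "x \<in> \<mm>"
      then have "x \<in> radical_ideal R (I <+>\<^bsub>R\<^esub> J)" using assms(9) by (simp add: primary_to_def)
      then obtain k :: nat where k: "x \<in> carrier R" "x [^]\<^bsub>R\<^esub> k \<in> P" using P by (auto simp: radical_ideal_def)
      then show "x \<in> P" using P.outside_power[of x k] by blast
    qed
  qed
  interpret H: h_function_setting R p \<mm> d I J
  proof (intro_locales)
    show "F_finite_domain_axioms R p"
      using p1 frob F_finite_generators[OF assms(6)] by (rule F_finite_domain_axioms.intro)
    show "F_finite_local_domain_axioms R \<mm> d"
      using m_prime proper chain no_longer by (rule F_finite_local_domain_axioms.intro)
    show "h_function_setting_axioms R \<mm> I J"
      using assms(7,8) prime_over by (rule h_function_setting_axioms.intro)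
  qed
  have h_len: "h_length R p I J n s = enat (H.colength (H.h_ideal n (nat \<lceil>s * real p ^ n\<rceil>)))" for n s
  proof -
    have "h_length R p I J n s = module_length R (quotient_module R (H.h_ideal n (nat \<lceil>s * real p ^ n\<rceil>)))"
      unfolding h_length_def H.h_ideal_def ideal_power_eq ..
    also have "\<dots> = local_length 1 \<mm> (H.h_ideal n (nat \<lceil>s * real p ^ n\<rceil>)) (carrier R)"
      using m.outside_one by (intro module_length_quotient H.h_ideal_ideal unit_outside_maximal[OF assms(2)]) auto
    finally show ?thesis by (simp only: H.h_ideal_finite)
  qed
  have "\<exists>h :: real \<Rightarrow> real.
      (\<forall>s\<^sub>1 s\<^sub>2. \<exists>C. \<forall>s \<in> {s\<^sub>1..s\<^sub>2}. \<forall>n.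
         \<bar>h s - h_fun R p I J n s / real p ^ (n * d)\<bar> \<le> C / real p ^ n) \<and>
      (\<forall>s. (\<lambda>n. h_fun R p I J n s / real p ^ (n * d)) \<longlonglongrightarrow> h s) \<and>
      (\<forall>K. compact K \<longrightarrow>
         uniform_limit K (\<lambda>n s. h_fun R p I J n s / real p ^ (n * d)) h sequentially) \<and>
      (\<forall>s\<^sub>1 s\<^sub>2. 0 < s\<^sub>1 \<and> s\<^sub>1 < s\<^sub>2 \<longrightarrow>
         (\<exists>C'. \<forall>x \<in> {s\<^sub>1..s\<^sub>2}. \<forall>y \<in> {s\<^sub>1..s\<^sub>2}. \<bar>h x - h y\<bar> \<le> C' * \<bar>x - y\<bar>))"
    using p1 H.colength_recursion H.colength_step
    by (intro scaled_limit_exists[where g = "\<lambda>n k. H.colength (H.h_ideal n k)"])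
      (auto simp: h_fun_def h_len)
  then show ?thesis using h_len by simp
qed

end
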